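(* Let $n\ge 1$. The (unordered) collection of singular values of an $n\times n$ GUE matrix has the same distribution as the union of the distinct non-zero singular values of two independent anti-GUE matrices, one of order $n$ and the other of order $n+1$. In terms of probability densities: for all $x_1,x_2,\dots,x_n\ge 0$, $$\sum_{\epsilon\in\{\pm1\}^n}p_n^{\mathrm H}(\epsilon_1x_1,\epsilon_2x_2,\dots,\epsilon_nx_n)=\frac{1}{\binom{n}{\lfloor n/2\rfloor}}\sum_{S,T}p_n^{\mathrm{aG}}\big(x_{s_1},x_{s_2},\dots,x_{s_{\lfloor n/2\rfloor}}\big)\,p_{n+1}^{\mathrm{aG}}\big(x_{t_1},x_{t_2},\dots,x_{t_{\lceil n/2\rceil}}\big),$$ where the right-hand sum runs over the $\binom{n}{\lfloor n/2\rfloor}$ ways to partition $\{1,2,\dots,n\}$ into two sets $S=\{s_1,\dots,s_{\lfloor n/2\rfloor}\}$ and $T=\{t_1,\dots,t_{\lceil n/2\rceil}\}$.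
   Context: GUE: $\mathrm{GUE}_n$ is the law of $\frac12(G+G^{\mathrm H})$, where $G$ is an $n\times n$ matrix whose entries have real and imaginary parts that are all independent standard normal, and $G^{\mathrm H}$ is the conjugate transpose. (So diagonal entries are standard normal, and the real and imaginary parts of entries above the diagonal are independent normals of mean $0$ and variance $\frac12$.) The joint density on $\mathbb R^n$ (with respect to Lebesgue measure) of its eigenvalues, taken as a randomly permuted $n$-tuple, is $$p_n^{\mathrm H}(x_1,\dots,x_n)=c_n^{\mathrm H}\prod_{1\le i<j\le n}|x_i-x_j|^2\exp\Big(-\tfrac12\sum_{i=1}^nx_i^2\Big),$$ with $c_n^{\mathrm H}$ the constant making it a probability density. Anti-GUE: the anti-GUE of order $N$ is the law of $M=\mathrm iK$, where $K$ is an $N\times N$ real skew-symmetric matrix whose entries above the diagonal are independent standard normals. Write $N=2m+r$ with $r\in\{0,1\}$. The eigenvalues of $M$ come in pairs $\pm\theta$ (plus one zero eigenvalue if $r=1$), and almost surely $M$ has exactly $m$ distinct non-zero singular values. Their joint density on $[0,\infty)^m$ (as a randomly permuted $m$-tuple) is $$p_N^{\mathrm{aG}}(\theta_1,\dots,\theta_m)=c_N^{\mathrm{aG}}\prod_{j=1}^m\theta_j^{2r}\prod_{1\le j<k\le m}(\theta_j^2-\theta_k^2)^2\exp\Big(-\tfrac12\sum_{j=1}^m\theta_j^2\Big),$$ with $c_N^{\mathrm{aG}}$ the normalizing constant (for $N=1$ there are no arguments and $p_1^{\mathrm{aG}}=1$). *)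

theory Defs
  imports
    "HOL-Probability.Probability"
    "HOL-Computational_Algebra.Polynomial"
    "Jordan_Normal_Form.Char_Poly"
    "Jordan_Normal_Form.Schur_Decomposition"
begin

section \<open>Random matrices\<close>

text \<open>The Borel sigma-algebra on complex \<open>n \<times> n\<close> matrices, generated by the entry maps.\<close>

definition mat_borel :: "nat \<Rightarrow> complex mat measure" where
  "mat_borel n = sigma (carrier_mat n n)
     {{A \<in> carrier_mat n n. A $$ (i, j) \<in> B} | i j B. i < n \<and> j < n \<and> B \<in> sets borel}"

abbreviation std_normal :: "real measure" where
  "std_normal \<equiv> density lborel (\<lambda>x. ennreal (std_normal_density x))"

text \<open>
  In the index \<open>(i, j, b)\<close> of a Gaussian variable, \<open>(i, j)\<close> is a matrix position; \<open>b = False\<close>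
  selects the real part and \<open>b = True\<close> the imaginary part of the entry.
\<close>

definition gue_matrix :: "nat \<Rightarrow> (nat \<times> nat \<times> bool \<Rightarrow> real) \<Rightarrow> complex mat" where
  "gue_matrix n g =
     (let G = mat n n (\<lambda>(i, j). Complex (g (i, j, False)) (g (i, j, True)))
      in (1 / 2) \<cdot>\<^sub>m (G + mat_adjoint G))"

definition GUE :: "nat \<Rightarrow> complex mat measure" where
  "GUE n = distr (PiM ({..<n} \<times> {..<n} \<times> UNIV) (\<lambda>_. std_normal)) (mat_borel n) (gue_matrix n)"

definition skew_matrix :: "nat \<Rightarrow> (nat \<times> nat \<Rightarrow> real) \<Rightarrow> real mat" where
  "skew_matrix N g = mat N N (\<lambda>(i, j).
     if i < j then g (i, j) else if j < i then - g (j, i) else 0)"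

definition antiGUE :: "nat \<Rightarrow> complex mat measure" where
  "antiGUE N = distr (PiM {(i, j). i < j \<and> j < N} (\<lambda>_. std_normal)) (mat_borel N)
     (\<lambda>g. \<i> \<cdot>\<^sub>m map_mat complex_of_real (skew_matrix N g))"

lemma space_mat_borel [simp]: "space (mat_borel n) = carrier_mat n n"
  unfolding mat_borel_def by (rule space_measure_of) auto

lemma measurable_mat_borelI:
  fixes f :: "'a \<Rightarrow> complex mat"
  assumes "\<And>\<omega>. \<omega> \<in> space M \<Longrightarrow> f \<omega> \<in> carrier_mat n n"
    and "\<And>i j. i < n \<Longrightarrow> j < n \<Longrightarrow> (\<lambda>\<omega>. f \<omega> $$ (i, j)) \<in> borel_measurable M"
  shows "f \<in> measurable M (mat_borel n)"
  unfolding mat_borel_def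
proof (rule measurable_measure_of)
  fix Y :: "complex mat set" assume "Y \<in> {{A \<in> carrier_mat n n. A $$ (i, j) \<in> B} | i j B. i < n \<and> j < n \<and> B \<in> sets borel}"
  then obtain i j B where ij: "i < n" "j < n" and B: "B \<in> sets borel"
    and Y: "Y = {A \<in> carrier_mat n n. A $$ (i, j) \<in> B}" by blast
  have "f -` Y \<inter> space M = (\<lambda>\<omega>. f \<omega> $$ (i, j)) -` B \<inter> space M"
    using assms(1) unfolding Y by auto
  also have "\<dots> \<in> sets M"
    using assms(2)[OF ij] B by (rule measurable_sets)
  finally show "f -` Y \<inter> space M \<in> sets M" .
qed (use assms(1) in auto)

lemma mat_adjoint_index:
  assumes "A \<in> carrier_mat n m" "i < m" "j < n"
  shows "mat_adjoint A $$ (i, j) = conjugate (A $$ (j, i))"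
  using assms unfolding mat_adjoint_def by (auto simp: mat_of_rows_def)

lemma measurable_gue_matrix:
  "gue_matrix n \<in> measurable (PiM ({..<n} \<times> {..<n} \<times> UNIV) (\<lambda>_. std_normal)) (mat_borel n)"
    (is "_ \<in> measurable ?P _")
proof (rule measurable_mat_borelI)
  fix g show "gue_matrix n g \<in> carrier_mat n n"
    by (auto simp: gue_matrix_def Let_def mat_adjoint_def)
next
  fix i j assume ij: "i < n" "j < n"
  have *: "(\<lambda>g. g (a, b, c)) \<in> borel_measurable ?P" if "a < n" "b < n" for a b and c :: bool
  proof -
    have "(\<lambda>g. g (a, b, c)) \<in> measurable ?P std_normal"
      by (rule measurable_component_singleton) (use that in auto)
    thus ?thesis by simp
  qed
  have "gue_matrix n g $$ (i, j) =
      (1 / 2) * ((complex_of_real (g (i, j, False)) + \<i> * complex_of_real (g (i, j, True))) +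
      (complex_of_real (g (j, i, False)) - \<i> * complex_of_real (g (j, i, True))))" for g
    using ij
    by (simp add: gue_matrix_def Let_def mat_adjoint_def mat_of_rows_def complex_eq_iff)
  moreover have "(\<lambda>g. (1 / 2) *
      ((complex_of_real (g (i, j, False)) + \<i> * complex_of_real (g (i, j, True))) +
      (complex_of_real (g (j, i, False)) - \<i> * complex_of_real (g (j, i, True)))))
      \<in> borel_measurable ?P"
    using *[OF ij] *[OF ij(2) ij(1)]
    by (intro borel_measurable_times borel_measurable_add borel_measurable_diff
        borel_measurable_const) simp_all
  ultimately show "(\<lambda>g. gue_matrix n g $$ (i, j)) \<in> borel_measurable ?P"
    by presburger
qed

lemma prob_space_GUE: "prob_space (GUE n)"
  unfolding GUE_def
  by (intro prob_space.prob_space_distr measurable_gue_matrix prob_space_PiM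
      prob_space_normal_density) simp

lemma measurable_antigue_matrix:
  "(\<lambda>g. \<i> \<cdot>\<^sub>m map_mat complex_of_real (skew_matrix N g))
     \<in> measurable (PiM {(i, j). i < j \<and> j < N} (\<lambda>_. std_normal)) (mat_borel N)"
    (is "?f \<in> measurable ?P _")
proof (rule measurable_mat_borelI)
  fix g show "?f g \<in> carrier_mat N N"
    by (auto simp: skew_matrix_def)
next
  fix i j assume ij: "i < N" "j < N"
  have *: "(\<lambda>g. g (a, b)) \<in> borel_measurable ?P" if "a < b" "b < N" for a b
  proof -
    have "(\<lambda>g. g (a, b)) \<in> measurable ?P std_normal"
      by (rule measurable_component_singleton) (use that in auto)
    thus ?thesis by simp
  qed
  consider "i < j" | "j < i" | "i = j" by linarith
  thus "(\<lambda>g. ?f g $$ (i, j)) \<in> borel_measurable ?P"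
  proof cases
    case 1
    thus ?thesis using ij * by (simp add: skew_matrix_def)
  next
    case 2
    thus ?thesis using ij * by (simp add: skew_matrix_def)
  next
    case 3
    thus ?thesis using ij by (simp add: skew_matrix_def)
  qed
qed

lemma prob_space_antiGUE: "prob_space (antiGUE N)"
  unfolding antiGUE_def
  by (intro prob_space.prob_space_distr measurable_antigue_matrix prob_space_PiM
      prob_space_normal_density) simp

section \<open>Singular values\<close>

text \<open>
  The singular values of a square matrix \<open>A\<close> are the square roots of the eigenvalues of
  \<open>A\<^sup>H A\<close>, counted with algebraic multiplicity; these eigenvalues are real and nonnegative.
\<close>

definition singular_values :: "complex mat \<Rightarrow> real multiset" where
  "singular_values A = image_mset (\<lambda>z. sqrt (Re z)) (proots (char_poly (mat_adjoint A * A)))"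

definition distinct_nonzero_singular_values :: "complex mat \<Rightarrow> real multiset" where
  "distinct_nonzero_singular_values A = mset_set (set_mset (singular_values A) - {0})"

text \<open>
  The usual sigma-algebra on finite point configurations with multiplicity (as for point
  processes), generated by the maps that count the points in a Borel set.
\<close>

definition mset_borel :: "real multiset measure" where
  "mset_borel = sigma UNIV
     {{X. size (filter_mset (\<lambda>x. x \<in> B) X) = k} | B k. B \<in> sets borel}"

section \<open>Joint densities\<close>

text \<open>A point of \<open>\<real>\<^sup>n\<close> is given by the values of a function at \<open>0, \<dots>, n - 1\<close>.\<close>

definition gue_weight :: "nat \<Rightarrow> (nat \<Rightarrow> real) \<Rightarrow> real" where
  "gue_weight n x =
     (\<Prod>(i, j) \<in> {(i, j). i < j \<and> j < n}. \<bar>x i - x j\<bar>\<^sup>2) * exp (- (1 / 2) * (\<Sum>i<n. (x i)\<^sup>2))"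

definition gue_const :: "nat \<Rightarrow> real" where
  "gue_const n = 1 / (LINT x | PiM {..<n} (\<lambda>_. lborel). gue_weight n x)"

definition gue_density :: "nat \<Rightarrow> (nat \<Rightarrow> real) \<Rightarrow> real" where
  "gue_density n x = gue_const n * gue_weight n x"

definition antigue_weight :: "nat \<Rightarrow> (nat \<Rightarrow> real) \<Rightarrow> real" where
  "antigue_weight N \<theta> =
     (let m = N div 2; r = N mod 2 in
       (\<Prod>j<m. \<theta> j ^ (2 * r)) *
       (\<Prod>(j, k) \<in> {(j, k). j < k \<and> k < m}. ((\<theta> j)\<^sup>2 - (\<theta> k)\<^sup>2)\<^sup>2) *
       exp (- (1 / 2) * (\<Sum>j<m. (\<theta> j)\<^sup>2)))"

definition antigue_const :: "nat \<Rightarrow> real" where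
  "antigue_const N =
     1 / (LINT \<theta>:({..<N div 2} \<rightarrow>\<^sub>E {0..}) | PiM {..<N div 2} (\<lambda>_. lborel). antigue_weight N \<theta>)"

definition antigue_density :: "nat \<Rightarrow> (nat \<Rightarrow> real) \<Rightarrow> real" where
  "antigue_density N \<theta> = antigue_const N * antigue_weight N \<theta>"

text \<open>
  The tuple of the coordinates of \<open>x\<close> with index in the finite set \<open>S\<close>, listed in increasing
  order of the index.
\<close>

definition subtuple :: "(nat \<Rightarrow> real) \<Rightarrow> nat set \<Rightarrow> nat \<Rightarrow> real" where
  "subtuple x S k = x (sorted_list_of_set S ! k)"

end

theory Submission
  imports Defs "HOL-Real_Asymp.Real_Asymp"
begin

text \<open>
  For a GUE or anti-GUE matrix, and likewise for points distributed according to the corresponding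
  eigenvalue density, Gaussian integration by parts along a suitable polynomial vector field
  expresses the expectation of a product of power sums through expectations of products of smaller
  total degree (the loop, or Schwinger-Dyson, equations). The matrix and the density satisfy the
  same recursion, which has only one solution up to normalization, so their moments agree without
  any change of variables to eigenvalue coordinates. The exponential moments are finite, hence the
  even moments determine the law of the random multiset of singular values.

  The sum over signs is computed by writing the squared Vandermonde determinant as a combination of
  sign characters: averaging leaves the squares of determinants whose rows have a prescribed parity
  of exponents. These vanish unless exactly \<open>n div 2\<close> rows are odd, and then they factor into two
  Vandermonde determinants in the squared variables, which are the two anti-GUE weights.
  Integrating this polynomial identity relates the normalizing constants, so these never have to be
  evaluated.
\<close>

section \<open>Gaussian integration by parts\<close>

text \<open>The Gaussian factor of every law is absorbed into a product of standard normals, so one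
  integration by parts serves matrices and densities. On the matrix side the field is the gradient
  of tr M^(k+1) / (k+1); on the density side it is x_i^k, for the anti-GUE 2 x_i^(2k+1). The
  logarithmic derivative of the squared Vandermonde product gives twice the terms with i < j and the
  divergence of the field the diagonal, which together make products of power sums. The obstacle is
  the moment problem for a random multiset. It is reduced to dimension one: with all other
  statistics frozen into a nonnegative weight, a characteristic function determines the weighted
  intensity of the points, and counts are brought in one at a time. Only even moments are at hand,
  because singular values are reached through traces of powers of A^H A, which is also how their
  measurability is shown. The sign identity is used twice: pointwise for the densities, and
  integrated against functions of the multiset for the laws, since sign changes preserve both the
  Gaussian measure and the absolute values.\<close>

abbreviation gauss :: "'i set \<Rightarrow> ('i \<Rightarrow> real) measure" where
  "gauss I \<equiv> PiM I (\<lambda>_. std_normal)"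

lemma prob_space_std_normal: "prob_space std_normal"
  by (intro prob_space_normal_density) simp

lemma prob_space_gauss: "prob_space (gauss I)"
  by (intro prob_space_PiM prob_space_std_normal)

interpretation std_normal: product_prob_space "\<lambda>_. std_normal" I for I
  by (intro product_prob_spaceI prob_space_std_normal)

lemma measurable_gauss_coord: "i \<in> I \<Longrightarrow> (\<lambda>g. g i) \<in> borel_measurable (gauss I)"
  using measurable_component_singleton[of i I "\<lambda>_. std_normal"] by simp

text \<open>Completing the square turns the density times exp(a x) into a multiple of a normal
  density with mean a; the exponentials with a = c and a = -c together dominate exp(c |x|).\<close>

lemma std_normal_exp_integrable: "integrable std_normal (\<lambda>x. exp (c * \<bar>x\<bar>))"
proof -
  have *: "integrable lborel (\<lambda>x. std_normal_density x * exp (a * x))" for a :: real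
  proof -
    have "std_normal_density x * exp (a * x) = exp (a\<^sup>2 / 2) * normal_density a 1 x" for x
      by (simp add: normal_density_def mult_exp_exp power2_eq_square field_simps)
    thus ?thesis by (simp add: integrable_normal_density)
  qed
  have "integrable lborel (\<lambda>x. std_normal_density x * exp (c * x) + std_normal_density x * exp ((- c) * x))"
    by (intro Bochner_Integration.integrable_add *)
  hence "integrable lborel (\<lambda>x. std_normal_density x * exp (c * \<bar>x\<bar>))"
  proof (rule Bochner_Integration.integrable_bound)
    show "AE x in lborel. norm (std_normal_density x * exp (c * \<bar>x\<bar>))
      \<le> norm (std_normal_density x * exp (c * x) + std_normal_density x * exp ((- c) * x))"
    proof (rule AE_I2)
      fix x
      have "0 \<le> std_normal_density x * exp (c * x)" "0 \<le> std_normal_density x * exp ((- c) * x)"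
        by simp_all
      thus "norm (std_normal_density x * exp (c * \<bar>x\<bar>))
        \<le> norm (std_normal_density x * exp (c * x) + std_normal_density x * exp ((- c) * x))"
        by (cases "x \<ge> 0") (simp_all del: mult_nonneg_nonneg zero_le_mult_iff)
    qed
  qed simp
  thus ?thesis by (subst integrable_density) auto
qed

lemma std_normal_density_exp_tendsto:
  "((\<lambda>x. std_normal_density x * exp (c * \<bar>x\<bar>)) \<longlongrightarrow> 0) at_top"
  "((\<lambda>x. std_normal_density x * exp (c * \<bar>x\<bar>)) \<longlongrightarrow> 0) at_bot"
proof -
  have *: "((\<lambda>x. 1 / sqrt (2 * pi) * exp (c * x - x\<^sup>2 / 2)) \<longlongrightarrow> 0) at_top"
    by real_asymp
  have eq: "std_normal_density x * exp (c * \<bar>x\<bar>) = 1 / sqrt (2 * pi) * exp (c * \<bar>x\<bar> - \<bar>x\<bar>\<^sup>2 / 2)" for x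
    by (simp add: std_normal_density_def mult_exp_exp)
  show 1: "((\<lambda>x. std_normal_density x * exp (c * \<bar>x\<bar>)) \<longlongrightarrow> 0) at_top"
    unfolding eq
    by (rule filterlim_compose[OF * filterlim_abs_real])
  show "((\<lambda>x. std_normal_density x * exp (c * \<bar>x\<bar>)) \<longlongrightarrow> 0) at_bot"
    unfolding filterlim_at_bot_mirror using 1 by (simp add: std_normal_density_def)
qed

text \<open>The standard normal density \<phi> satisfies \<phi>' = - x \<phi>, so \<phi> f has
  derivative \<phi> f' - x \<phi> f. The integral of that derivative over the line is zero because
  \<phi> beats every exp(c |x|), which gives both integrability and the boundary limits.\<close>

lemma std_normal_stein:
  fixes f f' :: "real \<Rightarrow> complex"
  assumes deriv: "\<And>x. (f has_vector_derivative f' x) (at x)"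
    and cont: "\<And>x. isCont f' x"
    and bd: "\<And>x. cmod (f x) \<le> C * exp (c * \<bar>x\<bar>)" "\<And>x. cmod (f' x) \<le> C' * exp (c' * \<bar>x\<bar>)"
  shows "(\<integral>x. complex_of_real x * f x \<partial>std_normal) = (\<integral>x. f' x \<partial>std_normal)"
proof -
  have contf: "isCont f x" for x using deriv has_vector_derivative_continuous by blast
  have [measurable]: "f \<in> borel_measurable borel" "f' \<in> borel_measurable borel"
    using contf cont by (auto intro!: borel_measurable_continuous_onI continuous_at_imp_continuous_on)
  have C: "0 \<le> C" using order_trans[OF norm_ge_zero bd(1)[of 0]] by simp
  have int1: "integrable std_normal (\<lambda>x. complex_of_real x * f x)"
  proof (rule Bochner_Integration.integrable_bound)
    show "integrable std_normal (\<lambda>x. C * exp ((c + 1) * \<bar>x\<bar>))"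
      by (intro integrable_mult_right std_normal_exp_integrable)
    show "AE x in std_normal. norm (complex_of_real x * f x) \<le> norm (C * exp ((c + 1) * \<bar>x\<bar>))"
    proof (rule AE_I2)
      fix x :: real
      have "\<bar>x\<bar> \<le> exp \<bar>x\<bar>" using exp_ge_add_one_self[of "\<bar>x\<bar>"] by linarith
      hence "\<bar>x\<bar> * cmod (f x) \<le> exp \<bar>x\<bar> * (C * exp (c * \<bar>x\<bar>))"
        by (intro mult_mono bd) auto
      thus "norm (complex_of_real x * f x) \<le> norm (C * exp ((c + 1) * \<bar>x\<bar>))"
        using C by (simp add: norm_mult algebra_simps exp_add abs_mult)
    qed
  qed simp
  have int2: "integrable std_normal f'"
  proof (rule Bochner_Integration.integrable_bound)
    show "integrable std_normal (\<lambda>x. C' * exp (c' * \<bar>x\<bar>))"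
      by (intro integrable_mult_right std_normal_exp_integrable)
    show "AE x in std_normal. norm (f' x) \<le> norm (C' * exp (c' * \<bar>x\<bar>))"
      using bd(2) order_trans by (intro AE_I2) (smt (verit) real_norm_def)
  qed simp
  have dens: "integrable std_normal h \<longleftrightarrow> integrable lborel (\<lambda>x. std_normal_density x *\<^sub>R h x)"
    "integral\<^sup>L std_normal h = integral\<^sup>L lborel (\<lambda>x. std_normal_density x *\<^sub>R h x)"
    if [measurable]: "h \<in> borel_measurable borel" for h :: "real \<Rightarrow> complex"
    by (rule integrable_density integral_density; auto)+
  have xf: "(\<lambda>x. complex_of_real x * f x) \<in> borel_measurable borel" by measurable
  have i1: "integrable lborel (\<lambda>x. std_normal_density x *\<^sub>R (complex_of_real x * f x))"
    using int1 dens(1)[OF xf] by (rule iffD1[rotated])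
  have i2: "integrable lborel (\<lambda>x. std_normal_density x *\<^sub>R f' x)"
    using int2 dens(1)[of f'] by (rule iffD1[rotated]) measurable
  define H where "H = (\<lambda>x. std_normal_density x *\<^sub>R f x)"
  define H' where "H' = (\<lambda>x. std_normal_density x *\<^sub>R f' x - std_normal_density x *\<^sub>R (complex_of_real x * f x))"
  have dphi: "(std_normal_density has_real_derivative - x * std_normal_density x) (at x)" for x
    unfolding std_normal_density_def
    by (auto intro!: derivative_eq_intros simp: field_simps)
  have dH: "(H has_vector_derivative H' x) (at x)" for x
  proof -
    have "(H has_vector_derivative (std_normal_density x *\<^sub>R f' x + (- x * std_normal_density x) *\<^sub>R f x)) (at x)"
      unfolding H_def by (rule has_vector_derivative_scaleR[OF dphi deriv])
    thus ?thesis by (simp add: H'_def scaleR_conv_of_real algebra_simps)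
  qed
  have cH': "isCont H' x" for x
    unfolding H'_def
    by (intro continuous_intros cont contf DERIV_isCont[OF dphi])
  have Hb: "norm (H x) \<le> norm (C * (std_normal_density x * exp (c * \<bar>x\<bar>)))" for x
    using mult_left_mono[OF bd(1)[of x], of "std_normal_density x"] C
    by (simp add: H_def abs_mult algebra_simps)
  have lim1: "(H \<longlongrightarrow> 0) at_top"
    using tendsto_mult_right_zero[OF std_normal_density_exp_tendsto(1), of C c]
    by (rule Lim_null_comparison[rotated, OF tendsto_norm_zero]) (use Hb in auto)
  have lim2: "(H \<longlongrightarrow> 0) at_bot"
    using tendsto_mult_right_zero[OF std_normal_density_exp_tendsto(2), of C c]
    by (rule Lim_null_comparison[rotated, OF tendsto_norm_zero]) (use Hb in auto)
  have iH': "integrable lborel H'" unfolding H'_def by (intro Bochner_Integration.integrable_diff i1 i2)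
  have "interval_lebesgue_integral lborel (-\<infinity>) \<infinity> H' = 0 - 0"
  proof (rule interval_integral_FTC_integrable)
    show "((H \<circ> real_of_ereal) \<longlongrightarrow> 0) (at_right (-\<infinity>))"
      using lim2 by (simp add: ereal_tendsto_simps)
    show "((H \<circ> real_of_ereal) \<longlongrightarrow> 0) (at_left \<infinity>)"
      using lim1 by (simp add: ereal_tendsto_simps)
  qed (use dH cH' iH' in \<open>auto simp: set_integrable_def\<close>)
  hence "integral\<^sup>L lborel H' = 0"
    by (simp add: interval_lebesgue_integral_def set_lebesgue_integral_def)
  thus ?thesis
    unfolding H'_def Bochner_Integration.integral_diff[OF i2 i1] dens(2)[OF xf] dens(2)[OF \<open>f' \<in> _\<close>]
    by simp
qed

text \<open>An algebra of functions that are integrable under \<open>gauss I\<close> for finite I.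
  The bound is a single exponential of the l1 norm, so it factorizes over the coordinates;
  continuity is asked along coordinate lines only, which is what one-dimensional integration by
  parts needs.\<close>

definition tame :: "'i set \<Rightarrow> (('i \<Rightarrow> real) \<Rightarrow> complex) \<Rightarrow> bool" where
  "tame I F \<longleftrightarrow> F \<in> borel_measurable (gauss I) \<and>
     (\<exists>C c. 0 \<le> c \<and> (\<forall>g. cmod (F g) \<le> C * exp (c * (\<Sum>i\<in>I. \<bar>g i\<bar>)))) \<and>
     (\<forall>g i t. isCont (\<lambda>s. F (g(i := s))) t)"

lemma tame_const: "tame I (\<lambda>_. c)"
  unfolding tame_def
proof (intro conjI)
  show "\<exists>C d. 0 \<le> d \<and> (\<forall>g. cmod c \<le> C * exp (d * (\<Sum>i\<in>I. \<bar>g i\<bar>)))"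
    by (rule exI[of _ "cmod c"], rule exI[of _ 0]) simp
qed auto

lemma tame_coord:
  assumes "finite I" "i \<in> I"
  shows "tame I (\<lambda>g. complex_of_real (g i))"
  unfolding tame_def
proof (intro conjI allI)
  have "\<bar>g i\<bar> \<le> 1 * exp (1 * (\<Sum>i\<in>I. \<bar>g i\<bar>))" for g :: "'a \<Rightarrow> real"
    using member_le_sum[OF assms(2) _ assms(1), of "\<lambda>i. \<bar>g i\<bar>"] exp_ge_add_one_self[of "\<Sum>i\<in>I. \<bar>g i\<bar>"]
    unfolding mult_1_left by linarith
  thus "\<exists>C c. 0 \<le> c \<and> (\<forall>g. cmod (complex_of_real (g i)) \<le> C * exp (c * (\<Sum>i\<in>I. \<bar>g i\<bar>)))"
    by (intro exI[of _ "1::real"]) simp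
  show "isCont (\<lambda>s. complex_of_real ((g(j := s)) i)) t" for g j t
    by (cases "i = j") auto
qed (use assms measurable_gauss_coord in auto)

lemma tame_add:
  assumes "tame I F" "tame I G"
  shows "tame I (\<lambda>g. F g + G g)"
proof -
  obtain C c D d where *: "0 \<le> c" "\<And>g. cmod (F g) \<le> C * exp (c * (\<Sum>i\<in>I. \<bar>g i\<bar>))"
    "0 \<le> d" "\<And>g. cmod (G g) \<le> D * exp (d * (\<Sum>i\<in>I. \<bar>g i\<bar>))"
    using assms unfolding tame_def by metis
  have CD: "C \<ge> 0" "D \<ge> 0"
    using order_trans[OF norm_ge_zero *(2)[of "\<lambda>_. 0"]] order_trans[OF norm_ge_zero *(4)[of "\<lambda>_. 0"]] by auto
  have "cmod (F g + G g) \<le> (C + D) * exp ((c + d) * (\<Sum>i\<in>I. \<bar>g i\<bar>))" for g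
  proof -
    let ?S = "\<Sum>i\<in>I. \<bar>g i\<bar>"
    have S: "0 \<le> ?S" by (simp add: sum_nonneg)
    have "cmod (F g + G g) \<le> C * exp (c * ?S) + D * exp (d * ?S)"
      using *(2,4)[of g] norm_triangle_ineq[of "F g" "G g"] by linarith
    also have "\<dots> \<le> C * exp ((c + d) * ?S) + D * exp ((c + d) * ?S)"
      using CD S *(1,3) by (intro add_mono mult_left_mono) (auto intro!: mult_right_mono)
    finally show ?thesis by (simp add: algebra_simps)
  qed
  hence "\<exists>C c. 0 \<le> c \<and> (\<forall>g. cmod (F g + G g) \<le> C * exp (c * (\<Sum>i\<in>I. \<bar>g i\<bar>)))"
    using *(1,3) by (intro exI[of _ "C + D"] exI[of _ "c + d"]) auto
  thus ?thesis using assms unfolding tame_def by (auto intro!: continuous_intros)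
qed

lemma tame_mult:
  assumes "tame I F" "tame I G"
  shows "tame I (\<lambda>g. F g * G g)"
proof -
  obtain C c D d where *: "0 \<le> c" "\<And>g. cmod (F g) \<le> C * exp (c * (\<Sum>i\<in>I. \<bar>g i\<bar>))"
    "0 \<le> d" "\<And>g. cmod (G g) \<le> D * exp (d * (\<Sum>i\<in>I. \<bar>g i\<bar>))"
    using assms unfolding tame_def by metis
  have "cmod (F g * G g) \<le> (C * D) * exp ((c + d) * (\<Sum>i\<in>I. \<bar>g i\<bar>))" for g
    using mult_mono[OF *(2,4)[of g] order_trans[OF norm_ge_zero *(2)[of g]] norm_ge_zero]
    by (simp add: norm_mult algebra_simps exp_add)
  hence "\<exists>C c. 0 \<le> c \<and> (\<forall>g. cmod (F g * G g) \<le> C * exp (c * (\<Sum>i\<in>I. \<bar>g i\<bar>)))"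
    using *(1,3) by (intro exI[of _ "C * D"] exI[of _ "c + d"]) auto
  thus ?thesis using assms unfolding tame_def by (auto intro!: continuous_intros)
qed

lemma tame_sum: "(\<And>a. a \<in> A \<Longrightarrow> tame I (F a)) \<Longrightarrow> tame I (\<lambda>g. \<Sum>a\<in>A. F a g)"
  by (induction A rule: infinite_finite_induct) (auto intro: tame_const tame_add)

lemma tame_prod: "(\<And>a. a \<in> A \<Longrightarrow> tame I (F a)) \<Longrightarrow> tame I (\<lambda>g. \<Prod>a\<in>A. F a g)"
  by (induction A rule: infinite_finite_induct) (auto intro: tame_const tame_mult)

lemma tame_power: "tame I F \<Longrightarrow> tame I (\<lambda>g. F g ^ k)"
  by (induction k) (auto intro: tame_const tame_mult)

lemma gauss_exp_integrable:
  assumes "finite I"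
  shows "integrable (gauss I) (\<lambda>g. exp (c * (\<Sum>i\<in>I. \<bar>g i\<bar>)))"
proof -
  have "integrable (gauss I) (\<lambda>g. \<Prod>i\<in>I. exp (c * \<bar>g i\<bar>))"
    by (intro std_normal.product_integrable_prod std_normal_exp_integrable assms)
  thus ?thesis using assms by (simp add: exp_sum sum_distrib_left)
qed

lemma tame_integrable:
  assumes "finite I" "tame I F"
  shows "integrable (gauss I) F"
proof -
  obtain C c where *: "0 \<le> c" "\<And>g. cmod (F g) \<le> C * exp (c * (\<Sum>i\<in>I. \<bar>g i\<bar>))"
    using assms(2) unfolding tame_def by metis
  show ?thesis
  proof (rule Bochner_Integration.integrable_bound)
    show "integrable (gauss I) (\<lambda>g. C * exp (c * (\<Sum>i\<in>I. \<bar>g i\<bar>)))"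
      by (intro integrable_mult_right gauss_exp_integrable assms)
    show "F \<in> borel_measurable (gauss I)" using assms(2) unfolding tame_def by blast
    show "AE g in gauss I. norm (F g) \<le> norm (C * exp (c * (\<Sum>i\<in>I. \<bar>g i\<bar>)))"
      using *(2) by (intro AE_I2) (smt (verit) real_norm_def)
  qed
qed

text \<open>Partial derivatives are taken along the lines \<open>g(\<alpha> := s)\<close>, for every
  g, and are required to be tame so that they can in turn be integrated.\<close>

definition grad :: "'i set \<Rightarrow> (('i \<Rightarrow> real) \<Rightarrow> complex) \<Rightarrow> ('i \<Rightarrow> ('i \<Rightarrow> real) \<Rightarrow> complex) \<Rightarrow> bool" where
  "grad I F F' \<longleftrightarrow> tame I F \<and> (\<forall>\<alpha>\<in>I. tame I (F' \<alpha>) \<and>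
     (\<forall>g t. ((\<lambda>s. F (g(\<alpha> := s))) has_vector_derivative F' \<alpha> (g(\<alpha> := t))) (at t)))"

text \<open>Fubini isolates the coordinate \<alpha>. With the others fixed, the exponential bounds
  become one-variable bounds whose constants contain the exponential of the other coordinates, so
  \<open>std_normal_stein\<close> applies to the inner integral.\<close>

lemma gauss_stein:
  assumes "finite I" "\<alpha> \<in> I" "grad I F F'"
  shows "(\<integral>g. complex_of_real (g \<alpha>) * F g \<partial>gauss I) = (\<integral>g. F' \<alpha> g \<partial>gauss I)"
proof -
  define J where "J = I - {\<alpha>}"
  have J: "finite J" "\<alpha> \<notin> J" "I = insert \<alpha> J" using assms by (auto simp: J_def)
  have t: "tame I F" "tame I (F' \<alpha>)"
    and d: "\<And>g t. ((\<lambda>s. F (g(\<alpha> := s))) has_vector_derivative F' \<alpha> (g(\<alpha> := t))) (at t)"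
    using assms unfolding grad_def by auto
  obtain C c where bF: "\<And>g. cmod (F g) \<le> C * exp (c * (\<Sum>i\<in>I. \<bar>g i\<bar>))"
    using t(1) unfolding tame_def by metis
  obtain D e where bF': "\<And>g. cmod (F' \<alpha> g) \<le> D * exp (e * (\<Sum>i\<in>I. \<bar>g i\<bar>))"
    using t(2) unfolding tame_def by metis
  have S: "(\<Sum>i\<in>I. \<bar>(g(\<alpha> := y)) i\<bar>) = \<bar>y\<bar> + (\<Sum>i\<in>J. \<bar>g i\<bar>)" for g and y :: real
  proof -
    have "(\<Sum>i\<in>J. \<bar>(g(\<alpha> := y)) i\<bar>) = (\<Sum>i\<in>J. \<bar>g i\<bar>)"
      using J(2) by (intro sum.cong) auto
    thus ?thesis using J(1,2) unfolding J(3) by (simp add: sum.insert)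
  qed
  have "(\<integral>g. complex_of_real (g \<alpha>) * F g \<partial>gauss I) =
    (\<integral>x. (\<integral>y. complex_of_real y * F (x(\<alpha> := y)) \<partial>std_normal) \<partial>gauss J)"
    using std_normal.product_integral_insert[OF J(1,2), of "\<lambda>g. complex_of_real (g \<alpha>) * F g"]
      tame_integrable[OF assms(1) tame_mult[OF tame_coord[OF assms(1,2)] t(1)]]
    by (simp add: J(3))
  also have "\<dots> = (\<integral>x. (\<integral>y. F' \<alpha> (x(\<alpha> := y)) \<partial>std_normal) \<partial>gauss J)"
  proof (rule Bochner_Integration.integral_cong[OF refl], rule std_normal_stein)
    fix x y
    show "((\<lambda>y. F (x(\<alpha> := y))) has_vector_derivative F' \<alpha> (x(\<alpha> := y))) (at y)" by (rule d)
    show "isCont (\<lambda>y. F' \<alpha> (x(\<alpha> := y))) y" using t(2) unfolding tame_def by blast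
    show "cmod (F (x(\<alpha> := y))) \<le> (C * exp (c * (\<Sum>i\<in>J. \<bar>x i\<bar>))) * exp (c * \<bar>y\<bar>)"
      using bF[of "x(\<alpha> := y)"] unfolding S by (simp add: algebra_simps exp_add)
    show "cmod (F' \<alpha> (x(\<alpha> := y))) \<le> (D * exp (e * (\<Sum>i\<in>J. \<bar>x i\<bar>))) * exp (e * \<bar>y\<bar>)"
      using bF'[of "x(\<alpha> := y)"] unfolding S by (simp add: algebra_simps exp_add)
  qed
  also have "\<dots> = (\<integral>g. F' \<alpha> g \<partial>gauss I)"
    using std_normal.product_integral_insert[OF J(1,2), of "F' \<alpha>"] tame_integrable[OF assms(1) t(2)]
    by (simp add: J(3))
  finally show ?thesis .
qed

lemma grad_const: "grad I (\<lambda>_. c) (\<lambda>_ _. 0)"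
  unfolding grad_def by (auto intro: tame_const)

lemma grad_coord:
  assumes "finite I" "i \<in> I"
  shows "grad I (\<lambda>g. complex_of_real (g i)) (\<lambda>\<alpha> _. if \<alpha> = i then 1 else 0)"
  unfolding grad_def
proof (intro conjI ballI allI)
  fix \<alpha> g t
  show "((\<lambda>s. complex_of_real ((g(\<alpha> := s)) i)) has_vector_derivative (if \<alpha> = i then 1 else 0)) (at t)"
    by (auto intro!: derivative_eq_intros simp: has_vector_derivative_of_real)
qed (use assms in \<open>auto intro: tame_const tame_coord\<close>)

lemma grad_add:
  assumes "grad I F F'" "grad I G G'"
  shows "grad I (\<lambda>g. F g + G g) (\<lambda>\<alpha> g. F' \<alpha> g + G' \<alpha> g)"
  using assms unfolding grad_def by (auto intro!: tame_add has_vector_derivative_add)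

lemma grad_mult:
  assumes "grad I F F'" "grad I G G'"
  shows "grad I (\<lambda>g. F g * G g) (\<lambda>\<alpha> g. F g * G' \<alpha> g + F' \<alpha> g * G g)"
  using assms unfolding grad_def by (auto intro!: tame_add tame_mult has_vector_derivative_mult)

lemma grad_sum:
  assumes "\<And>a. a \<in> A \<Longrightarrow> grad I (F a) (F' a)"
  shows "grad I (\<lambda>g. \<Sum>a\<in>A. F a g) (\<lambda>\<alpha> g. \<Sum>a\<in>A. F' a \<alpha> g)"
  using assms by (induction A rule: infinite_finite_induct) (auto intro: grad_const grad_add)

lemma grad_power:
  assumes "grad I F F'"
  shows "grad I (\<lambda>g. F g ^ k) (\<lambda>\<alpha> g. of_nat k * F g ^ (k - 1) * F' \<alpha> g)"
proof (induction k)
  case (Suc k)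
  have "(\<lambda>\<alpha> g. F g * (of_nat k * F g ^ (k - 1) * F' \<alpha> g) + F' \<alpha> g * F g ^ k)
    = (\<lambda>\<alpha> g. of_nat (Suc k) * F g ^ (Suc k - 1) * F' \<alpha> g)"
    by (cases k) (auto simp: fun_eq_iff algebra_simps)
  thus ?case using grad_mult[OF assms Suc] by simp
qed (use grad_const in simp)

text \<open>The derivative of \<open>F\<close> along the vector field \<open>V\<close>.\<close>

definition drv where
  "drv I V F DF \<longleftrightarrow> (\<exists>F'. grad I F F' \<and> (\<forall>g. DF g = (\<Sum>\<alpha>\<in>I. V \<alpha> g * F' \<alpha> g)))"

lemma drv_const: "drv I V (\<lambda>_. c) (\<lambda>_. 0)"
  unfolding drv_def by (intro exI[of _ "\<lambda>_ _. 0"]) (auto intro: grad_const)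

lemma drv_coord:
  assumes "finite I" "i \<in> I"
  shows "drv I V (\<lambda>g. complex_of_real (g i)) (V i)"
  unfolding drv_def by (rule exI, rule conjI, rule grad_coord[OF assms])
    (simp add: if_distrib[of "(*) _"] sum.delta assms cong: if_cong)

lemma drv_add:
  assumes "drv I V F DF" "drv I V G DG"
  shows "drv I V (\<lambda>g. F g + G g) (\<lambda>g. DF g + DG g)"
proof -
  obtain F' G' where *: "grad I F F'" "\<And>g. DF g = (\<Sum>\<alpha>\<in>I. V \<alpha> g * F' \<alpha> g)"
     "grad I G G'" "\<And>g. DG g = (\<Sum>\<alpha>\<in>I. V \<alpha> g * G' \<alpha> g)" using assms unfolding drv_def by metis
  show ?thesis unfolding drv_def
    by (rule exI, rule conjI, rule grad_add[OF *(1,3)]) (simp add: *(2,4) algebra_simps sum.distrib)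
qed

lemma drv_mult:
  assumes "drv I V F DF" "drv I V G DG"
  shows "drv I V (\<lambda>g. F g * G g) (\<lambda>g. F g * DG g + DF g * G g)"
proof -
  obtain F' G' where *: "grad I F F'" "\<And>g. DF g = (\<Sum>\<alpha>\<in>I. V \<alpha> g * F' \<alpha> g)"
     "grad I G G'" "\<And>g. DG g = (\<Sum>\<alpha>\<in>I. V \<alpha> g * G' \<alpha> g)" using assms unfolding drv_def by metis
  show ?thesis unfolding drv_def
    by (rule exI, rule conjI, rule grad_mult[OF *(1,3)])
       (simp add: *(2,4) algebra_simps sum.distrib sum_distrib_left)
qed

lemma drv_tame: "drv I V F DF \<Longrightarrow> tame I F"
  unfolding drv_def grad_def by blast

lemma drv_sum:
  assumes "\<And>a. a \<in> A \<Longrightarrow> drv I V (F a) (DF a)"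
  shows "drv I V (\<lambda>g. \<Sum>a\<in>A. F a g) (\<lambda>g. \<Sum>a\<in>A. DF a g)"
  using assms by (induction A rule: infinite_finite_induct) (auto intro: drv_const drv_add)

lemma drv_cong: "drv I V F DF \<Longrightarrow> (\<And>g. F g = G g) \<Longrightarrow> (\<And>g. DF g = DG g) \<Longrightarrow> drv I V G DG"
  by (metis ext)

lemma drv_power:
  assumes "drv I V F DF"
  shows "drv I V (\<lambda>g. F g ^ k) (\<lambda>g. of_nat k * F g ^ (k - 1) * DF g)"
proof -
  obtain F' where *: "grad I F F'" "\<And>g. DF g = (\<Sum>\<alpha>\<in>I. V \<alpha> g * F' \<alpha> g)"
    using assms unfolding drv_def by metis
  show ?thesis unfolding drv_def
    by (rule exI, rule conjI, rule grad_power[OF *(1)]) (simp add: *(2) sum_distrib_left algebra_simps)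
qed

text \<open>Logarithmic differentiation without division: \<open>h a\<close> plays the logarithmic
  derivative of the factor \<open>F a\<close>, and the identity also holds where factors vanish, as
  Vandermonde factors do on the diagonals.\<close>

lemma drv_log_prod:
  assumes "finite A" "\<And>a. a \<in> A \<Longrightarrow> drv I V (F a) (\<lambda>g. F a g * h a g)"
  shows "drv I V (\<lambda>g. \<Prod>a\<in>A. F a g) (\<lambda>g. (\<Prod>a\<in>A. F a g) * (\<Sum>a\<in>A. h a g))"
  using assms
proof (induction A rule: finite_induct)
  case (insert a A)
  have "drv I V (\<lambda>g. F a g * (\<Prod>a\<in>A. F a g))
     (\<lambda>g. F a g * ((\<Prod>a\<in>A. F a g) * (\<Sum>a\<in>A. h a g)) + (F a g * h a g) * (\<Prod>a\<in>A. F a g))"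
    using insert by (intro drv_mult) auto
  thus ?case by (rule drv_cong) (use insert in \<open>auto simp: algebra_simps\<close>)
qed (use drv_const in simp)

text \<open>Summing \<open>gauss_stein\<close> over the functions V_\<alpha> F gives the divergence
  theorem for the Gaussian measure; of the derivatives of V only the diagonal ones
  \<open>V' \<alpha> \<alpha>\<close>, that is the divergence, remain.\<close>

lemma drv_stein:
  assumes fin: "finite I" and V: "\<And>\<alpha>. \<alpha> \<in> I \<Longrightarrow> grad I (V \<alpha>) (V' \<alpha>)" and F: "drv I V F DF"
  shows "(\<integral>g. (\<Sum>\<alpha>\<in>I. complex_of_real (g \<alpha>) * V \<alpha> g) * F g \<partial>gauss I) =
     (\<integral>g. (\<Sum>\<alpha>\<in>I. V' \<alpha> \<alpha> g) * F g + DF g \<partial>gauss I)"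
proof -
  obtain F' where F': "grad I F F'" and DF: "\<And>g. DF g = (\<Sum>\<alpha>\<in>I. V \<alpha> g * F' \<alpha> g)"
    using F unfolding drv_def by metis
  have t: "tame I F" "\<And>\<alpha>. \<alpha> \<in> I \<Longrightarrow> tame I (F' \<alpha>)" "\<And>\<alpha>. \<alpha> \<in> I \<Longrightarrow> tame I (V \<alpha>)"
    "\<And>\<alpha>. \<alpha> \<in> I \<Longrightarrow> tame I (V' \<alpha> \<alpha>)"
    using V F' unfolding grad_def by auto
  have "(\<integral>g. (\<Sum>\<alpha>\<in>I. complex_of_real (g \<alpha>) * V \<alpha> g) * F g \<partial>gauss I)
     = (\<integral>g. (\<Sum>\<alpha>\<in>I. complex_of_real (g \<alpha>) * (V \<alpha> g * F g)) \<partial>gauss I)"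
    by (simp add: sum_distrib_right mult.assoc)
  also have "\<dots> = (\<Sum>\<alpha>\<in>I. \<integral>g. complex_of_real (g \<alpha>) * (V \<alpha> g * F g) \<partial>gauss I)"
    by (intro Bochner_Integration.integral_sum tame_integrable fin tame_mult tame_coord t)
  also have "\<dots> = (\<Sum>\<alpha>\<in>I. \<integral>g. V \<alpha> g * F' \<alpha> g + V' \<alpha> \<alpha> g * F g \<partial>gauss I)"
    by (intro sum.cong refl gauss_stein[OF fin] grad_mult V F')
  also have "\<dots> = (\<integral>g. (\<Sum>\<alpha>\<in>I. V \<alpha> g * F' \<alpha> g + V' \<alpha> \<alpha> g * F g) \<partial>gauss I)"
    by (intro Bochner_Integration.integral_sum[symmetric] tame_integrable fin tame_add tame_mult t)
  also have "\<dots> = (\<integral>g. (\<Sum>\<alpha>\<in>I. V' \<alpha> \<alpha> g) * F g + DF g \<partial>gauss I)"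
    by (simp add: DF sum.distrib sum_distrib_right add.commute)
  finally show ?thesis .
qed

section \<open>Loop equations\<close>

text \<open>The Leibniz rule. As V sends each \<open>T l\<close> to a multiple of another
  \<open>T (f l)\<close>, differentiating a product of power sums stays within such products,
  recorded as one updated list entry.\<close>

lemma drv_prod_list:
  assumes "\<And>l. drv I V (T l) (\<lambda>g. c l * T (f l) g)"
  shows "drv I V (\<lambda>g. \<Prod>l\<leftarrow>ks. T l g)
    (\<lambda>g. \<Sum>j<length ks. c (ks ! j) * (\<Prod>l\<leftarrow>ks[j := f (ks ! j)]. T l g))"
proof (induction ks)
  case (Cons k ks)
  show ?case
    by (rule drv_cong[OF drv_mult[OF assms[of k] Cons]])
       (simp_all add: sum.lessThan_Suc_shift sum_distrib_left mult.left_commute add.commute mult.assoc del: sum.lessThan_Suc)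
qed (use drv_const in simp)

lemma tame_prod_list: "(\<And>l. tame I (T l)) \<Longrightarrow> tame I (\<lambda>g. \<Prod>l\<leftarrow>ks. T l g)"
  by (induction ks) (auto intro: tame_const tame_mult)

definition moment :: "'i set \<Rightarrow> (('i \<Rightarrow> real) \<Rightarrow> complex) \<Rightarrow> (nat \<Rightarrow> ('i \<Rightarrow> real) \<Rightarrow> complex) \<Rightarrow> nat list \<Rightarrow> complex" where
  "moment I w T ks = (\<integral>g. w g * (\<Prod>k\<leftarrow>ks. T k g) \<partial>gauss I)"

text \<open>This is \<open>drv_stein\<close> with test function w times the product over
  \<open>ks\<close>, in the form common to matrices and densities. The position vector paired with V
  is the leading factor \<open>T k0\<close>; divergence plus logarithmic derivative of the weight is
  quadratic in the power sums, up to the single term \<open>b * T r\<close>; differentiating the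
  remaining factors updates one entry of \<open>ks\<close>.\<close>

lemma moment_loop:
  assumes fin: "finite I" and V: "\<And>\<alpha>. \<alpha> \<in> I \<Longrightarrow> grad I (V \<alpha>) (V' \<alpha>)"
    and T: "\<And>l. drv I V (T l) (\<lambda>g. c l * T (f l) g)"
    and w: "drv I V w (\<lambda>g. w g * h g)"
    and V0: "\<And>g. (\<Sum>\<alpha>\<in>I. complex_of_real (g \<alpha>) * V \<alpha> g) = T k0 g"
    and div: "\<And>g. (\<Sum>\<alpha>\<in>I. V' \<alpha> \<alpha> g) + h g = (\<Sum>i\<in>A. a i * (T (p i) g * T (q i) g)) + b * T r g"
    and A: "finite A"
  shows "moment I w T (k0 # ks) = (\<Sum>i\<in>A. a i * moment I w T (p i # q i # ks)) + b * moment I w T (r # ks)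
     + (\<Sum>j<length ks. c (ks ! j) * moment I w T (ks[j := f (ks ! j)]))"
proof -
  let ?P = "\<lambda>g ks. \<Prod>l\<leftarrow>ks. T l g"
  have tT: "tame I (T l)" for l using drv_tame[OF T] .
  have tw: "tame I w" using drv_tame[OF w] .
  have int: "integrable (gauss I) (\<lambda>g. w g * ?P g ls)" for ls
    by (intro tame_integrable fin tame_mult tw tame_prod_list tT)
  have int': "integrable (gauss I) (\<lambda>g. w g * (T x g * (T y g * ?P g ls)))"
    "integrable (gauss I) (\<lambda>g. w g * (T x g * ?P g ls))" for ls x y
    using int[of "x # y # ls"] int[of "x # ls"] by simp_all
  have "moment I w T (k0 # ks) =
     (\<integral>g. (\<Sum>\<alpha>\<in>I. complex_of_real (g \<alpha>) * V \<alpha> g) * (w g * ?P g ks) \<partial>gauss I)"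
    unfolding moment_def V0 by (simp add: algebra_simps)
  also have "\<dots> = (\<integral>g. (\<Sum>\<alpha>\<in>I. V' \<alpha> \<alpha> g) * (w g * ?P g ks) +
      (w g * (\<Sum>j<length ks. c (ks ! j) * ?P g (ks[j := f (ks ! j)])) + w g * h g * ?P g ks) \<partial>gauss I)"
    by (rule drv_stein[OF fin V drv_mult[OF w drv_prod_list[where T = T and c = c and f = f, OF T]]])
  also have "\<dots> = (\<integral>g. ((\<Sum>\<alpha>\<in>I. V' \<alpha> \<alpha> g) + h g) * (w g * ?P g ks) +
      (\<Sum>j<length ks. c (ks ! j) * (w g * ?P g (ks[j := f (ks ! j)]))) \<partial>gauss I)"
    by (intro Bochner_Integration.integral_cong refl) (simp add: algebra_simps sum_distrib_left)
  also have "\<dots> = (\<integral>g. (\<Sum>i\<in>A. a i * (w g * (T (p i) g * (T (q i) g * ?P g ks)))) + b * (w g * (T r g * ?P g ks)) +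
      (\<Sum>j<length ks. c (ks ! j) * (w g * ?P g (ks[j := f (ks ! j)]))) \<partial>gauss I)"
    unfolding div
    by (intro Bochner_Integration.integral_cong refl) (simp add: algebra_simps sum_distrib_left)
  also have "\<dots> = (\<Sum>i\<in>A. a i * moment I w T (p i # q i # ks)) + b * moment I w T (r # ks)
     + (\<Sum>j<length ks. c (ks ! j) * moment I w T (ks[j := f (ks ! j)]))"
    unfolding moment_def list.map prod_list.Cons
    by (subst Bochner_Integration.integral_add Bochner_Integration.integral_sum
        | intro Bochner_Integration.integrable_add Bochner_Integration.integrable_sum integrable_mult_right int int'
        | simp)+
  finally show ?thesis .
qed

text \<open>
  Gaussian matrices with covariance \<open>E(M\<^sub>a\<^sub>b M\<^sub>c\<^sub>d) = \<delta>\<^sub>a\<^sub>d \<delta>\<^sub>b\<^sub>c - \<eta> \<delta>\<^sub>a\<^sub>c \<delta>\<^sub>b\<^sub>d\<close>: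
  the GUE is the case \<open>\<eta> = 0\<close>, the anti-GUE the case \<open>\<eta> = 1\<close>.
\<close>

locale gauss_matrix =
  fixes I :: "'i set" and E :: "'i \<Rightarrow> nat \<Rightarrow> nat \<Rightarrow> complex" and n :: nat and \<eta> :: complex
  assumes fin: "finite I"
    and cov: "\<And>a b c d. a < n \<Longrightarrow> b < n \<Longrightarrow> c < n \<Longrightarrow> d < n \<Longrightarrow>
      (\<Sum>\<alpha>\<in>I. E \<alpha> a b * E \<alpha> c d) = of_bool (a = d \<and> b = c) - \<eta> * of_bool (a = c \<and> b = d)"
    and skew: "\<And>\<alpha> a b. \<eta> \<noteq> 0 \<Longrightarrow> E \<alpha> b a = - E \<alpha> a b"
begin

definition m :: "('i \<Rightarrow> real) \<Rightarrow> nat \<Rightarrow> nat \<Rightarrow> complex" where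
  "m g a b = (\<Sum>\<alpha>\<in>I. complex_of_real (g \<alpha>) * E \<alpha> a b)"

primrec mp :: "nat \<Rightarrow> ('i \<Rightarrow> real) \<Rightarrow> nat \<Rightarrow> nat \<Rightarrow> complex" where
  "mp 0 g a b = of_bool (a = b)"
| "mp (Suc k) g a b = (\<Sum>c<n. m g a c * mp k g c b)"

definition T :: "nat \<Rightarrow> ('i \<Rightarrow> real) \<Rightarrow> complex" where
  "T k g = (\<Sum>a<n. mp k g a a)"

lemma mp_add: "a < n \<Longrightarrow> mp (s + t) g a b = (\<Sum>c<n. mp s g a c * mp t g c b)"
proof (induction s arbitrary: a)
  case 0
  thus ?case by simp
next
  case (Suc s)
  have "mp (Suc s + t) g a b = (\<Sum>c<n. m g a c * (\<Sum>d<n. mp s g c d * mp t g d b))"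
    using Suc.IH by (auto intro!: sum.cong)
  also have "\<dots> = (\<Sum>d<n. \<Sum>c<n. m g a c * mp s g c d * mp t g d b)"
    unfolding sum_distrib_left mult.assoc by (rule sum.swap)
  finally show ?case by (simp add: sum_distrib_right)
qed

lemma mp_one: "b < n \<Longrightarrow> mp (Suc 0) g a b = m g a b"
  by simp

text \<open>The transpose of the k-th power of a skew matrix is (-1)^k times that power; the
  inductive step uses that a matrix commutes with its powers.\<close>

lemma mp_skew:
  assumes "\<eta> \<noteq> 0"
  shows "a < n \<Longrightarrow> b < n \<Longrightarrow> mp k g b a = (-1) ^ k * mp k g a b"
proof (induction k arbitrary: a b)
  case (Suc k)
  have m: "m g b a = - m g a b" for a b
    by (simp add: m_def skew[OF assms, of _ a b] sum_negf)
  have "mp (Suc k) g b a = (\<Sum>c<n. (-1) ^ Suc k * (mp k g a c * m g c b))"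
    unfolding mp.simps
  proof (intro sum.cong refl)
    fix c assume "c \<in> {..<n}"
    hence "mp k g c a = (-1) ^ k * mp k g a c" using Suc.prems by (intro Suc.IH) auto
    thus "m g b c * mp k g c a = (-1) ^ Suc k * (mp k g a c * m g c b)" by (simp add: m[of b c])
  qed
  also have "\<dots> = (-1) ^ Suc k * mp (k + 1) g a b"
    unfolding mp_add[OF Suc.prems(1)] sum_distrib_left using Suc.prems(2) by (intro sum.cong refl) simp
  finally show ?case unfolding Suc_eq_plus1 .
qed auto

lemma T_odd:
  assumes "\<eta> \<noteq> 0" "odd k"
  shows "T k g = 0"
proof -
  have "mp k g a a = 0" if "a < n" for a using mp_skew[OF assms(1) that that, of k g] assms(2) by simp
  thus ?thesis by (simp add: T_def)
qed

primrec dmp :: "nat \<Rightarrow> 'i \<Rightarrow> ('i \<Rightarrow> real) \<Rightarrow> nat \<Rightarrow> nat \<Rightarrow> complex" where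
  "dmp 0 \<alpha> g a b = 0"
| "dmp (Suc k) \<alpha> g a b = (\<Sum>c<n. m g a c * dmp k \<alpha> g c b + E \<alpha> a c * mp k g c b)"

lemma grad_cong: "grad I F F' \<Longrightarrow> (\<And>g. F g = G g) \<Longrightarrow> (\<And>\<alpha> g. \<alpha> \<in> I \<Longrightarrow> F' \<alpha> g = G' \<alpha> g) \<Longrightarrow> grad I G G'"
  unfolding grad_def by (metis ext)

lemma grad_m: "grad I (\<lambda>g. m g a b) (\<lambda>\<alpha> g. E \<alpha> a b)"
  unfolding m_def
  by (rule grad_cong[OF grad_sum[where A = I]], rule grad_mult, rule grad_coord, rule fin, assumption, rule grad_const)
     (simp_all add: fin if_distrib[of "\<lambda>x. x * _"] cong: if_cong)

lemma grad_mp: "grad I (\<lambda>g. mp k g a b) (\<lambda>\<alpha> g. dmp k \<alpha> g a b)"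
proof (induction k arbitrary: a)
  case (Suc k)
  show ?case unfolding mp.simps dmp.simps
    by (intro grad_sum grad_mult grad_m Suc)
qed (simp add: grad_const)

text \<open>The \<alpha>-derivative of M^k is the sum over s of M^s E_\<alpha> M^(k-1-s). Summing
  over \<alpha> against \<open>E \<alpha> a b\<close>, the covariance replaces the two E factors by
  index identifications: the direct pairing gives the first product, the pairing with weight -
  \<eta> the one with a and b exchanged.\<close>

lemma dmp_contract:
  assumes "a < n" "b < n" "a' < n"
  shows "b' < n \<Longrightarrow> (\<Sum>\<alpha>\<in>I. E \<alpha> a b * dmp k \<alpha> g b' a') =
    (\<Sum>s<k. mp s g b' b * mp (k - 1 - s) g a a' - \<eta> * (mp s g b' a * mp (k - 1 - s) g b a'))"
proof (induction k arbitrary: b')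
  case (Suc k)
  have "(\<Sum>\<alpha>\<in>I. E \<alpha> a b * dmp (Suc k) \<alpha> g b' a') =
      (\<Sum>c<n. m g b' c * (\<Sum>\<alpha>\<in>I. E \<alpha> a b * dmp k \<alpha> g c a')) +
      (\<Sum>c<n. (\<Sum>\<alpha>\<in>I. E \<alpha> a b * E \<alpha> b' c) * mp k g c a')"
  proof -
    have "(\<Sum>\<alpha>\<in>I. E \<alpha> a b * dmp (Suc k) \<alpha> g b' a') =
      (\<Sum>\<alpha>\<in>I. \<Sum>c<n. m g b' c * (E \<alpha> a b * dmp k \<alpha> g c a') + (E \<alpha> a b * E \<alpha> b' c) * mp k g c a')"
      by (simp add: sum_distrib_left algebra_simps)
    also have "\<dots> = (\<Sum>c<n. \<Sum>\<alpha>\<in>I. m g b' c * (E \<alpha> a b * dmp k \<alpha> g c a') + (E \<alpha> a b * E \<alpha> b' c) * mp k g c a')"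
      by (rule sum.swap)
    finally show ?thesis by (simp add: sum.distrib sum_distrib_left sum_distrib_right)
  qed
  also have "(\<Sum>c<n. (\<Sum>\<alpha>\<in>I. E \<alpha> a b * E \<alpha> b' c) * mp k g c a') =
     (\<Sum>c<n. of_bool (c = a) * (of_bool (b' = b) * mp k g c a') - \<eta> * of_bool (c = b) * (of_bool (b' = a) * mp k g c a'))"
  proof (intro sum.cong refl)
    fix c assume "c \<in> {..<n}"
    hence *: "(\<Sum>\<alpha>\<in>I. E \<alpha> a b * E \<alpha> b' c) = of_bool (a = c \<and> b = b') - \<eta> * of_bool (a = b' \<and> b = c)"
      using assms Suc.prems by (intro cov) auto
    show "(\<Sum>\<alpha>\<in>I. E \<alpha> a b * E \<alpha> b' c) * mp k g c a' =
      of_bool (c = a) * (of_bool (b' = b) * mp k g c a') - \<eta> * of_bool (c = b) * (of_bool (b' = a) * mp k g c a')"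
      unfolding * by (cases "c = a"; cases "c = b"; cases "b' = b"; cases "b' = a") (simp_all add: left_diff_distrib)
  qed
  also have "\<dots> = of_bool (b' = b) * mp k g a a' - \<eta> * (of_bool (b' = a) * mp k g b a')"
    using assms by (simp add: sum_subtractf sum_distrib_left[symmetric] mult.assoc)
  also have "(\<Sum>c<n. m g b' c * (\<Sum>\<alpha>\<in>I. E \<alpha> a b * dmp k \<alpha> g c a')) =
     (\<Sum>c<n. m g b' c * (\<Sum>s<k. mp s g c b * mp (k - 1 - s) g a a' - \<eta> * (mp s g c a * mp (k - 1 - s) g b a')))"
    by (intro sum.cong refl) (simp add: Suc.IH)
  also have "\<dots> = (\<Sum>s<k. mp (Suc s) g b' b * mp (k - 1 - s) g a a' - \<eta> * (mp (Suc s) g b' a * mp (k - 1 - s) g b a'))"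
    by (simp add: sum_distrib_left sum_distrib_right sum_subtractf algebra_simps sum.swap[of _ "{..<n}" "{..<k}"])
  finally show ?case
    unfolding sum.lessThan_Suc_shift by simp
qed simp

context
  fixes k :: nat
begin

text \<open>This is tr(E_\<alpha> M^k), the \<alpha>-derivative of tr M^(k+1) / (k+1).\<close>

definition V :: "'i \<Rightarrow> ('i \<Rightarrow> real) \<Rightarrow> complex" where
  "V \<alpha> g = (\<Sum>a<n. \<Sum>b<n. E \<alpha> a b * mp k g b a)"

definition V' :: "'i \<Rightarrow> 'i \<Rightarrow> ('i \<Rightarrow> real) \<Rightarrow> complex" where
  "V' \<alpha> \<beta> g = (\<Sum>a<n. \<Sum>b<n. E \<alpha> a b * dmp k \<beta> g b a)"

lemma grad_V: "grad I (V \<alpha>) (V' \<alpha>)"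
proof -
  have *: "grad I (\<lambda>g. E \<alpha> a b * mp k g b a) (\<lambda>\<beta> g. E \<alpha> a b * dmp k \<beta> g b a)" for a b
    using grad_mult[OF grad_const[of I "E \<alpha> a b"] grad_mp[of k b a]] by simp
  show ?thesis unfolding V_def V'_def by (intro grad_sum *)
qed

lemma V_sum: "(\<Sum>\<alpha>\<in>I. complex_of_real (g \<alpha>) * V \<alpha> g) = T (Suc k) g"
proof -
  have "(\<Sum>\<alpha>\<in>I. complex_of_real (g \<alpha>) * V \<alpha> g) = (\<Sum>a<n. \<Sum>b<n. (\<Sum>\<alpha>\<in>I. complex_of_real (g \<alpha>) * E \<alpha> a b) * mp k g b a)"
    unfolding V_def sum_distrib_left sum_distrib_right sum.swap[of _ I] by (simp add: mult.assoc)
  thus ?thesis by (simp add: T_def m_def)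
qed

text \<open>Moving along V changes M by M^k minus \<eta> times the transpose of M^k, which is
  \<kappa> M^k. For the GUE \<kappa> is 1; for the anti-GUE it is 2 if k is odd and 0 if k is
  even.\<close>

definition \<kappa> :: complex where "\<kappa> = 1 - \<eta> * (-1) ^ k"

lemma V_contract:
  assumes "a < n" "b < n"
  shows "(\<Sum>\<alpha>\<in>I. V \<alpha> g * E \<alpha> a b) = \<kappa> * mp k g a b"
proof -
  have "(\<Sum>\<alpha>\<in>I. V \<alpha> g * E \<alpha> a b) = (\<Sum>c<n. \<Sum>d<n. (\<Sum>\<alpha>\<in>I. E \<alpha> c d * E \<alpha> a b) * mp k g d c)"
    unfolding V_def sum_distrib_right sum.swap[of _ I] by (simp add: algebra_simps)
  also have "\<dots> = (\<Sum>c<n. \<Sum>d<n. of_bool (d = a) * (of_bool (c = b) * mp k g d c) - \<eta> * (of_bool (d = b) * (of_bool (c = a) * mp k g d c)))"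
    using assms by (intro sum.cong refl) (auto simp: cov left_diff_distrib)
  also have "\<dots> = mp k g a b - \<eta> * mp k g b a"
    using assms by (simp add: sum_subtractf sum_distrib_left[symmetric])
  also have "\<eta> * mp k g b a = \<eta> * (-1) ^ k * mp k g a b"
    using mp_skew[OF _ assms, of k g] by (cases "\<eta> = 0") auto
  finally show ?thesis by (simp add: \<kappa>_def algebra_simps)
qed

lemma drv_m: "a < n \<Longrightarrow> b < n \<Longrightarrow> drv I V (\<lambda>g. m g a b) (\<lambda>g. \<kappa> * mp k g a b)"
  unfolding drv_def using grad_m V_contract by (intro exI[of _ "\<lambda>\<alpha> g. E \<alpha> a b"]) auto

text \<open>M moves by \<kappa> M^k, which commutes with M, so each of the l factors of M^l
  contributes \<kappa> M^(k+l-1).\<close>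

lemma drv_mp: "a < n \<Longrightarrow> b < n \<Longrightarrow> drv I V (\<lambda>g. mp l g a b) (\<lambda>g. of_nat l * \<kappa> * mp (k + l - 1) g a b)"
proof (induction l arbitrary: a)
  case (Suc l)
  have "drv I V (\<lambda>g. \<Sum>c<n. m g a c * mp l g c b)
    (\<lambda>g. \<Sum>c<n. m g a c * (of_nat l * \<kappa> * mp (k + l - 1) g c b) + \<kappa> * mp k g a c * mp l g c b)"
    using Suc by (intro drv_sum drv_mult drv_m) auto
  thus ?case
  proof (rule drv_cong)
    fix g
    have "(\<Sum>c<n. m g a c * (of_nat l * \<kappa> * mp (k + l - 1) g c b) + \<kappa> * mp k g a c * mp l g c b) =
       of_nat l * \<kappa> * mp (Suc (k + l - 1)) g a b + \<kappa> * mp (k + l) g a b"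
      using Suc.prems by (simp add: sum.distrib mp_add sum_distrib_left algebra_simps)
    also have "\<dots> = of_nat (Suc l) * \<kappa> * mp (k + Suc l - 1) g a b"
      by (cases l) (auto simp: algebra_simps simp del: mp.simps(2))
    finally show "(\<Sum>c<n. m g a c * (of_nat l * \<kappa> * mp (k + l - 1) g c b) + \<kappa> * mp k g a c * mp l g c b) =
       of_nat (Suc l) * \<kappa> * mp (k + Suc l - 1) g a b" .
  qed simp
qed (simp add: drv_const)

lemma drv_T: "drv I V (T l) (\<lambda>g. (of_nat l * \<kappa>) * T (k + l - 1) g)"
  by (rule drv_cong[OF drv_sum[where A = "{..<n}"]], rule drv_mp) (auto simp: T_def sum_distrib_left)

text \<open>Set a' = a and b' = b in \<open>dmp_contract\<close> and sum. The direct pairing splits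
  into a product of two traces. In the \<eta> term, transposing M^s costs (-1)^s and joins the
  factors into the single trace tr M^(k-1), whence the alternating sum.\<close>

lemma V_div: "(\<Sum>\<alpha>\<in>I. V' \<alpha> \<alpha> g) = (\<Sum>s<k. 1 * (T s g * T (k - 1 - s) g)) + - \<eta> * (\<Sum>s<k. (-1) ^ s) * T (k - 1) g"
proof -
  have "(\<Sum>\<alpha>\<in>I. V' \<alpha> \<alpha> g) = (\<Sum>a<n. \<Sum>b<n. (\<Sum>\<alpha>\<in>I. E \<alpha> a b * dmp k \<alpha> g b a))"
    unfolding V'_def by (subst sum.swap) (intro sum.cong refl sum.swap)
  also have "\<dots> = (\<Sum>a<n. \<Sum>b<n. \<Sum>s<k. mp s g b b * mp (k - 1 - s) g a a - \<eta> * (mp s g b a * mp (k - 1 - s) g b a))"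
    by (intro sum.cong refl dmp_contract) auto
  also have "\<dots> = (\<Sum>a<n. \<Sum>b<n. \<Sum>s<k. mp s g b b * mp (k - 1 - s) g a a - \<eta> * ((-1) ^ s * (mp s g a b * mp (k - 1 - s) g b a)))"
  proof (intro sum.cong refl)
    fix a b s assume "a \<in> {..<n}" "b \<in> {..<n}"
    thus "mp s g b b * mp (k - 1 - s) g a a - \<eta> * (mp s g b a * mp (k - 1 - s) g b a) =
      mp s g b b * mp (k - 1 - s) g a a - \<eta> * ((-1) ^ s * (mp s g a b * mp (k - 1 - s) g b a))"
      using mp_skew[of a b s g] by (cases "\<eta> = 0") auto
  qed
  also have "\<dots> = (\<Sum>s<k. (\<Sum>a<n. \<Sum>b<n. mp s g b b * mp (k - 1 - s) g a a) - \<eta> * ((-1) ^ s * (\<Sum>a<n. \<Sum>b<n. mp s g a b * mp (k - 1 - s) g b a)))"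
    by (simp add: sum_subtractf sum_distrib_left sum.swap[of _ "{..<n}" "{..<k}"])
  also have "\<dots> = (\<Sum>s<k. T s g * T (k - 1 - s) g - \<eta> * ((-1) ^ s * T (k - 1) g))"
  proof (intro sum.cong refl arg_cong2[of _ _ _ _ "(-)"] arg_cong2[of _ _ _ _ "(*)"])
    fix s assume s: "s \<in> {..<k}"
    have "(\<Sum>a<n. \<Sum>b<n. mp s g b b * mp (k - 1 - s) g a a) = T (k - 1 - s) g * T s g"
      unfolding T_def sum_product by (intro sum.cong refl mult.commute)
    thus "(\<Sum>a<n. \<Sum>b<n. mp s g b b * mp (k - 1 - s) g a a) = T s g * T (k - 1 - s) g"
      by (simp only: mult.commute)
    have "mp (k - 1) g a a = (\<Sum>b<n. mp s g a b * mp (k - 1 - s) g b a)" if "a < n" for a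
      using mp_add[OF that, of s "k - 1 - s" g a] s by simp
    thus "(\<Sum>a<n. \<Sum>b<n. mp s g a b * mp (k - 1 - s) g b a) = T (k - 1) g"
      by (simp add: T_def)
  qed
  also have "\<dots> = (\<Sum>s<k. T s g * T (k - 1 - s) g) - \<eta> * ((\<Sum>s<k. (-1) ^ s) * T (k - 1) g)"
    by (simp only: sum_subtractf sum_distrib_left sum_distrib_right)
  finally show ?thesis by (simp only: mult_1_left diff_conv_add_uminus mult_minus_left mult.assoc)
qed

lemma loop:
  "moment I (\<lambda>_. 1) T (Suc k # ks) = (\<Sum>s<k. moment I (\<lambda>_. 1) T (s # (k - 1 - s) # ks))
     - \<eta> * (\<Sum>s<k. (-1) ^ s) * moment I (\<lambda>_. 1) T ((k - 1) # ks)
     + (\<Sum>j<length ks. of_nat (ks ! j) * \<kappa> * moment I (\<lambda>_. 1) T (ks[j := k + ks ! j - 1]))"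
proof -
  have w: "drv I V (\<lambda>_. 1) (\<lambda>g. 1 * (\<lambda>_. 0) g)"
    using drv_const[of I V 1] by (simp only: mult_zero_right)
  have d: "(\<Sum>\<alpha>\<in>I. V' \<alpha> \<alpha> g) + (\<lambda>_. 0) g =
    (\<Sum>s\<in>{..<k}. 1 * (T s g * T (k - 1 - s) g)) + - \<eta> * (\<Sum>s<k. (-1) ^ s) * T (k - 1) g" for g
    by (simp only: V_div add_0_right)
  show ?thesis
    by (subst moment_loop[where T = T and V = V and c = "\<lambda>l. of_nat l * \<kappa>" and f = "\<lambda>l. k + l - 1" and h = "\<lambda>_. 0",
        OF fin grad_V drv_T w V_sum d]) simp_all
qed

end

lemma moment_zero: "moment I w T (0 # ks) = of_nat n * moment I w T ks"
  by (simp add: moment_def T_def algebra_simps)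

end

text \<open>A loop equation expresses a moment through lists of smaller total exponent, so induction
  on \<open>sum_list\<close> works. A leading zero does not lower the total; it is removed by an
  inner induction on the list.\<close>

lemma loop_unique:
  fixes \<Phi> \<Psi> :: "nat list \<Rightarrow> complex"
  assumes "\<Phi> [] = \<Psi> []" and zero: "\<And>ks. \<Phi> ks = \<Psi> ks \<Longrightarrow> \<Phi> (0 # ks) = \<Psi> (0 # ks)"
    and step: "\<And>k ks. (\<And>ls. sum_list ls \<le> k + sum_list ks \<Longrightarrow> \<Phi> ls = \<Psi> ls) \<Longrightarrow> \<Phi> (Suc k # ks) = \<Psi> (Suc k # ks)"
  shows "\<Phi> ks = \<Psi> ks"
proof (induction "sum_list ks" arbitrary: ks rule: less_induct)
  case less
  show ?case using less
  proof (induction ks)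
    case (Cons k ks)
    show ?case
    proof (cases k)
      case 0
      thus ?thesis using Cons by (auto intro: zero)
    next
      case (Suc k')
      show ?thesis unfolding Suc
        by (rule step, rule Cons.prems) (simp add: Suc)
    qed
  qed (use assms in auto)
qed

lemma sum_list_update_le:
  fixes ks :: "nat list"
  assumes "j < length ks" "y \<le> ks ! j + d"
  shows "sum_list (ks[j := y]) \<le> sum_list ks + d"
  using assms by (simp add: sum_list_update)

text \<open>Combines the logarithmic derivative of a squared Vandermonde product (twice the pairs a
  < b) with the divergence of the field (the diagonal).\<close>

lemma sum_pairs_symmetric:
  fixes f :: "nat \<Rightarrow> nat \<Rightarrow> complex"
  assumes "\<And>a b. f a b = f b a"
  shows "2 * (\<Sum>(a, b)\<in>{(a, b). a < b \<and> b < n}. f a b) + (\<Sum>a<n. f a a) = (\<Sum>a<n. \<Sum>b<n. f a b)"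
proof -
  let ?L = "{(a, b). a < b \<and> b < n}" and ?G = "{(a, b). b < a \<and> a < n}" and ?D = "(\<lambda>a. (a, a)) ` {..<n}"
  have fin: "finite ?L" "finite ?G" by (rule finite_subset[of _ "{..<n} \<times> {..<n}"]; auto)+
  have "(\<Sum>a<n. \<Sum>b<n. f a b) = (\<Sum>(a, b)\<in>{..<n} \<times> {..<n}. f a b)"
    by (simp add: sum.cartesian_product)
  also have "{..<n} \<times> {..<n} = (?L \<union> ?G) \<union> ?D" by auto
  also have "(\<Sum>(a, b)\<in>\<dots>. f a b) = (\<Sum>(a, b)\<in>?L. f a b) + (\<Sum>(a, b)\<in>?G. f a b) + (\<Sum>(a, b)\<in>?D. f a b)"
    using fin by (subst sum.union_disjoint, simp, simp, force, subst sum.union_disjoint) auto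
  also have "(\<Sum>(a, b)\<in>?G. f a b) = (\<Sum>(a, b)\<in>?L. f a b)"
    by (rule sum.reindex_bij_witness[of _ prod.swap prod.swap]) (auto simp: assms)
  also have "(\<Sum>(a, b)\<in>?D. f a b) = (\<Sum>a<n. f a a)"
    by (subst sum.reindex) (auto simp: inj_on_def)
  finally show ?thesis by simp
qed

lemma finite_pairs [simp]: "finite {(a, b). a < b \<and> b < (n::nat)}"
  by (rule finite_subset[of _ "{..<n} \<times> {..<n}"]) auto

lemma sum_powers_symmetric:
  fixes x y :: complex
  shows "(\<Sum>s<k. x ^ s * y ^ (k - 1 - s)) = (\<Sum>s<k. y ^ s * x ^ (k - 1 - s))"
  by (rule sum.reindex_bij_witness[of _ "\<lambda>s. k - 1 - s" "\<lambda>s. k - 1 - s"]) (auto simp: mult.commute)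

lemma power_diff_sum:
  fixes x y :: complex
  shows "x ^ k - y ^ k = (x - y) * (\<Sum>s<k. x ^ s * y ^ (k - 1 - s))"
  by (subst power_diff_sumr2) (simp add: mult.commute)

subsection \<open>Eigenvalue densities\<close>

abbreviation gvar :: "nat \<Rightarrow> (nat \<Rightarrow> real) \<Rightarrow> complex" where
  "gvar i g \<equiv> complex_of_real (g i)"

lemma grad_gvar_power:
  assumes "i < n"
  shows "grad {..<n} (\<lambda>g. gvar i g ^ k) (\<lambda>\<alpha> g. of_nat k * gvar i g ^ (k - 1) * (if \<alpha> = i then 1 else 0))"
  using assms by (intro grad_power grad_coord) auto

definition psum :: "nat \<Rightarrow> nat \<Rightarrow> (nat \<Rightarrow> real) \<Rightarrow> complex" where
  "psum n k g = (\<Sum>i<n. gvar i g ^ k)"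

definition vand2 :: "nat \<Rightarrow> (nat \<Rightarrow> real) \<Rightarrow> complex" where
  "vand2 n g = (\<Prod>(a, b)\<in>{(a, b). a < b \<and> b < n}. (gvar a g - gvar b g)\<^sup>2)"

lemma drv_gvar_power:
  assumes "i < n"
  shows "drv {..<n} V (\<lambda>g. gvar i g ^ k) (\<lambda>g. of_nat k * gvar i g ^ (k - 1) * V i g)"
  using assms by (intro drv_power drv_coord) auto

lemma drv_diff:
  assumes "drv I V F DF" "drv I V G DG"
  shows "drv I V (\<lambda>g. F g - G g) (\<lambda>g. DF g - DG g)"
  using drv_add[OF assms(1) drv_mult[OF drv_const[of I V "-1"] assms(2)]] by simp

text \<open>The field is V_i = x_i^k. It gives (x_a - x_b)^2 the logarithmic derivative 2 (x_a^k -
  x_b^k) / (x_a - x_b), a geometric sum whose diagonal value k x_a^(k-1) is the divergence term. The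
  result is the matrix loop equation with \<eta> = 0 and \<kappa> = 1.\<close>

lemma gue_density_loop:
  "moment {..<n} (vand2 n) (psum n) (Suc k # ks) =
     (\<Sum>s<k. moment {..<n} (vand2 n) (psum n) (s # (k - 1 - s) # ks))
     + (\<Sum>j<length ks. of_nat (ks ! j) * moment {..<n} (vand2 n) (psum n) (ks[j := k + ks ! j - 1]))"
proof -
  let ?I = "{..<n}" and ?P = "{(a, b). a < b \<and> b < n}"
  let ?V = "\<lambda>i g. gvar i g ^ k"
  let ?V' = "\<lambda>i \<alpha> g. of_nat k * gvar i g ^ (k - 1) * (if \<alpha> = i then 1 else 0)"
  let ?f = "\<lambda>g a b. \<Sum>s<k. gvar a g ^ s * gvar b g ^ (k - 1 - s)"
  let ?h = "\<lambda>g. \<Sum>p\<in>?P. case p of (a, b) \<Rightarrow> 2 * ?f g a b"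
  have V: "\<alpha> \<in> ?I \<Longrightarrow> grad ?I (?V \<alpha>) (?V' \<alpha>)" for \<alpha> by (intro grad_gvar_power) auto
  have T: "drv ?I ?V (psum n l) (\<lambda>g. of_nat l * psum n (k + l - 1) g)" for l
  proof -
    have "drv ?I ?V (psum n l) (\<lambda>g. \<Sum>i<n. of_nat l * gvar i g ^ (l - 1) * ?V i g)"
      unfolding psum_def by (intro drv_sum drv_gvar_power) auto
    thus ?thesis
    proof (rule drv_cong)
      fix g
      have "of_nat l * gvar i g ^ (l - 1) * gvar i g ^ k = of_nat l * gvar i g ^ (k + l - 1)" for i
        by (cases l) (auto simp: power_add mult_ac)
      thus "(\<Sum>i<n. of_nat l * gvar i g ^ (l - 1) * gvar i g ^ k) = of_nat l * psum n (k + l - 1) g"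
        unfolding psum_def sum_distrib_left by (intro sum.cong refl)
    qed simp
  qed
  have w: "drv ?I ?V (vand2 n) (\<lambda>g. vand2 n g * ?h g)"
  proof -
    have "drv ?I ?V (\<lambda>g. (gvar a g - gvar b g)\<^sup>2) (\<lambda>g. (gvar a g - gvar b g)\<^sup>2 * (2 * ?f g a b))"
      if ab: "a < b" "b < n" for a b
    proof (rule drv_cong[OF drv_power[OF drv_diff[OF drv_coord drv_coord]]])
      fix g
      show "of_nat 2 * (gvar a g - gvar b g) ^ (2 - 1) * (gvar a g ^ k - gvar b g ^ k) = (gvar a g - gvar b g)\<^sup>2 * (2 * ?f g a b)"
        by (subst power_diff_sum) (simp add: power2_eq_square)
    qed (use ab in auto)
    thus ?thesis
      unfolding vand2_def by (intro drv_log_prod finite_pairs) (simp only: case_prod_unfold mem_Collect_eq)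
  qed
  have V0: "(\<Sum>\<alpha>\<in>?I. complex_of_real (g \<alpha>) * ?V \<alpha> g) = psum n (Suc k) g" for g
    by (simp add: psum_def)
  have div: "(\<Sum>\<alpha>\<in>?I. ?V' \<alpha> \<alpha> g) + ?h g = (\<Sum>s\<in>{..<k}. 1 * (psum n s g * psum n (k - 1 - s) g)) + 0 * psum n 0 g" for g
  proof -
    have "?f g a a = of_nat k * gvar a g ^ (k - 1)" for a
      by (simp add: power_add[symmetric])
    hence "(\<Sum>\<alpha>\<in>?I. ?V' \<alpha> \<alpha> g) + ?h g = 2 * (\<Sum>(a, b)\<in>?P. ?f g a b) + (\<Sum>a<n. ?f g a a)"
      by (simp add: sum_distrib_left case_prod_unfold)
    also have "\<dots> = (\<Sum>a<n. \<Sum>b<n. ?f g a b)"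
      by (rule sum_pairs_symmetric, rule sum_powers_symmetric)
    also have "\<dots> = (\<Sum>s<k. \<Sum>a<n. \<Sum>b<n. gvar a g ^ s * gvar b g ^ (k - 1 - s))"
      by (subst (2) sum.swap, subst sum.swap) (rule refl)
    finally show ?thesis by (simp add: psum_def sum_product)
  qed
  show ?thesis
    by (subst moment_loop[where c = of_nat and f = "\<lambda>l. k + l - 1", OF _ V T w V0 div]) simp_all
qed

lemma psum_moment_zero: "moment I w (psum n) (0 # ks) = of_nat n * moment I w (psum n) ks"
  by (simp add: moment_def psum_def algebra_simps)

text \<open>
  The power sum of exponent \<open>2 * k\<close> of the points \<open>\<plusminus>\<theta>\<^sub>i\<close> and \<open>r\<close> zeros. Only even exponents are
  needed since the odd power sums vanish.
\<close>

definition psum2 :: "nat \<Rightarrow> nat \<Rightarrow> nat \<Rightarrow> (nat \<Rightarrow> real) \<Rightarrow> complex" where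
  "psum2 r m k g = 2 * (\<Sum>i<m. gvar i g ^ (2 * k)) + of_nat r * of_bool (k = 0)"

definition anti_weight :: "nat \<Rightarrow> nat \<Rightarrow> (nat \<Rightarrow> real) \<Rightarrow> complex" where
  "anti_weight r m g = (\<Prod>j<m. gvar j g ^ (2 * r)) *
     (\<Prod>(a, b)\<in>{(a, b). a < b \<and> b < m}. ((gvar a g)\<^sup>2 - (gvar b g)\<^sup>2)\<^sup>2)"

text \<open>The field V_i = 2 x_i^(2k+1) is odd, so it moves the points \<theta> and -\<theta>
  symmetrically. The factor 2 makes its pairing with the position vector equal to
  \<open>psum2 r m (Suc k)\<close> and matches \<kappa> = 2 on the matrix side.\<close>

lemma antigue_density_loop:
  assumes r: "r \<le> 1"
  shows "moment {..<m} (anti_weight r m) (psum2 r m) (Suc k # ks) =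
     (\<Sum>s<Suc k. moment {..<m} (anti_weight r m) (psum2 r m) (s # (k - s) # ks))
     - moment {..<m} (anti_weight r m) (psum2 r m) (k # ks)
     + (\<Sum>j<length ks. 4 * of_nat (ks ! j) * moment {..<m} (anti_weight r m) (psum2 r m) (ks[j := k + ks ! j]))"
proof -
  let ?I = "{..<m}" and ?P = "{(a, b). a < b \<and> b < m}"
  let ?V = "\<lambda>i g. 2 * gvar i g ^ (2 * k + 1)"
  let ?V' = "\<lambda>i \<alpha> g. 2 * (of_nat (2 * k + 1) * gvar i g ^ (2 * k + 1 - 1) * (if \<alpha> = i then 1 else 0))"
  let ?f = "\<lambda>g a b. \<Sum>s<Suc k. (gvar a g)\<^sup>2 ^ s * (gvar b g)\<^sup>2 ^ (Suc k - 1 - s)"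
  let ?h1 = "\<lambda>g. \<Sum>j<m. 4 * of_nat r * gvar j g ^ (2 * k)"
  let ?h2 = "\<lambda>g. \<Sum>p\<in>?P. case p of (a, b) \<Rightarrow> 8 * ?f g a b"
  let ?h = "\<lambda>g. ?h1 g + ?h2 g"
  have V: "\<alpha> \<in> ?I \<Longrightarrow> grad ?I (?V \<alpha>) (?V' \<alpha>)" for \<alpha>
    using grad_mult[OF grad_const[of ?I 2] grad_gvar_power[of \<alpha> m "2 * k + 1"]] by simp
  have T: "drv ?I ?V (psum2 r m l) (\<lambda>g. (4 * of_nat l) * psum2 r m (k + l) g)" for l
  proof -
    have "drv ?I ?V (psum2 r m l) (\<lambda>g. 2 * (\<Sum>i<m. of_nat (2 * l) * gvar i g ^ (2 * l - 1) * ?V i g))"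
      unfolding psum2_def
      by (rule drv_cong[OF drv_add[OF drv_mult[OF drv_const drv_sum[OF drv_gvar_power]] drv_const]]) auto
    thus ?thesis
    proof (rule drv_cong)
      fix g
      have "of_nat (2 * l) * gvar i g ^ (2 * l - 1) * ?V i g = 4 * of_nat l * gvar i g ^ (2 * (k + l))" for i
        by (cases l) (auto simp: power_add mult_ac)
      hence "(\<Sum>i<m. of_nat (2 * l) * gvar i g ^ (2 * l - 1) * ?V i g) = 4 * of_nat l * (\<Sum>i<m. gvar i g ^ (2 * (k + l)))"
        unfolding sum_distrib_left by (intro sum.cong refl)
      thus "2 * (\<Sum>i<m. of_nat (2 * l) * gvar i g ^ (2 * l - 1) * ?V i g) = (4 * of_nat l) * psum2 r m (k + l) g"
        unfolding psum2_def by (simp only:) (cases l; simp)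
    qed simp
  qed
  have w1: "drv ?I ?V (\<lambda>g. \<Prod>j<m. gvar j g ^ (2 * r)) (\<lambda>g. (\<Prod>j<m. gvar j g ^ (2 * r)) * ?h1 g)"
  proof (rule drv_log_prod, simp)
    fix j assume j: "j \<in> {..<m}"
    show "drv ?I ?V (\<lambda>g. gvar j g ^ (2 * r)) (\<lambda>g. gvar j g ^ (2 * r) * (4 * of_nat r * gvar j g ^ (2 * k)))"
    proof (rule drv_cong[OF drv_gvar_power])
      fix g
      show "of_nat (2 * r) * gvar j g ^ (2 * r - 1) * ?V j g = gvar j g ^ (2 * r) * (4 * of_nat r * gvar j g ^ (2 * k))"
        by (cases r) (auto simp: power_add mult_ac)
    qed (use j in auto)
  qed
  have w2: "drv ?I ?V (\<lambda>g. \<Prod>p\<in>?P. case p of (a, b) \<Rightarrow> ((gvar a g)\<^sup>2 - (gvar b g)\<^sup>2)\<^sup>2)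
    (\<lambda>g. (\<Prod>p\<in>?P. case p of (a, b) \<Rightarrow> ((gvar a g)\<^sup>2 - (gvar b g)\<^sup>2)\<^sup>2) * ?h2 g)"
  proof -
    have e: "of_nat 2 * x ^ (2 - 1) * (2 * x ^ (2 * k + 1)) = 4 * (x\<^sup>2) ^ Suc k" for x :: complex
      by (simp add: power_mult power2_eq_square)
    have "drv ?I ?V (\<lambda>g. ((gvar a g)\<^sup>2 - (gvar b g)\<^sup>2)\<^sup>2) (\<lambda>g. ((gvar a g)\<^sup>2 - (gvar b g)\<^sup>2)\<^sup>2 * (8 * ?f g a b))"
      if ab: "a < b" "b < m" for a b
    proof (rule drv_cong[OF drv_power[OF drv_diff[OF drv_gvar_power drv_gvar_power]]])
      fix g
      show "of_nat 2 * ((gvar a g)\<^sup>2 - (gvar b g)\<^sup>2) ^ (2 - 1) * (of_nat 2 * gvar a g ^ (2 - 1) * ?V a g - of_nat 2 * gvar b g ^ (2 - 1) * ?V b g)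
        = ((gvar a g)\<^sup>2 - (gvar b g)\<^sup>2)\<^sup>2 * (8 * ?f g a b)"
        unfolding e right_diff_distrib[symmetric] power_diff_sum
        by (simp add: power2_eq_square del: sum.lessThan_Suc)
    qed (use ab in auto)
    thus ?thesis
      by (intro drv_log_prod finite_pairs) (simp only: case_prod_unfold mem_Collect_eq)
  qed
  have w: "drv ?I ?V (anti_weight r m) (\<lambda>g. anti_weight r m g * ?h g)"
    unfolding anti_weight_def
    by (rule drv_cong[OF drv_mult[OF w1 w2]]) (simp_all only: distrib_left mult_ac add_ac)
  have V0: "(\<Sum>\<alpha>\<in>?I. complex_of_real (g \<alpha>) * ?V \<alpha> g) = psum2 r m (Suc k) g" for g
    by (simp add: psum2_def sum_distrib_left mult_ac)
  let ?p = "\<lambda>k g. \<Sum>i<m. gvar i g ^ (2 * k)"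
  have div: "(\<Sum>\<alpha>\<in>?I. ?V' \<alpha> \<alpha> g) + ?h g = (\<Sum>s\<in>{..<Suc k}. 1 * (psum2 r m s g * psum2 r m (k - s) g)) + (-1) * psum2 r m k g" for g
  proof -
    have faa: "?f g a a = of_nat (Suc k) * gvar a g ^ (2 * k)" for a
    proof -
      have "?f g a a = (\<Sum>s<Suc k. gvar a g ^ (2 * k))"
      proof (intro sum.cong refl)
        fix s assume "s \<in> {..<Suc k}"
        hence "k = s + (Suc k - 1 - s)" by auto
        thus "(gvar a g)\<^sup>2 ^ s * (gvar a g)\<^sup>2 ^ (Suc k - 1 - s) = gvar a g ^ (2 * k)"
          by (metis power_add power_mult)
      qed
      thus ?thesis by simp
    qed
    \<comment> \<open>Since 4 k + 2 = 4 (k + 1) - 2, the divergence provides the diagonal of the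
      double sum and leaves -2 times the power sum; the factors \<theta>^(2r) add 4 r times
      it.\<close>
    have "(\<Sum>\<alpha>\<in>?I. ?V' \<alpha> \<alpha> g) + ?h g = 4 * (2 * (\<Sum>(a, b)\<in>?P. ?f g a b) + (\<Sum>a<m. ?f g a a))
        + (4 * of_nat r - 2) * ?p k g"
    proof -
      have "(\<Sum>\<alpha>\<in>?I. ?V' \<alpha> \<alpha> g) = (4 * of_nat k + 2) * ?p k g"
        unfolding sum_distrib_left by (intro sum.cong refl) (simp add: algebra_simps)
      moreover have "?h1 g = 4 * of_nat r * ?p k g"
        by (simp only: sum_distrib_left)
      moreover have "?h2 g = 8 * (\<Sum>(a, b)\<in>?P. ?f g a b)"
        by (simp only: sum_distrib_left case_prod_unfold)
      moreover have "(\<Sum>a<m. ?f g a a) = of_nat (Suc k) * ?p k g"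
        unfolding faa by (simp only: sum_distrib_left)
      ultimately show ?thesis by (simp only:) (simp add: algebra_simps del: sum.lessThan_Suc)
    qed
    also have "2 * (\<Sum>(a, b)\<in>?P. ?f g a b) + (\<Sum>a<m. ?f g a a) = (\<Sum>a<m. \<Sum>b<m. ?f g a b)"
      by (rule sum_pairs_symmetric, rule sum_powers_symmetric)
    also have "\<dots> = (\<Sum>s<Suc k. \<Sum>a<m. \<Sum>b<m. (gvar a g)\<^sup>2 ^ s * (gvar b g)\<^sup>2 ^ (Suc k - 1 - s))"
      by (subst (2) sum.swap, subst sum.swap) (rule refl)
    also have "\<dots> = (\<Sum>s<Suc k. ?p s g * ?p (k - s) g)"
      by (simp add: sum_product power_mult del: sum.lessThan_Suc)
    finally have 1: "(\<Sum>\<alpha>\<in>?I. ?V' \<alpha> \<alpha> g) + ?h g = 4 * (\<Sum>s<Suc k. ?p s g * ?p (k - s) g) + (4 * of_nat r - 2) * ?p k g" .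
    \<comment> \<open>The zero eigenvalues enter only at exponent 0, hence the corrections at s = 0
      and s = k. For k = 0 they leave r^2, which has to match the r subtracted with
      \<open>psum2 r m k\<close>: this is where r \<le> 1 is used.\<close>
    have "(\<Sum>s<Suc k. psum2 r m s g * psum2 r m (k - s) g) =
        (\<Sum>s<Suc k. 4 * (?p s g * ?p (k - s) g) + of_bool (s = k) * (2 * of_nat r * ?p s g)
          + of_bool (s = 0) * (2 * of_nat r * ?p (k - s) g) + of_bool (s = 0) * (of_nat r * of_nat r * of_bool (k - s = 0)))"
      unfolding psum2_def
      by (intro sum.cong refl) (auto simp: algebra_simps simp del: sum.lessThan_Suc)
    also have "\<dots> = 4 * (\<Sum>s<Suc k. ?p s g * ?p (k - s) g) + 4 * of_nat r * ?p k g + of_nat r * of_bool (k = 0)"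
      using r by (cases r) (simp_all add: sum.distrib sum_distrib_left[symmetric] del: sum.lessThan_Suc)
    finally show ?thesis unfolding 1 by (simp add: psum2_def algebra_simps del: sum.lessThan_Suc)
  qed
  show ?thesis
    by (subst moment_loop[where c = "\<lambda>l. 4 * of_nat l" and f = "\<lambda>l. k + l", OF _ V T w V0 div]) simp_all
qed

lemma psum2_moment_zero: "moment I w (psum2 r m) (0 # ks) = of_nat (2 * m + r) * moment I w (psum2 r m) ks"
proof -
  have "psum2 r m 0 g = of_nat (2 * m + r)" for g by (simp add: psum2_def)
  hence "(\<lambda>g. w g * (\<Prod>k\<leftarrow>0 # ks. psum2 r m k g)) = (\<lambda>g. of_nat (2 * m + r) * (w g * (\<Prod>k\<leftarrow>ks. psum2 r m k g)))"
    by (simp only: list.map prod_list.Cons mult.left_commute)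
  thus ?thesis by (simp only: moment_def integral_mult_right_zero)
qed

subsection \<open>The two matrix ensembles\<close>

definition gue_index :: "nat \<Rightarrow> (nat \<times> nat \<times> bool) set" where
  "gue_index n = {..<n} \<times> {..<n} \<times> UNIV"

text \<open>The coefficient of the Gaussian with index (i, j, \<beta>) in (G + G^H) / 2: it is (e_ij
  + e_ji) / 2 for a real part and \<i> (e_ij - e_ji) / 2 for an imaginary part, over ordered pairs
  (i, j).\<close>

definition gue_unit :: "nat \<times> nat \<times> bool \<Rightarrow> nat \<Rightarrow> nat \<Rightarrow> complex" where
  "gue_unit = (\<lambda>(i, j, \<beta>) a b. (of_bool (a = i \<and> b = j) * (if \<beta> then \<i> else 1) +
     of_bool (a = j \<and> b = i) * (if \<beta> then - \<i> else 1)) / 2)"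

interpretation gue: gauss_matrix "gue_index n" gue_unit n 0 for n
proof
  fix a b c d assume *: "a < n" "b < n" "c < n" "d < n"
  have "(\<Sum>\<alpha>\<in>gue_index n. gue_unit \<alpha> a b * gue_unit \<alpha> c d) =
    (\<Sum>i<n. \<Sum>j<n. \<Sum>\<beta>\<in>UNIV. gue_unit (i, j, \<beta>) a b * gue_unit (i, j, \<beta>) c d)"
    by (simp add: gue_index_def sum.cartesian_product')
  also have "\<dots> = (\<Sum>i<n. \<Sum>j<n. of_bool (i = a) * (of_bool (j = b) * (of_bool (a = d \<and> b = c) / 2))
      + of_bool (j = a) * (of_bool (i = b) * (of_bool (a = d \<and> b = c) / 2)))"
  proof (intro sum.cong refl)
    fix i j
    \<comment> \<open>Here p and q mark (a, b) as (i, j) or (j, i), and p', q' do so for (c, d). The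
      imaginary part carries \<i> squared and cancels the products p p' and q q'; only the
      transposed pairings survive, hence \<eta> = 0.\<close>
    have poly: "((p * 1 + q * 1) / 2) * ((p' * 1 + q' * 1) / 2) + ((p * \<i> + q * (- \<i>)) / 2) * ((p' * \<i> + q' * (- \<i>)) / 2)
      = (p * q' + q * p') / 2" for p q p' q' :: complex
    proof -
      have 1: "p * \<i> + q * (- \<i>) = (p - q) * \<i>" "p' * \<i> + q' * (- \<i>) = (p' - q') * \<i>"
        by (simp_all add: left_diff_distrib)
      have "(p - q) * \<i> / 2 * ((p' - q') * \<i> / 2) = ((p - q) * (p' - q')) * (\<i> * \<i>) / 4"
        by (simp only: times_divide_eq_left times_divide_eq_right divide_divide_eq_left mult_ac) simp
      hence 2: "(p - q) * \<i> / 2 * ((p' - q') * \<i> / 2) = - ((p - q) * (p' - q')) / 4" by simp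
      show ?thesis unfolding 1 2 by (simp add: field_simps)
    qed
    have "(\<Sum>\<beta>\<in>UNIV. gue_unit (i, j, \<beta>) a b * gue_unit (i, j, \<beta>) c d) =
      (of_bool (a = i \<and> b = j) * of_bool (c = j \<and> d = i) + of_bool (a = j \<and> b = i) * of_bool (c = i \<and> d = j)) / 2"
      by (rule trans[OF _ poly]) (simp only: UNIV_bool gue_unit_def prod.case if_True if_False sum.insert finite.intros sum.empty
        insert_iff empty_iff simp_thms add_0_right)
    moreover have "of_bool (a = i \<and> b = j) * of_bool (c = j \<and> d = i) = (of_bool (i = a) * (of_bool (j = b) * of_bool (a = d \<and> b = c)) :: complex)"
      "of_bool (a = j \<and> b = i) * of_bool (c = i \<and> d = j) = (of_bool (j = a) * (of_bool (i = b) * of_bool (a = d \<and> b = c)) :: complex)"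
      unfolding of_bool_conj[symmetric] by (intro arg_cong[where f = of_bool]; blast)+
    ultimately show "(\<Sum>\<beta>\<in>UNIV. gue_unit (i, j, \<beta>) a b * gue_unit (i, j, \<beta>) c d) =
      of_bool (i = a) * (of_bool (j = b) * (of_bool (a = d \<and> b = c) / 2))
      + of_bool (j = a) * (of_bool (i = b) * (of_bool (a = d \<and> b = c) / 2))"
      by (simp only: add_divide_distrib times_divide_eq_right)
  qed
  also have "\<dots> = of_bool (a = d \<and> b = c)"
  proof -
    have dd: "(\<Sum>i<n. \<Sum>j<n. of_bool (i = x) * (of_bool (j = y) * K)) = K" if "x < n" "y < n" for x y and K :: complex
      using that by (simp add: sum_distrib_left[symmetric])
    show ?thesis
      unfolding sum.distrib dd[OF *(1,2)]
      by (subst mult.left_commute, subst dd[OF *(2,1)]) simp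
  qed
  finally show "(\<Sum>\<alpha>\<in>gue_index n. gue_unit \<alpha> a b * gue_unit \<alpha> c d) = of_bool (a = d \<and> b = c) - 0 * of_bool (a = c \<and> b = d)"
    by simp
qed (auto simp: gue_index_def)

definition anti_unit :: "nat \<times> nat \<Rightarrow> nat \<Rightarrow> nat \<Rightarrow> complex" where
  "anti_unit = (\<lambda>(i, j) a b. \<i> * (of_bool (a = i \<and> b = j) - of_bool (a = j \<and> b = i)))"

interpretation anti: gauss_matrix "{(i, j). i < j \<and> j < N}" anti_unit N 1 for N
proof
  fix a b c d assume *: "a < N" "b < N" "c < N" "d < N"
  let ?I = "{(i, j). i < j \<and> j < N}"
  \<comment> \<open>Only the unit on the unordered pair of a and b is non-zero at (a, b), and
    exactly one of its two orderings lies in the index set. For a = b there is none, and both sides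
    vanish.\<close>
  have "(\<Sum>\<alpha>\<in>?I. anti_unit \<alpha> a b * anti_unit \<alpha> c d) =
      (\<Sum>\<alpha>\<in>?I. of_bool (\<alpha> = (a, b)) * (of_bool (a = d \<and> b = c) - of_bool (a = c \<and> b = d))
        + of_bool (\<alpha> = (b, a)) * (of_bool (a = d \<and> b = c) - of_bool (a = c \<and> b = d)))"
  proof (intro sum.cong refl)
    fix \<alpha> assume "\<alpha> \<in> ?I"
    then obtain x y where "\<alpha> = (x, y)" "x < y" by auto
    note xy = this
    consider "a = x" "b = y" | "a = y" "b = x" | "\<not> (a = x \<and> b = y)" "\<not> (a = y \<and> b = x)" by blast
    thus "anti_unit \<alpha> a b * anti_unit \<alpha> c d =
        of_bool (\<alpha> = (a, b)) * (of_bool (a = d \<and> b = c) - of_bool (a = c \<and> b = d))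
        + of_bool (\<alpha> = (b, a)) * (of_bool (a = d \<and> b = c) - of_bool (a = c \<and> b = d))"
    proof cases
      case 1
      show ?thesis unfolding xy(1) 1[symmetric] using xy(2)[folded 1]
        by (cases "c = a"; cases "d = b"; cases "c = b"; cases "d = a"; simp add: anti_unit_def)
    next
      case 2
      show ?thesis unfolding xy(1) 2[symmetric] using xy(2)[folded 2]
        by (cases "c = a"; cases "d = b"; cases "c = b"; cases "d = a"; simp add: anti_unit_def)
    next
      case 3
      hence "\<alpha> \<noteq> (a, b)" "\<alpha> \<noteq> (b, a)" "anti_unit \<alpha> a b = 0" unfolding xy(1) anti_unit_def by auto
      thus ?thesis by simp
    qed
  qed
  also have "\<dots> = of_bool (a = d \<and> b = c) - of_bool (a = c \<and> b = d)"
    using * by (cases a b rule: linorder_cases) (auto simp: sum.distrib sum_distrib_right[symmetric])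
  finally show "(\<Sum>\<alpha>\<in>?I. anti_unit \<alpha> a b * anti_unit \<alpha> c d) = of_bool (a = d \<and> b = c) - 1 * of_bool (a = c \<and> b = d)"
    by simp
next
  fix \<alpha> :: "nat \<times> nat" and a b :: nat
  obtain i j where \<alpha>: "\<alpha> = (i, j)" by (cases \<alpha>)
  have "(b = i \<and> a = j) = (a = j \<and> b = i)" "(b = j \<and> a = i) = (a = i \<and> b = j)" by blast+
  thus "anti_unit \<alpha> b a = - anti_unit \<alpha> a b"
    by (simp only: \<alpha> anti_unit_def prod.case right_diff_distrib minus_diff_eq)
qed (rule finite_pairs)

lemma moment_one_Nil: "moment I (\<lambda>_. 1) T [] = 1"
  by (simp add: moment_def std_normal.P.prob_space)

text \<open>The loop equations of density and matrix coincide and are linear in the moments, so the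
  two solutions differ by the value at the empty list: the mass of the squared Vandermonde product
  under the Gaussian measure.\<close>

theorem gue_moments:
  "moment {..<n} (vand2 n) (psum n) ks = moment {..<n} (vand2 n) (psum n) [] * moment (gue_index n) (\<lambda>_. 1) (gue.T n) ks"
proof (rule loop_unique[where \<Phi> = "moment {..<n} (vand2 n) (psum n)"])
  show "moment {..<n} (vand2 n) (psum n) [] = moment {..<n} (vand2 n) (psum n) [] * moment (gue_index n) (\<lambda>_. 1) (gue.T n) []"
    by (simp add: moment_one_Nil)
next
  fix ks assume "moment {..<n} (vand2 n) (psum n) ks = moment {..<n} (vand2 n) (psum n) [] * moment (gue_index n) (\<lambda>_. 1) (gue.T n) ks"
  thus "moment {..<n} (vand2 n) (psum n) (0 # ks) = moment {..<n} (vand2 n) (psum n) [] * moment (gue_index n) (\<lambda>_. 1) (gue.T n) (0 # ks)"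
    by (simp add: psum_moment_zero gue.moment_zero)
next
  fix k and ks :: "nat list"
  let ?A = "moment {..<n} (vand2 n) (psum n)" and ?B = "moment (gue_index n) (\<lambda>_. 1) (gue.T n)"
  assume IH: "\<And>ls. sum_list ls \<le> k + sum_list ks \<Longrightarrow> ?A ls = ?A [] * ?B ls"
  have 1: "?A (s # (k - 1 - s) # ks) = ?A [] * ?B (s # (k - 1 - s) # ks)" if "s < k" for s
    using that by (intro IH) simp
  have 2: "of_nat (ks ! j) * ?A (ks[j := k + ks ! j - 1]) = of_nat (ks ! j) * (?A [] * ?B (ks[j := k + ks ! j - 1]))" if "j < length ks" for j
  proof -
    have "sum_list (ks[j := k + ks ! j - 1]) \<le> sum_list ks + k"
      by (rule sum_list_update_le[OF that]) simp
    thus ?thesis using IH[of "ks[j := k + ks ! j - 1]"] by (simp only: add.commute)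
  qed
  show "?A (Suc k # ks) = ?A [] * ?B (Suc k # ks)"
  proof -
    have s1: "(\<Sum>s<k. ?A (s # (k - 1 - s) # ks)) = (\<Sum>s<k. ?A [] * ?B (s # (k - 1 - s) # ks))"
      by (intro sum.cong refl 1) simp
    have s2: "(\<Sum>j<length ks. of_nat (ks ! j) * ?A (ks[j := k + ks ! j - 1])) =
       (\<Sum>j<length ks. of_nat (ks ! j) * (?A [] * ?B (ks[j := k + ks ! j - 1])))"
      by (intro sum.cong refl 2) simp
    show ?thesis
      unfolding gue_density_loop gue.loop gue.\<kappa>_def s1 s2
      by (simp add: sum_distrib_left distrib_left mult.left_commute)
  qed
qed

text \<open>The matrix equation is taken at the odd index 2 k + 1. Odd traces vanish, so only even s
  remain in the sum over splittings; the alternating sum of 2 k + 1 signs is 1; and \<kappa> = 2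
  times the exponent 2 l gives the 4 l of the density equation.\<close>

theorem antigue_moments:
  assumes r: "r \<le> 1"
  shows "moment {..<m} (anti_weight r m) (psum2 r m) ks = moment {..<m} (anti_weight r m) (psum2 r m) [] *
     moment {(i, j). i < j \<and> j < 2 * m + r} (\<lambda>_. 1) (\<lambda>k. anti.T (2 * m + r) (2 * k)) ks"
proof -
  define N where "N = 2 * m + r"
  let ?A = "moment {..<m} (anti_weight r m) (psum2 r m)" and ?T = "anti.T N"
  let ?M = "moment {(i, j). i < j \<and> j < N} (\<lambda>_. 1)"
  let ?B = "?M (\<lambda>k. ?T (2 * k))"
  have B: "?B ls = ?M ?T (map ((*) 2) ls)" for ls by (simp add: moment_def o_def)
  have loop: "?B (Suc k # ks) = (\<Sum>s<Suc k. ?B (s # (k - s) # ks)) - ?B (k # ks)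
     + (\<Sum>j<length ks. 4 * of_nat (ks ! j) * ?B (ks[j := k + ks ! j]))" for k ks
  proof -
    let ?M' = "\<lambda>s. ?M ?T (s # (2 * k - s) # map ((*) 2) ks)"
    have odd: "?M' s = 0" if "odd s" for s
      using that by (simp add: moment_def anti.T_odd)
    have "(\<Sum>s<2 * k + 1. ?M' s) = (\<Sum>s\<in>{s. s < 2 * k + 1 \<and> even s}. ?M' s)"
      by (rule sum.mono_neutral_right) (auto simp: odd)
    also have "\<dots> = (\<Sum>s<Suc k. ?M' (2 * s))"
      by (rule sum.reindex_bij_witness[of _ "\<lambda>s. 2 * s" "\<lambda>s. s div 2"]) auto
    finally have 1: "(\<Sum>s<2 * k + 1. ?M' s) = (\<Sum>s<Suc k. ?M' (2 * s))" .
    have 2: "(\<Sum>s<2 * k + 1. (-1) ^ s) = (1 :: complex)"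
      by (induction k) auto
    have 3: "(map ((*) 2) ks)[j := 2 * k + 2 * ks ! j] = map ((*) 2) (ks[j := k + ks ! j])" if "j < length ks" for j
      using that by (simp add: map_update)
    show ?thesis
      unfolding B list.map
      using anti.loop[of N "2 * k + 1" "map ((*) 2) ks"] 1 2
      by (simp add: anti.\<kappa>_def 3 diff_mult_distrib2 del: sum.lessThan_Suc cong: sum.cong_simp)
  qed
  have "?A ks = ?A [] * ?B ks"
  proof (rule loop_unique[where \<Phi> = ?A])
    show "?A [] = ?A [] * ?B []" by (simp add: moment_one_Nil)
  next
    fix ks assume "?A ks = ?A [] * ?B ks"
    thus "?A (0 # ks) = ?A [] * ?B (0 # ks)"
      by (simp add: psum2_moment_zero B anti.moment_zero) (simp add: N_def)
  next
    fix k and ks :: "nat list"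
    assume IH: "\<And>ls. sum_list ls \<le> k + sum_list ks \<Longrightarrow> ?A ls = ?A [] * ?B ls"
    have 1: "?A (s # (k - s) # ks) = ?A [] * ?B (s # (k - s) # ks)" if "s < Suc k" for s
      using that by (intro IH) simp
    have 2: "?A (ks[j := k + ks ! j]) = ?A [] * ?B (ks[j := k + ks ! j])" if "j < length ks" for j
    proof -
      have "sum_list (ks[j := k + ks ! j]) \<le> sum_list ks + k"
        by (rule sum_list_update_le[OF that]) simp
      thus ?thesis by (intro IH) (simp only: add.commute)
    qed
    have 3: "?A (k # ks) = ?A [] * ?B (k # ks)" by (rule IH) simp
    show "?A (Suc k # ks) = ?A [] * ?B (Suc k # ks)"
      unfolding antigue_density_loop[OF r] loop 3
      by (simp add: 1 2 sum_distrib_left ring_distribs mult_ac del: sum.lessThan_Suc cong: sum.cong_simp)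
  qed
  thus ?thesis by (simp add: N_def)
qed

section \<open>Random multisets\<close>

text \<open>Linear statistics of a point configuration; the number of points in B is the case
  \<open>indicator B\<close>.\<close>

definition lin :: "(real \<Rightarrow> real) \<Rightarrow> real multiset \<Rightarrow> real" where
  "lin f X = (\<Sum>x\<in>#X. f x)"

lemma lin_empty [simp]: "lin f {#} = 0"
  and lin_add_mset [simp]: "lin f (add_mset x X) = f x + lin f X"
  and lin_plus [simp]: "lin f (X + Y) = lin f X + lin f Y"
  by (simp_all add: lin_def)

lemma lin_sum: "lin (\<lambda>x. \<Sum>i\<in>A. f i x) X = (\<Sum>i\<in>A. lin (f i) X)"
  by (induction X) (simp_all add: sum.distrib)

lemma lin_cmult: "lin (\<lambda>x. c * f x) X = c * lin f X"
  by (induction X) (simp_all add: distrib_left)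

lemma lin_cong: "(\<And>x. x \<in># X \<Longrightarrow> f x = g x) \<Longrightarrow> lin f X = lin g X"
  by (induction X) simp_all

lemma lin_nonneg: "(\<And>x. x \<in># X \<Longrightarrow> 0 \<le> f x) \<Longrightarrow> 0 \<le> lin f X"
  by (induction X) simp_all

lemma lin_tendsto: "(\<And>x. x \<in># X \<Longrightarrow> (\<lambda>n. f n x) \<longlonglongrightarrow> g x) \<Longrightarrow> (\<lambda>n. lin (f n) X) \<longlonglongrightarrow> lin g X"
  by (induction X) (auto intro!: tendsto_add)

lemma lin_indicator: "lin (indicator B) X = size (filter_mset (\<lambda>x. x \<in> B) X)"
  by (induction X) (simp_all add: indicator_def)

lemma lin_mset_set: "finite A \<Longrightarrow> lin f (mset_set A) = (\<Sum>x\<in>A. f x)"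
  by (simp add: lin_def sum_unfold_sum_mset)

section \<open>Measurability on the space of finite multisets\<close>

lemma space_mset_borel [simp]: "space mset_borel = UNIV"
  unfolding mset_borel_def by (rule space_measure_of) auto

lemma sets_mset_borel:
  "sets mset_borel = sigma_sets UNIV {{X. size (filter_mset (\<lambda>x. x \<in> B) X) = k} | B k. B \<in> sets borel}"
  unfolding mset_borel_def by (rule sets_measure_of) auto

lemma measurable_filter_size:
  assumes "B \<in> sets borel"
  shows "(\<lambda>X. size (filter_mset (\<lambda>x. x \<in> B) X)) \<in> measurable mset_borel (count_space UNIV)"
proof (subst measurable_count_space_eq2_countable, intro conjI ballI)
  fix k
  have "(\<lambda>X. size (filter_mset (\<lambda>x. x \<in> B) X)) -` {k} \<inter> space mset_borel = {X. size (filter_mset (\<lambda>x. x \<in> B) X) = k}"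
    by auto
  also have "\<dots> \<in> sets mset_borel"
    unfolding sets_mset_borel using assms by (intro sigma_sets.Basic) auto
  finally show "(\<lambda>X. size (filter_mset (\<lambda>x. x \<in> B) X)) -` {k} \<inter> space mset_borel \<in> sets mset_borel" .
qed auto

lemma measurable_size_mset: "size \<in> measurable mset_borel (count_space UNIV)"
  using measurable_filter_size[of UNIV] by simp

lemma measurable_lin_indicator: "B \<in> sets borel \<Longrightarrow> lin (indicator B) \<in> borel_measurable mset_borel"
  unfolding lin_indicator[abs_def]
  by (auto intro!: measurable_compose[OF measurable_filter_size])

lemma measurable_mset_borel_indicatorI:
  assumes "\<And>B. B \<in> sets borel \<Longrightarrow> (\<lambda>\<omega>. lin (indicator B) (f \<omega>)) \<in> borel_measurable M"
  shows "f \<in> measurable M mset_borel"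
  unfolding mset_borel_def
proof (rule measurable_measure_of)
  fix Y assume "Y \<in> {{X :: real multiset. size (filter_mset (\<lambda>x. x \<in> B) X) = k} | B k. B \<in> sets borel}"
  then obtain B k where B: "B \<in> sets borel" and Y: "Y = {X. size (filter_mset (\<lambda>x. x \<in> B) X) = k}" by blast
  have "f -` Y \<inter> space M = {\<omega> \<in> space M. lin (indicator B) (f \<omega>) = real k}"
    unfolding Y lin_indicator by auto
  also have "\<dots> \<in> sets M" using assms[OF B] by measurable
  finally show "f -` Y \<inter> space M \<in> sets M" .
qed auto

text \<open>Dynkin's lemma. Half-lines form a generating system stable under intersection;
  complements need the total number of points, and countable disjoint unions are pointwise limits of
  finite sums of counts.\<close>

lemma measurable_mset_borel_atMostI:
  assumes size: "(\<lambda>\<omega>. real (size (f \<omega>))) \<in> borel_measurable M"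
    and a: "\<And>a. (\<lambda>\<omega>. lin (indicator {..a}) (f \<omega>)) \<in> borel_measurable M"
  shows "f \<in> measurable M mset_borel"
proof (rule measurable_mset_borel_indicatorI)
  fix B :: "real set" assume "B \<in> sets borel"
  also have "sets borel = sigma_sets UNIV (range (atMost :: real \<Rightarrow> _))"
    by (subst borel_eq_atMost) (simp add: full_SetCompr_eq)
  finally have B: "B \<in> sigma_sets UNIV (range atMost)" .
  have "Int_stable (range (atMost :: real \<Rightarrow> _))"
    by (auto simp: Int_stable_def)
  moreover have "range (atMost :: real \<Rightarrow> _) \<subseteq> Pow UNIV" by simp
  ultimately show "(\<lambda>\<omega>. lin (indicator B) (f \<omega>)) \<in> borel_measurable M"
    using B
  proof (induction rule: sigma_sets_induct_disjoint)
    case (basic A)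
    then obtain t where A: "A = {..t}" by blast
    show ?case unfolding A by (rule a)
  next
    case empty
    have "lin (indicator {}) X = 0" for X by (simp add: lin_indicator)
    thus ?case by (simp only: borel_measurable_const)
  next
    case (compl A)
    have "lin (indicator (UNIV - A)) X = real (size X) - lin (indicator A) X" for X
      by (induction X) (auto simp: indicator_def)
    thus ?case using compl size by simp
  next
    case (union A)
    have *: "lin (indicator (\<Union>i<n. A i)) X = (\<Sum>i<n. lin (indicator (A i)) X)" for n X
      unfolding lin_sum[symmetric]
      by (intro lin_cong) (use union(1) in \<open>auto simp: indicator_UN_disjoint disjoint_family_on_def\<close>)
    have "(\<lambda>n. lin (indicator (\<Union>i<n. A i)) X) \<longlonglongrightarrow> lin (indicator (\<Union>i. A i)) X" for X
      by (intro lin_tendsto LIMSEQ_indicator_UN)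
    note lim = this
    show ?case
    proof (rule borel_measurable_LIMSEQ_real)
      show "(\<lambda>n. lin (indicator (\<Union>i<n. A i)) (f \<omega>)) \<longlonglongrightarrow> lin (indicator (\<Union>i. A i)) (f \<omega>)" for \<omega>
        by (rule lim)
      show "(\<lambda>\<omega>. lin (indicator (\<Union>i<n. A i)) (f \<omega>)) \<in> borel_measurable M" for n
        unfolding * by (intro borel_measurable_sum union(3))
    qed
  qed
qed

text \<open>Listing the points in increasing order gives measurable coordinates on multisets of any
  size. The value 0 beyond the size is a placeholder.\<close>

definition pt :: "nat \<Rightarrow> real multiset \<Rightarrow> real" where
  "pt i X = (if i < size X then sorted_list_of_multiset X ! i else 0)"

lemma sorted_nth_le_iff:
  fixes xs :: "real list"
  assumes "sorted xs" "i < length xs"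
  shows "xs ! i \<le> a \<longleftrightarrow> i < length (filter (\<lambda>x. x \<le> a) xs)"
  using assms
proof (induction xs arbitrary: i)
  case (Cons x xs)
  show ?case
  proof (cases "x \<le> a")
    case True
    thus ?thesis using Cons by (cases i) auto
  next
    case False
    hence "\<forall>y\<in>set xs. \<not> y \<le> a" using Cons.prems(1) by fastforce
    hence "filter (\<lambda>x. x \<le> a) xs = []" by (simp add: filter_empty_conv)
    moreover have "\<not> (x # xs) ! i \<le> a"
      using \<open>\<forall>y\<in>set xs. \<not> y \<le> a\<close> False Cons.prems(2) by (cases i) auto
    ultimately show ?thesis using False by simp
  qed
qed simp

lemma length_sorted_list_of_multiset: "length (sorted_list_of_multiset X) = size X"
  by (metis mset_sorted_list_of_multiset size_mset)

text \<open>The point with index i, counted from 0, is at most a exactly if more than i points are,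
  and counts are measurable by construction of \<open>mset_borel\<close>. Beyond the size the
  placeholder 0 decides.\<close>

lemma measurable_pt: "pt i \<in> borel_measurable mset_borel"
proof (rule borel_measurable_iff_le[THEN iffD2], intro allI)
  fix a
  have [measurable]: "Measurable.pred mset_borel (\<lambda>X. i < size X)"
    by (intro measurable_compose[OF measurable_size_mset]) auto
  have [measurable]: "Measurable.pred mset_borel (\<lambda>X. i < size (filter_mset (\<lambda>x. x \<le> a) X))"
    using measurable_compose[OF measurable_filter_size[of "{..a}"], of "\<lambda>k. i < k" "count_space UNIV"] by simp
  have eq: "pt i X \<le> a \<longleftrightarrow> (i < size X \<and> i < size (filter_mset (\<lambda>x. x \<le> a) X)) \<or> (\<not> i < size X \<and> 0 \<le> a)" for X
  proof -
    have "size (filter_mset (\<lambda>x. x \<le> a) X) = length (filter (\<lambda>x. x \<le> a) (sorted_list_of_multiset X))"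
      by (metis mset_filter mset_sorted_list_of_multiset size_mset)
    thus ?thesis
      using sorted_nth_le_iff[OF sorted_sorted_list_of_multiset, of i X a]
      by (auto simp: pt_def length_sorted_list_of_multiset)
  qed
  show "{X \<in> space mset_borel. pt i X \<le> a} \<in> sets mset_borel" unfolding eq by measurable
qed

lemma lin_pt: "lin f X = (\<Sum>i<size X. f (pt i X))"
proof -
  have "lin f X = lin f (mset (sorted_list_of_multiset X))" by simp
  also have "\<dots> = sum_list (map f (sorted_list_of_multiset X))"
    unfolding lin_def by (simp only: mset_map[symmetric] sum_mset_sum_list)
  also have "\<dots> = (\<Sum>i<size X. f (sorted_list_of_multiset X ! i))"
    by (simp add: sum_list_sum_nth length_sorted_list_of_multiset atLeast0LessThan)
  finally show ?thesis by (simp add: pt_def)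
qed

text \<open>On each of the countably many events of fixed size this is a finite sum over the sorted
  points.\<close>

lemma measurable_lin:
  assumes [measurable]: "f \<in> borel_measurable borel"
  shows "lin f \<in> borel_measurable mset_borel"
  unfolding lin_pt[abs_def]
proof (rule measurable_compose_countable[OF _ measurable_size_mset])
  fix k :: nat
  have [measurable]: "pt i \<in> borel_measurable mset_borel" for i by (rule measurable_pt)
  show "(\<lambda>X. \<Sum>i<k. f (pt i X)) \<in> borel_measurable mset_borel" by measurable
qed

definition distinct_part :: "real multiset \<Rightarrow> real multiset" where
  "distinct_part X = mset_set (set_mset X - {0})"

lemma lin_count:
  "finite A \<Longrightarrow> set_mset X \<subseteq> A \<Longrightarrow> lin f X = (\<Sum>x\<in>A. real (count X x) * f x)"
proof (induction X)
  case (add x X)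
  have "(\<Sum>y\<in>A. real (count (add_mset x X) y) * f y) = (\<Sum>y\<in>A. (if y = x then f x else 0) + real (count X y) * f y)"
    by (intro sum.cong) (auto simp: algebra_simps)
  thus ?case using add by (simp add: sum.distrib)
qed simp

text \<open>Weighting every point with the reciprocal of its multiplicity turns a sum over distinct
  values into a sum over all points. Multiplicities are expressed by comparing sorted points, so the
  right-hand side is visibly measurable on each event of fixed size.\<close>

lemma lin_distinct_part:
  "lin f (distinct_part X) = (\<Sum>i<size X. f (pt i X) * of_bool (pt i X \<noteq> 0) / (\<Sum>j<size X. of_bool (pt j X = pt i X)))"
proof -
  have c: "real (count X x) = (\<Sum>j<size X. of_bool (pt j X = x))" for x
    unfolding lin_pt[of "\<lambda>y. of_bool (y = x)", symmetric]
    by (induction X) auto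
  have "lin f (distinct_part X) = (\<Sum>x\<in>set_mset X - {0}. f x)"
    unfolding distinct_part_def by (rule lin_mset_set) auto
  also have "\<dots> = (\<Sum>x\<in>set_mset X. f x * of_bool (x \<noteq> 0))"
    by (intro sum.mono_neutral_cong_left) auto
  also have "\<dots> = (\<Sum>x\<in>set_mset X. real (count X x) * (f x * of_bool (x \<noteq> 0) / count X x))"
    by (intro sum.cong) auto
  also have "\<dots> = lin (\<lambda>x. f x * of_bool (x \<noteq> 0) / count X x) X"
    by (rule lin_count[symmetric]) auto
  finally show ?thesis unfolding lin_pt c by simp
qed

lemma measurable_distinct_part: "distinct_part \<in> measurable mset_borel mset_borel"
proof (rule measurable_mset_borel_indicatorI)
  fix B :: "real set" assume [measurable]: "B \<in> sets borel"
  have [measurable]: "pt i \<in> borel_measurable mset_borel" for i by (rule measurable_pt)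
  show "(\<lambda>X. lin (indicator B) (distinct_part X)) \<in> borel_measurable mset_borel"
    unfolding lin_distinct_part
    by (rule measurable_compose_countable[OF _ measurable_size_mset]) measurable
qed

lemma measurable_mset_plus: "(\<lambda>(X, Y). X + Y) \<in> measurable (mset_borel \<Otimes>\<^sub>M mset_borel) mset_borel"
proof (rule measurable_mset_borel_indicatorI)
  fix B :: "real set" assume B: "B \<in> sets borel"
  show "(\<lambda>XY. lin (indicator B) (case XY of (X, Y) \<Rightarrow> X + Y)) \<in> borel_measurable (mset_borel \<Otimes>\<^sub>M mset_borel)"
    unfolding case_prod_unfold lin_plus
    by (intro borel_measurable_add measurable_compose[OF measurable_fst] measurable_compose[OF measurable_snd]
        measurable_lin_indicator B)
qed

subsection \<open>Determination by moments\<close>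

text \<open>Levy's uniqueness theorem after rescaling to probability measures: t = 0 shows that the
  total masses agree, and mass zero is treated apart because it cannot be normalized.\<close>

lemma finite_measure_eq_char:
  fixes M1 M2 :: "real measure"
  assumes fin: "finite_measure M1" "finite_measure M2" and s: "sets M1 = sets borel" "sets M2 = sets borel"
    and eq: "\<And>t. (\<integral>x. iexp (t * x) \<partial>M1) = (\<integral>x. iexp (t * x) \<partial>M2)"
  shows "M1 = M2"
proof -
  interpret M1: finite_measure M1 by fact
  interpret M2: finite_measure M2 by fact
  have sp: "space M1 = UNIV" "space M2 = UNIV" using sets_eq_imp_space_eq[OF s(1)] sets_eq_imp_space_eq[OF s(2)] by simp_all
  define c where "c = measure M1 UNIV"
  have c2: "measure M2 UNIV = c"
    using eq[of 0] by (simp add: c_def sp)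
  show ?thesis
  proof (cases "c = 0")
    case True
    have "emeasure M1 UNIV = 0" "emeasure M2 UNIV = 0"
      using True c2 M1.emeasure_eq_measure M2.emeasure_eq_measure by (simp_all add: c_def)
    hence "emeasure M1 A = 0" "emeasure M2 A = 0" for A
      using emeasure_mono[of A UNIV M1] emeasure_mono[of A UNIV M2] sets.top[of M1] sets.top[of M2]
      by (simp_all add: sp)
    thus ?thesis using s by (intro measure_eqI) auto
  next
    case False
    hence c: "c > 0" by (simp add: c_def less_le)
    define N where "N = (\<lambda>M :: real measure. scale_measure (ennreal (1 / c)) M)"
    have N: "real_distribution (N M)" "char (N M) t = (1 / c) *\<^sub>R (\<integral>x. iexp (t * x) \<partial>M)"
      if M: "finite_measure M" "sets M = sets borel" "measure M UNIV = c" for M t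
    proof -
      interpret M: finite_measure M by fact
      have spM: "space M = UNIV" using sets_eq_imp_space_eq[OF M(2)] by simp
      have "emeasure (N M) (space (N M)) = 1"
        using c M(3) by (simp add: N_def spM space_scale_measure M.emeasure_eq_measure ennreal_mult[symmetric])
      thus "real_distribution (N M)"
        by (intro real_distribution.intro real_distribution_axioms.intro prob_spaceI) (simp_all add: N_def M(2) spM space_scale_measure)
      have "N M = density M (\<lambda>_. ennreal (1 / c))"
        by (rule measure_eqI) (simp_all add: N_def emeasure_density nn_integral_cmult_indicator)
      hence "char (N M) t = (\<integral>x. iexp (t * x) \<partial>density M (\<lambda>_. ennreal (1 / c)))"
        by (simp add: char_def)
      also have "\<dots> = (\<integral>x. (1 / c) *\<^sub>R iexp (t * x) \<partial>M)"
        by (rule integral_density) (use c M(2) in \<open>auto simp: measurable_cong_sets[OF M(2) refl]\<close>)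
      finally show "char (N M) t = (1 / c) *\<^sub>R (\<integral>x. iexp (t * x) \<partial>M)" by simp
    qed
    have "N M1 = N M2"
      by (intro Levy_uniqueness N(1) ext) (use fin s c2 c_def eq in \<open>simp_all add: N(2)\<close>)
    hence "emeasure (N M1) A = emeasure (N M2) A" for A by simp
    hence "ennreal (1 / c) * emeasure M1 A = ennreal (1 / c) * emeasure M2 A" for A
      by (simp add: N_def)
    hence "ennreal c * (ennreal (1 / c) * emeasure M1 A) = ennreal c * (ennreal (1 / c) * emeasure M2 A)" for A
      by simp
    hence "emeasure M1 A = emeasure M2 A" for A
      using c by (simp add: mult.assoc[symmetric] ennreal_mult[symmetric])
    thus ?thesis using s by (intro measure_eqI) auto
  qed
qed

text \<open>
  The intensity measure of the points and their negatives, weighted by \<open>W\<close>. Symmetrizing makes the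
  characteristic function a series in the even moments alone.
\<close>

definition symm_points :: "nat \<Rightarrow> (real multiset \<Rightarrow> real) \<Rightarrow> real multiset measure \<Rightarrow> real measure" where
  "symm_points n W P = distr (density (count_space ({..<n} \<times> {1, -1}) \<Otimes>\<^sub>M P) (\<lambda>p. ennreal (W (snd p)))) borel
     (\<lambda>p. snd (fst p) * pt (fst (fst p)) (snd p))"

context
  fixes P :: "real multiset measure" and n :: nat and W :: "real multiset \<Rightarrow> real"
  assumes P: "prob_space P" "sets P = sets mset_borel"
    and W [measurable]: "W \<in> borel_measurable mset_borel" and W0: "\<And>X. 0 \<le> W X" and Wi: "integrable P W"
begin

interpretation P: prob_space P by (rule P)

lemma measurable_P [simp]: "measurable P = measurable mset_borel"
  using measurable_cong_sets[OF P(2) refl] by blast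

lemma pair_P: "pair_sigma_finite (count_space ({..<n} \<times> {1, -1 :: real})) P"
  by (intro pair_sigma_finite.intro sigma_finite_measure_count_space_finite P.sigma_finite_measure_axioms) auto

lemma measurable_symm:
  "(\<lambda>p. snd (fst p) * pt (fst (fst p)) (snd p)) \<in> borel_measurable (count_space ({..<n} \<times> {1, -1 :: real}) \<Otimes>\<^sub>M P)"
proof -
  have *: "pt i \<in> borel_measurable P" for i using measurable_pt P(2) by simp
  show "(\<lambda>p. snd (fst p) * pt (fst (fst p)) (snd p)) \<in> borel_measurable (count_space ({..<n} \<times> {1, -1 :: real}) \<Otimes>\<^sub>M P)"
    by (rule measurable_compose_countable'[where I = "{..<n} \<times> {1, -1 :: real}" and g = fst
          and f = "\<lambda>i p. snd i * pt (fst i) (snd p)"])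
       (auto intro!: borel_measurable_times measurable_compose[OF measurable_snd *] countable_finite)
qed

lemma measurable_W_snd: "(\<lambda>p. W (snd p)) \<in> borel_measurable (count_space ({..<n} \<times> {1, -1 :: real}) \<Otimes>\<^sub>M P)"
  by (rule measurable_compose[OF measurable_snd]) (simp add: W)

text \<open>Change of variables, then Fubini over the finite set of positions and signs. The bound
  on h makes its product with the integrable weight W integrable.\<close>

lemma symm_points_integral:
  fixes h :: "real \<Rightarrow> 'b :: {banach, second_countable_topology}"
  assumes h: "h \<in> borel_measurable borel" and bd: "\<And>x. norm (h x) \<le> b"
  shows "(\<integral>x. h x \<partial>symm_points n W P) = (\<Sum>i<n. \<integral>X. W X *\<^sub>R h (pt i X) \<partial>P) + (\<Sum>i<n. \<integral>X. W X *\<^sub>R h (- pt i X) \<partial>P)"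
    and "finite_measure (symm_points n W P)"
proof -
  let ?C = "count_space ({..<n} \<times> {1, -1 :: real})"
  interpret pair_sigma_finite ?C P by (rule pair_P)
  have hm: "(\<lambda>p. h (snd (fst p) * pt (fst (fst p)) (snd p))) \<in> borel_measurable (?C \<Otimes>\<^sub>M P)"
    by (rule measurable_compose[OF measurable_symm h])
  have Wh: "integrable P (\<lambda>X. W X *\<^sub>R h (s * pt i X))" for i s
  proof (rule Bochner_Integration.integrable_bound)
    show "integrable P (\<lambda>X. b * W X)" using Wi by simp
    have [measurable]: "pt i \<in> borel_measurable mset_borel" by (rule measurable_pt)
    note h [measurable]
    show "(\<lambda>X. W X *\<^sub>R h (s * pt i X)) \<in> borel_measurable P" unfolding measurable_P by measurable
    show "AE X in P. norm (W X *\<^sub>R h (s * pt i X)) \<le> norm (b * W X)"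
    proof (rule AE_I2)
      fix X
      have "norm (W X *\<^sub>R h (s * pt i X)) \<le> W X * b" using bd[of "s * pt i X"] W0[of X] by (simp add: mult_left_mono)
      thus "norm (W X *\<^sub>R h (s * pt i X)) \<le> norm (b * W X)" by (simp add: mult.commute abs_le_iff)
    qed
  qed
  have m2: "(\<lambda>p. W (snd p) *\<^sub>R h (snd (fst p) * pt (fst (fst p)) (snd p))) \<in> borel_measurable (?C \<Otimes>\<^sub>M P)"
    by (rule borel_measurable_scaleR[OF measurable_W_snd hm])
  have C: "integrable ?C g" for g :: "_ \<Rightarrow> real"
    by (intro integrable_count_space) auto
  have int: "integrable (?C \<Otimes>\<^sub>M P) (\<lambda>p. W (snd p) *\<^sub>R h (snd (fst p) * pt (fst (fst p)) (snd p)))"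
    by (rule Fubini_integrable[OF m2 C]) (simp only: fst_conv snd_conv Wh AE_I2)
  have "(\<integral>x. h x \<partial>symm_points n W P) = (\<integral>p. h (snd (fst p) * pt (fst (fst p)) (snd p))
    \<partial>density (?C \<Otimes>\<^sub>M P) (\<lambda>p. ennreal (W (snd p))))"
    unfolding symm_points_def
    by (rule integral_distr) (use h measurable_symm in simp_all)
  also have "\<dots> = (\<integral>p. W (snd p) *\<^sub>R h (snd (fst p) * pt (fst (fst p)) (snd p)) \<partial>(?C \<Otimes>\<^sub>M P))"
    by (rule integral_density[OF hm measurable_W_snd]) (simp add: W0)
  also have "\<dots> = (\<integral>c. (\<integral>X. W X *\<^sub>R h (snd c * pt (fst c) X) \<partial>P) \<partial>?C)"
    using integral_fst'[OF int] by (simp only: fst_conv snd_conv)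
  also have "\<dots> = (\<Sum>c\<in>{..<n} \<times> {1, -1}. \<integral>X. W X *\<^sub>R h (snd c * pt (fst c) X) \<partial>P)"
    by (rule lebesgue_integral_count_space_finite) auto
  also have "\<dots> = (\<Sum>i<n. (\<integral>X. W X *\<^sub>R h (pt i X) \<partial>P) + (\<integral>X. W X *\<^sub>R h (- pt i X) \<partial>P))"
    by (subst sum.cartesian_product') simp
  finally show "(\<integral>x. h x \<partial>symm_points n W P) = (\<Sum>i<n. \<integral>X. W X *\<^sub>R h (pt i X) \<partial>P) + (\<Sum>i<n. \<integral>X. W X *\<^sub>R h (- pt i X) \<partial>P)"
    by (simp add: sum.distrib)
  have "integrable (?C \<Otimes>\<^sub>M P) (\<lambda>p. W (snd p))"
    by (rule Fubini_integrable[OF measurable_W_snd C]) (simp only: fst_conv snd_conv Wi AE_I2)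
  hence fin: "(\<integral>\<^sup>+p. ennreal (norm (W (snd p))) \<partial>(?C \<Otimes>\<^sub>M P)) < \<infinity>"
    unfolding integrable_iff_bounded by blast
  have "emeasure (symm_points n W P) (space (symm_points n W P)) =
      emeasure (density (?C \<Otimes>\<^sub>M P) (\<lambda>p. ennreal (W (snd p)))) (space (?C \<Otimes>\<^sub>M P))"
    unfolding symm_points_def using measurable_symm
    by (subst emeasure_distr) simp_all
  also have "\<dots> = (\<integral>\<^sup>+p. ennreal (norm (W (snd p))) \<partial>(?C \<Otimes>\<^sub>M P))"
    by (subst emeasure_density) (use measurable_W_snd W0 in \<open>auto intro!: nn_integral_cong measurable_compose[OF measurable_W_snd]\<close>)
  finally show "finite_measure (symm_points n W P)" using fin by (intro finite_measureI) auto
qed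

text \<open>Almost surely the first n sorted points are all the points, so the sum over positions is
  a linear statistic.\<close>

lemma integral_lin_pt:
  fixes h :: "real \<Rightarrow> real"
  assumes h [measurable]: "h \<in> borel_measurable borel" and bd: "\<And>x. norm (h x) \<le> b" and n: "AE X in P. size X = n"
  shows "(\<Sum>i<n. \<integral>X. W X *\<^sub>R h (pt i X) \<partial>P) = (\<integral>X. W X * lin h X \<partial>P)"
proof -
  have "(\<Sum>i<n. \<integral>X. W X *\<^sub>R h (pt i X) \<partial>P) = (\<integral>X. (\<Sum>i<n. W X *\<^sub>R h (pt i X)) \<partial>P)"
  proof (rule Bochner_Integration.integral_sum[symmetric])
    fix i
    have [measurable]: "pt i \<in> borel_measurable mset_borel" by (rule measurable_pt)
    show "integrable P (\<lambda>X. W X *\<^sub>R h (pt i X))"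
    proof (rule Bochner_Integration.integrable_bound)
      show "integrable P (\<lambda>X. b * W X)" using Wi by simp
      show "(\<lambda>X. W X *\<^sub>R h (pt i X)) \<in> borel_measurable P" unfolding measurable_P by measurable
      show "AE X in P. norm (W X *\<^sub>R h (pt i X)) \<le> norm (b * W X)"
      proof (rule AE_I2)
        fix X
        have "norm (W X *\<^sub>R h (pt i X)) \<le> W X * b" using bd[of "pt i X"] W0[of X] by (simp add: abs_mult mult_left_mono)
        thus "norm (W X *\<^sub>R h (pt i X)) \<le> norm (b * W X)" by (simp add: mult.commute abs_le_iff)
      qed
    qed
  qed
  also have "\<dots> = (\<integral>X. W X * lin h X \<partial>P)"
  proof (rule integral_cong_AE)
    have [measurable]: "lin h \<in> borel_measurable mset_borel" by (rule measurable_lin[OF h])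
    have [measurable]: "pt i \<in> borel_measurable mset_borel" for i by (rule measurable_pt)
    show "(\<lambda>X. W X * lin h X) \<in> borel_measurable P" unfolding measurable_P by measurable
    show "(\<lambda>X. \<Sum>i<n. W X *\<^sub>R h (pt i X)) \<in> borel_measurable P" unfolding measurable_P by measurable
    show "AE X in P. (\<Sum>i<n. W X *\<^sub>R h (pt i X)) = W X * lin h X"
      using n by eventually_elim (simp add: lin_pt sum_distrib_left)
  qed
  finally show ?thesis .
qed

text \<open>Termwise integration of the cosine series. Even powers and W are nonnegative, so the
  absolute values of the terms have as integrals exactly the terms of the series assumed
  summable.\<close>

lemma cos_moments:
  assumes n: "AE X in P. size X = n"
    and int: "\<And>k. integrable P (\<lambda>X. W X * lin (\<lambda>x. x ^ (2 * k)) X)"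
    and sm: "\<And>t. summable (\<lambda>k. t ^ (2 * k) / fact (2 * k) * (\<integral>X. W X * lin (\<lambda>x. x ^ (2 * k)) X \<partial>P))"
  shows "(\<integral>X. W X * lin (\<lambda>x. cos (t * x)) X \<partial>P) =
    (\<Sum>k. (-1) ^ k * t ^ (2 * k) / fact (2 * k) * (\<integral>X. W X * lin (\<lambda>x. x ^ (2 * k)) X \<partial>P))"
proof -
  let ?a = "\<lambda>k. (-1) ^ k * t ^ (2 * k) / fact (2 * k)"
  let ?f = "\<lambda>k X. ?a k * (W X * lin (\<lambda>x. x ^ (2 * k)) X)"
  have lin_sums: "(\<lambda>k. ?a k * lin (\<lambda>x. x ^ (2 * k)) X) sums lin (\<lambda>x. cos (t * x)) X" for X
  proof (induction X)
    case (add x X)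
    have "(\<lambda>k. ?a k * x ^ (2 * k)) sums cos (t * x)"
      using cos_paired[of "t * x"] by (simp add: power_mult_distrib mult.assoc)
    from sums_add[OF this add] show ?case by (simp add: distrib_left)
  qed simp
  hence s: "(\<lambda>k. ?f k X) sums (W X * lin (\<lambda>x. cos (t * x)) X)" for X
    using sums_mult[OF lin_sums[of X], of "W X"] by (simp add: mult_ac)
  have L0: "0 \<le> lin (\<lambda>x. x ^ (2 * k)) X" for k X by (intro lin_nonneg) (simp add: power_mult)
  have nrm: "norm (?f k X) = t ^ (2 * k) / fact (2 * k) * (W X * lin (\<lambda>x. x ^ (2 * k)) X)" for k X
    using W0[of X] L0[of k X] by (simp add: abs_mult power_abs power_mult)
  have abs_sum: "summable (\<lambda>k. t ^ (2 * k) / fact (2 * k) * lin (\<lambda>x. x ^ (2 * k)) X)" for X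
  proof (induction X)
    case (add x X)
    \<comment> \<open>The even part of the exponential series of |t x|: odd terms are replaced by
      zero, then the series is reindexed.\<close>
    have "summable (\<lambda>k. inverse (fact k) * \<bar>t * x\<bar> ^ k)" by (rule summable_exp)
    hence "summable (\<lambda>k. (\<lambda>k. inverse (fact k) * \<bar>t * x\<bar> ^ k * of_bool (even k)) k)"
      by (rule summable_comparison_test'[where N = 0]) auto
    hence "summable (\<lambda>k. (\<lambda>k. inverse (fact k) * \<bar>t * x\<bar> ^ k * of_bool (even k)) (2 * k))"
      by (subst summable_mono_reindex) (auto simp: strict_mono_def image_iff elim!: evenE)
    moreover have "inverse (fact (2 * k)) * \<bar>t * x\<bar> ^ (2 * k) * of_bool (even (2 * k)) = t ^ (2 * k) / fact (2 * k) * x ^ (2 * k)" for k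
    proof -
      have "\<bar>t * x\<bar> ^ (2 * k) = (t * x) ^ (2 * k)" by (rule power_even_abs) simp
      thus ?thesis by (simp add: power_mult_distrib divide_inverse)
    qed
    ultimately have "summable (\<lambda>k. t ^ (2 * k) / fact (2 * k) * x ^ (2 * k))" by simp
    from summable_add[OF this add] show ?case by (simp add: distrib_left)
  qed simp
  have "(\<integral>X. W X * lin (\<lambda>x. cos (t * x)) X \<partial>P) = (\<integral>X. (\<Sum>k. ?f k X) \<partial>P)"
    using s by (simp add: sums_iff)
  also have "\<dots> = (\<Sum>k. \<integral>X. ?f k X \<partial>P)"
  proof (rule integral_suminf)
    show "integrable P (?f k)" for k by (intro integrable_mult_right int)
    show "AE X in P. summable (\<lambda>k. norm (?f k X))"
      unfolding nrm
    proof (rule AE_I2)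
      fix X
      show "summable (\<lambda>k. t ^ (2 * k) / fact (2 * k) * (W X * lin (\<lambda>x. x ^ (2 * k)) X))"
        using summable_mult[OF abs_sum[of X], of "W X"] by (simp add: mult_ac)
    qed
    show "summable (\<lambda>k. \<integral>X. norm (?f k X) \<partial>P)"
      unfolding nrm using sm[of t] by simp
  qed
  finally show ?thesis by simp
qed

end

text \<open>Symmetrization kills the sine part, so the characteristic function of the weighted
  intensity is twice the cosine transform, a series in the even moments by
  \<open>cos_moments\<close>. Hence \<open>finite_measure_eq_char\<close> identifies the symmetrized
  intensities.\<close>

lemma moments_determine_intensity:
  fixes P Q :: "real multiset measure" and W :: "real multiset \<Rightarrow> real"
  assumes P: "prob_space P" "sets P = sets mset_borel" and Q: "prob_space Q" "sets Q = sets mset_borel"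
    and W: "W \<in> borel_measurable mset_borel" "\<And>X. 0 \<le> W X" and Wi: "integrable P W" "integrable Q W"
    and n: "AE X in P. size X = n" "AE X in Q. size X = n"
    and nonneg: "AE X in P. \<forall>x\<in>#X. 0 \<le> x" "AE X in Q. \<forall>x\<in>#X. 0 \<le> x"
    and int: "\<And>k. integrable P (\<lambda>X. W X * lin (\<lambda>x. x ^ (2 * k)) X)" "\<And>k. integrable Q (\<lambda>X. W X * lin (\<lambda>x. x ^ (2 * k)) X)"
    and eq: "\<And>k. (\<integral>X. W X * lin (\<lambda>x. x ^ (2 * k)) X \<partial>P) = (\<integral>X. W X * lin (\<lambda>x. x ^ (2 * k)) X \<partial>Q)"
    and sm: "\<And>t. summable (\<lambda>k. t ^ (2 * k) / fact (2 * k) * (\<integral>X. W X * lin (\<lambda>x. x ^ (2 * k)) X \<partial>P))"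
    and B: "B \<in> sets borel"
  shows "(\<integral>X. W X * lin (indicator B) X \<partial>P) = (\<integral>X. W X * lin (indicator B) X \<partial>Q)"
proof -
  note sP = symm_points_integral[OF P W Wi(1), of _ 1 n] and sQ = symm_points_integral[OF Q W Wi(2), of _ 1 n]
  have finP: "finite_measure (symm_points n W P)" and finQ: "finite_measure (symm_points n W Q)"
    using sP(2)[of "\<lambda>_. 0 :: real"] sQ(2)[of "\<lambda>_. 0 :: real"] by simp_all
  have sets: "sets (symm_points n W M) = sets borel" for M by (simp add: symm_points_def)
  have cos_int: "(\<integral>x. cos (t * x) \<partial>symm_points n W M) = 2 * (\<integral>X. W X * lin (\<lambda>x. cos (t * x)) X \<partial>M)"
    and sin_int: "(\<integral>x. sin (t * x) \<partial>symm_points n W M) = 0"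
    if M: "prob_space M" "sets M = sets mset_borel" "integrable M W" "AE X in M. size X = n" for M t
    using symm_points_integral(1)[OF M(1,2) W M(3), of "\<lambda>x. cos (t * x)" 1 n]
      symm_points_integral(1)[OF M(1,2) W M(3), of "\<lambda>x. sin (t * x)" 1 n]
      integral_lin_pt[OF M(1,2) W M(3), of "\<lambda>x. cos (t * x)" 1 n] M(4)
    by (simp_all add: sum_negf)
  have char: "(\<integral>x. iexp (t * x) \<partial>symm_points n W M) = complex_of_real (2 * (\<integral>X. W X * lin (\<lambda>x. cos (t * x)) X \<partial>M))"
    if M: "prob_space M" "sets M = sets mset_borel" "integrable M W" "AE X in M. size X = n" for M t
  proof -
    interpret S: finite_measure "symm_points n W M"
      using symm_points_integral(2)[OF M(1,2) W M(3), of "\<lambda>_. 0 :: real" 1 n] by simp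
    have i: "integrable (symm_points n W M) (\<lambda>x. complex_of_real (cos (t * x)))"
       "integrable (symm_points n W M) (\<lambda>x. complex_of_real (sin (t * x)))"
      by (rule S.integrable_const_bound[of _ 1]; simp add: measurable_cong_sets[OF sets refl])+
    have "(\<integral>x. iexp (t * x) \<partial>symm_points n W M) = (\<integral>x. complex_of_real (cos (t * x)) + \<i> * complex_of_real (sin (t * x)) \<partial>symm_points n W M)"
      by (intro Bochner_Integration.integral_cong refl) (simp add: exp_Euler cos_of_real sin_of_real del: of_real_mult flip: of_real_mult)
    also have "\<dots> = complex_of_real (\<integral>x. cos (t * x) \<partial>symm_points n W M) + \<i> * complex_of_real (\<integral>x. sin (t * x) \<partial>symm_points n W M)"
      using i by (subst Bochner_Integration.integral_add) simp_all
    finally show ?thesis unfolding cos_int[OF M] sin_int[OF M] by simp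
  qed
  have smQ: "summable (\<lambda>k. t ^ (2 * k) / fact (2 * k) * (\<integral>X. W X * lin (\<lambda>x. x ^ (2 * k)) X \<partial>Q))" for t
    using sm[of t] unfolding eq .
  have "symm_points n W P = symm_points n W Q"
  proof (rule finite_measure_eq_char[OF finP finQ sets sets])
    fix t
    show "(\<integral>x. iexp (t * x) \<partial>symm_points n W P) = (\<integral>x. iexp (t * x) \<partial>symm_points n W Q)"
      unfolding char[OF P Wi(1) n(1)] char[OF Q Wi(2) n(2)]
        cos_moments[OF P W Wi(1) n(1) int(1) sm] cos_moments[OF Q W Wi(2) n(2) int(2) smQ] eq ..
  qed
  \<comment> \<open>The even test function \<open>indicator B \<bar>x\<bar>\<close> undoes the
    symmetrization because the points are nonnegative; each point is counted twice.\<close>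
  moreover have ind: "(\<integral>x. indicator B \<bar>x\<bar> \<partial>symm_points n W M) = 2 * (\<integral>X. W X * lin (indicator B) X \<partial>M)"
    if M: "prob_space M" "sets M = sets mset_borel" "integrable M W" "AE X in M. size X = n" "AE X in M. \<forall>x\<in>#X. 0 \<le> x" for M
  proof -
    let ?h = "\<lambda>x :: real. indicator B \<bar>x\<bar> :: real"
    have h: "?h \<in> borel_measurable borel" using B by measurable
    have "(\<integral>x. ?h x \<partial>symm_points n W M) = 2 * (\<integral>X. W X * lin ?h X \<partial>M)"
      using symm_points_integral(1)[OF M(1,2) W M(3) h, of 1 n]
        integral_lin_pt[OF M(1,2) W M(3) h, of 1 n] M(4) by (simp add: indicator_def)
    also have "(\<integral>X. W X * lin ?h X \<partial>M) = (\<integral>X. W X * lin (indicator B) X \<partial>M)"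
    proof (rule integral_cong_AE)
      show "(\<lambda>X. W X * lin ?h X) \<in> borel_measurable M" "(\<lambda>X. W X * lin (indicator B) X) \<in> borel_measurable M"
        unfolding measurable_cong_sets[OF M(2) refl]
        by (intro borel_measurable_times W measurable_lin h measurable_lin_indicator B)+
      show "AE X in M. W X * lin ?h X = W X * lin (indicator B) X"
        using M(5) by eventually_elim (auto intro!: lin_cong)
    qed
    finally show ?thesis .
  qed
  ultimately show ?thesis
    using ind[OF P Wi(1) n(1) nonneg(1)] ind[OF Q Wi(2) n(2) nonneg(2)] by simp
qed

section \<open>From weighted intensities to the law of the multiset\<close>

abbreviation prod_lin :: "nat list \<Rightarrow> real multiset \<Rightarrow> real" where
  "prod_lin ks X \<equiv> (\<Prod>k\<leftarrow>ks. lin (\<lambda>x. x ^ (2 * k)) X)"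

lemma prod_lin_nonneg: "0 \<le> prod_lin ks X"
  by (induction ks) (auto intro!: mult_nonneg_nonneg lin_nonneg simp: power_mult)

lemma measurable_prod_lin: "prod_lin ks \<in> borel_measurable mset_borel"
  by (induction ks) (auto intro!: borel_measurable_times measurable_lin)

text \<open>The Lagrange basis polynomial of the node k among 0, ..., n.\<close>

lemma exists_interpolation_poly:
  assumes "k \<le> n"
  shows "\<exists>q :: real poly. \<forall>j\<le>n. poly q (real j) = of_bool (j = k)"
proof
  let ?q = "\<Prod>i\<in>{..n} - {k}. Polynomial.smult (1 / (real k - real i)) [:- real i, 1:]"
  show "\<forall>j\<le>n. poly ?q (real j) = of_bool (j = k)"
  proof (intro allI impI)
    fix j assume "j \<le> n"
    show "poly ?q (real j) = of_bool (j = k)"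
    proof (cases "j = k")
      case True
      have "poly ?q (real k) = (\<Prod>i\<in>{..n} - {k}. 1)"
        unfolding poly_prod
      proof (intro prod.cong refl)
        fix i assume "i \<in> {..n} - {k}"
        hence nz: "(real k - real i = 0) = False" by simp
        have p: "poly [:- real i, 1:] (real k) = real k - real i" by simp
        show "poly (Polynomial.smult (1 / (real k - real i)) [:- real i, 1:]) (real k) = 1"
          by (simp only: poly_smult p times_divide_eq_left mult_1_left divide_self_if nz if_False)
      qed
      thus ?thesis using True by simp
    next
      case False
      have "(\<Prod>i\<in>{..n} - {k}. poly (Polynomial.smult (1 / (real k - real i)) [:- real i, 1:]) (real j)) = 0"
        using False \<open>j \<le> n\<close> by (intro prod_zero) (auto intro!: bexI[of _ j])
      thus ?thesis using False by (simp add: poly_prod)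
    qed
  qed
qed

text \<open>All factors but one are frozen into a nonnegative weight; the even moments of the
  remaining one determine the weighted intensity by \<open>moments_determine_intensity\<close>, and
  so a count may be added to the weight. Iterating yields all joint counts, and the events
  prescribing finitely many counts generate \<open>mset_borel\<close>.\<close>

theorem mset_measure_eq_moments:
  fixes P Q :: "real multiset measure"
  assumes P: "prob_space P" "sets P = sets mset_borel" and Q: "prob_space Q" "sets Q = sets mset_borel"
    and n: "AE X in P. size X = n" "AE X in Q. size X = n"
    and nonneg: "AE X in P. \<forall>x\<in>#X. 0 \<le> x" "AE X in Q. \<forall>x\<in>#X. 0 \<le> x"
    and int: "\<And>ks. integrable P (prod_lin ks)" "\<And>ks. integrable Q (prod_lin ks)"
    and eq: "\<And>ks. (\<integral>X. prod_lin ks X \<partial>P) = (\<integral>X. prod_lin ks X \<partial>Q)"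
    and sm: "\<And>t ks. summable (\<lambda>k. t ^ (2 * k) / fact (2 * k) * (\<integral>X. prod_lin (k # ks) X \<partial>P))"
  shows "P = Q"
proof -
  interpret P: prob_space P by fact
  interpret Q: prob_space Q by fact
  have mP: "measurable P N = measurable mset_borel N" and mQ: "measurable Q N = measurable mset_borel N" for N :: "real measure"
    using measurable_cong_sets[OF P(2) refl] measurable_cong_sets[OF Q(2) refl] by blast+
  \<comment> \<open>The good weights contain the constants and are closed under multiplication by point counts.
    Counts take at most \<open>n + 1\<close> values, so indicators of their values are polynomials in them and
    the cylinder events become good.\<close>
  define good where "good = (\<lambda>W. W \<in> borel_measurable mset_borel \<and> (\<forall>X. 0 \<le> W X) \<and> (\<exists>C. \<forall>X. W X \<le> C) \<and>
     (\<forall>ks. (\<integral>X. W X * prod_lin ks X \<partial>P) = (\<integral>X. W X * prod_lin ks X \<partial>Q)))"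
  have bint: "integrable P (\<lambda>X. W X * prod_lin ks X)" "integrable Q (\<lambda>X. W X * prod_lin ks X)"
    if W: "W \<in> borel_measurable mset_borel" "\<And>X. \<bar>W X\<bar> \<le> C" for W C ks
  proof -
    have bd: "norm (W X * prod_lin ks X) \<le> norm (C * prod_lin ks X)" for X
      using mult_right_mono[OF order_trans[OF W(2)[of X] abs_ge_self[of C]] abs_ge_zero[of "prod_lin ks X"]]
      by (simp add: abs_mult)
    show "integrable P (\<lambda>X. W X * prod_lin ks X)" "integrable Q (\<lambda>X. W X * prod_lin ks X)"
      by (rule Bochner_Integration.integrable_bound[OF integrable_mult_right[OF int(1), of C ks]],
          unfold mP, intro borel_measurable_times W measurable_prod_lin, intro AE_I2 bd,
          rule Bochner_Integration.integrable_bound[OF integrable_mult_right[OF int(2), of C ks]],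
          unfold mQ, intro borel_measurable_times W measurable_prod_lin, intro AE_I2 bd)
  qed
  \<comment> \<open>Setting the count to 0 off the almost sure event \<open>size X = n\<close> makes
    it bounded by n everywhere, so that good weights stay bounded.\<close>
  define N where "N = (\<lambda>B X. if size X = n then lin (indicator B) X else 0)"
  have N_nat: "N B X = real (if size X = n then size (filter_mset (\<lambda>x. x \<in> B) X) else 0)" for B X
    by (simp add: N_def lin_indicator)
  have N_bd: "0 \<le> N B X" "N B X \<le> real n" for B X
    unfolding N_nat using size_filter_mset_lesseq[of "\<lambda>x. x \<in> B" X] by auto
  have N_m: "N B \<in> borel_measurable mset_borel" if "B \<in> sets borel" for B
    unfolding N_def
    by (intro measurable_If borel_measurable_const measurable_lin_indicator that)
       (use measurable_compose[OF measurable_size_mset, of "\<lambda>k. k = n" "count_space UNIV"] in \<open>simp add: pred_def\<close>)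
  have good_N: "good (\<lambda>X. W X * N B X)" if W: "good W" and B: "B \<in> sets borel" for W B
  proof -
    obtain C where Wm: "W \<in> borel_measurable mset_borel" and W0: "\<And>X. 0 \<le> W X" and WC: "\<And>X. W X \<le> C"
      and We: "\<And>ks. (\<integral>X. W X * prod_lin ks X \<partial>P) = (\<integral>X. W X * prod_lin ks X \<partial>Q)"
      using W unfolding good_def by blast
    have Wabs: "\<bar>W X\<bar> \<le> C" for X using W0 WC by simp
    have C0: "0 \<le> C" using W0[of "{#}"] WC[of "{#}"] by linarith
    have "(\<integral>X. W X * N B X * prod_lin ks X \<partial>P) = (\<integral>X. W X * N B X * prod_lin ks X \<partial>Q)" for ks
    proof -
      let ?W = "\<lambda>X. W X * prod_lin ks X"
      have cons: "?W X * lin (\<lambda>x. x ^ (2 * k)) X = W X * prod_lin (k # ks) X" for X k by simp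
      have "(\<integral>X. ?W X * lin (indicator B) X \<partial>P) = (\<integral>X. ?W X * lin (indicator B) X \<partial>Q)"
      proof (rule moments_determine_intensity[OF P Q _ _ _ _ n nonneg _ _ _ _ B])
        show "?W \<in> borel_measurable mset_borel" by (intro borel_measurable_times Wm measurable_prod_lin)
        show "0 \<le> ?W X" for X by (intro mult_nonneg_nonneg W0 prod_lin_nonneg)
        show "integrable P ?W" "integrable Q ?W" by (intro bint[OF Wm Wabs])+
        show "integrable P (\<lambda>X. ?W X * lin (\<lambda>x. x ^ (2 * k)) X)" "integrable Q (\<lambda>X. ?W X * lin (\<lambda>x. x ^ (2 * k)) X)" for k
          unfolding cons by (intro bint[OF Wm Wabs])+
        show "(\<integral>X. ?W X * lin (\<lambda>x. x ^ (2 * k)) X \<partial>P) = (\<integral>X. ?W X * lin (\<lambda>x. x ^ (2 * k)) X \<partial>Q)" for k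
          unfolding cons by (rule We)
        \<comment> \<open>The unweighted moment series, multiplied by the bound C of W, is a
          majorant.\<close>
        show "summable (\<lambda>k. t ^ (2 * k) / fact (2 * k) * (\<integral>X. ?W X * lin (\<lambda>x. x ^ (2 * k)) X \<partial>P))" for t
        proof (rule summable_comparison_test')
          show "summable (\<lambda>k. C * (t ^ (2 * k) / fact (2 * k) * (\<integral>X. prod_lin (k # ks) X \<partial>P)))"
            by (rule summable_mult[OF sm])
          fix k :: nat
          have "(\<integral>X. W X * prod_lin (k # ks) X \<partial>P) \<le> (\<integral>X. C * prod_lin (k # ks) X \<partial>P)"
            by (intro integral_mono bint[OF Wm Wabs] integrable_mult_right int mult_right_mono WC prod_lin_nonneg)
          also have "\<dots> = C * (\<integral>X. prod_lin (k # ks) X \<partial>P)" by simp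
          finally have *: "(\<integral>X. W X * prod_lin (k # ks) X \<partial>P) \<le> C * (\<integral>X. prod_lin (k # ks) X \<partial>P)" .
          have t: "0 \<le> t ^ (2 * k) / fact (2 * k)" by (simp add: power_mult)
          have nn: "0 \<le> (\<integral>X. W X * prod_lin (k # ks) X \<partial>P)"
            by (intro Bochner_Integration.integral_nonneg mult_nonneg_nonneg W0 prod_lin_nonneg)
          have "norm (t ^ (2 * k) / fact (2 * k) * (\<integral>X. W X * prod_lin (k # ks) X \<partial>P)) =
            t ^ (2 * k) / fact (2 * k) * (\<integral>X. W X * prod_lin (k # ks) X \<partial>P)"
            using mult_nonneg_nonneg[OF t nn] by (simp only: real_norm_def abs_of_nonneg)
          also have "\<dots> \<le> C * (t ^ (2 * k) / fact (2 * k) * (\<integral>X. prod_lin (k # ks) X \<partial>P))"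
            using mult_left_mono[OF * t] by (simp only: mult.left_commute)
          finally show "norm (t ^ (2 * k) / fact (2 * k) * (\<integral>X. ?W X * lin (\<lambda>x. x ^ (2 * k)) X \<partial>P))
            \<le> C * (t ^ (2 * k) / fact (2 * k) * (\<integral>X. prod_lin (k # ks) X \<partial>P))"
            unfolding cons .
        qed
      qed
      moreover have "(\<integral>X. W X * N B X * prod_lin ks X \<partial>M) = (\<integral>X. ?W X * lin (indicator B) X \<partial>M)"
        if M: "sets M = sets mset_borel" "AE X in M. size X = n" for M
      proof (rule integral_cong_AE)
        show "(\<lambda>X. W X * N B X * prod_lin ks X) \<in> borel_measurable M" "(\<lambda>X. ?W X * lin (indicator B) X) \<in> borel_measurable M"
          unfolding measurable_cong_sets[OF M(1) refl]
          by (intro borel_measurable_times Wm N_m B measurable_prod_lin measurable_lin_indicator)+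
        show "AE X in M. W X * N B X * prod_lin ks X = ?W X * lin (indicator B) X"
          using M(2) by eventually_elim (simp add: N_def)
      qed
      ultimately show ?thesis using P Q n by simp
    qed
    moreover have "(\<lambda>X. W X * N B X) \<in> borel_measurable mset_borel"
      by (intro borel_measurable_times Wm N_m B)
    moreover have "0 \<le> W X * N B X" "W X * N B X \<le> C * real n" for X
      using mult_mono[OF WC[of X] N_bd(2)[of B X] C0 N_bd(1)] W0[of X] N_bd(1)[of B X] by simp_all
    ultimately show ?thesis unfolding good_def by blast
  qed
  have good_pow: "good (\<lambda>X. W X * N B X ^ j)" if "good W" "B \<in> sets borel" for W B j
  proof (induction j)
    case (Suc j)
    from good_N[OF this that(2)] show ?case by (simp add: mult.assoc mult.commute[of "N B _"])
  qed (use that in simp)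
  have good_bool: "good (\<lambda>X. W X * of_bool (N B X = real k))" if W: "good W" and B: "B \<in> sets borel" for W B k
  proof -
    obtain C where Wm: "W \<in> borel_measurable mset_borel" and W0: "\<And>X. 0 \<le> W X" and WC: "\<And>X. W X \<le> C"
      using W unfolding good_def by blast
    have C0: "0 \<le> C" using W0[of "{#}"] WC[of "{#}"] by linarith
    have "(\<integral>X. W X * of_bool (N B X = real k) * prod_lin ks X \<partial>P) = (\<integral>X. W X * of_bool (N B X = real k) * prod_lin ks X \<partial>Q)" for ks
    proof (cases "k \<le> n")
      case True
      obtain q :: "real poly" where q: "\<And>j. j \<le> n \<Longrightarrow> poly q (real j) = of_bool (j = k)"
        using exists_interpolation_poly[OF True] by blast
      have e: "W X * of_bool (N B X = real k) * prod_lin ks X = (\<Sum>i\<le>degree q. coeff q i * (W X * N B X ^ i * prod_lin ks X))" for X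
      proof -
        obtain j where j: "N B X = real j" using N_nat[of B X] by blast
        hence "j \<le> n" using N_bd(2)[of B X] by simp
        hence "of_bool (N B X = real k) = (\<Sum>i\<le>degree q. coeff q i * N B X ^ i)"
          using q[of j] by (simp add: j poly_altdef)
        thus ?thesis by (simp add: sum_distrib_left sum_distrib_right mult_ac)
      qed
      have Wb: "\<bar>W X * N B X ^ i\<bar> \<le> C * real n ^ i" for i X
        using mult_mono[OF WC[of X] power_mono[OF N_bd(2)[of B X] N_bd(1)] C0] W0[of X] N_bd(1)[of B X]
        by (simp add: abs_mult power_abs)
      have Wm': "(\<lambda>X. W X * N B X ^ i) \<in> borel_measurable mset_borel" for i
        by (intro borel_measurable_times borel_measurable_power Wm N_m B)
      have "(\<integral>X. W X * N B X ^ i * prod_lin ks X \<partial>P) = (\<integral>X. W X * N B X ^ i * prod_lin ks X \<partial>Q)" for i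
        using good_pow[OF W B, of i] unfolding good_def by blast
      thus ?thesis unfolding e
        by (simp only: Bochner_Integration.integral_sum integrable_mult_right bint[OF Wm' Wb] integral_mult_right_zero)
    next
      case False
      hence "N B X \<noteq> real k" for X using N_bd(2)[of B X] by simp
      thus ?thesis by simp
    qed
    moreover have "(\<lambda>X. W X * of_bool (N B X = real k)) \<in> borel_measurable mset_borel"
      using measurable_compose[OF N_m[OF B], of "\<lambda>x. of_bool (x = real k) :: real" borel] Wm
      by (intro borel_measurable_times) auto
    moreover have "0 \<le> W X * of_bool (N B X = real k)" "W X * of_bool (N B X = real k) \<le> C" for X
      using W0[of X] WC[of X] C0 by auto
    ultimately show ?thesis unfolding good_def by blast
  qed
  have good_one: "good (\<lambda>_. 1)"
    unfolding good_def using eq by auto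
  have good_list: "(\<forall>(B, k)\<in>set l. B \<in> sets borel) \<Longrightarrow> good (\<lambda>X. of_bool (\<forall>(B, k)\<in>set l. N B X = real k))" for l :: "(real set \<times> nat) list"
  proof (induction l)
    case (Cons Bk l)
    obtain B k where Bk: "Bk = (B, k)" by (cases Bk)
    have "good (\<lambda>X. of_bool (\<forall>(B, k)\<in>set l. N B X = real k) * of_bool (N B X = real k))"
      using Cons Bk by (intro good_bool) auto
    also have "(\<lambda>X. of_bool (\<forall>(B, k)\<in>set l. N B X = real k) * of_bool (N B X = real k) :: real) =
      (\<lambda>X. of_bool (\<forall>(B, k)\<in>set (Bk # l). N B X = real k))"
      by (auto simp: Bk)
    finally show ?case .
  qed (use good_one in simp)
  \<comment> \<open>Constraints are kept in a list, so intersecting two events is appending their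
    lists and the empty list gives the whole space.\<close>
  define cyl where "cyl = (\<lambda>l :: (real set \<times> nat) list. {X. \<forall>(B, k)\<in>set l. size (filter_mset (\<lambda>x. x \<in> B) X) = k})"
  define G where "G = {cyl l | l. \<forall>(B, k)\<in>set l. B \<in> sets borel}"
  have cyl_sets: "cyl l \<in> sets mset_borel" if "\<forall>(B, k)\<in>set l. B \<in> sets borel" for l
    using that
  proof (induction l)
    case (Cons Bk l)
    obtain B k where Bk: "Bk = (B, k)" by (cases Bk)
    have "cyl (Bk # l) = {X. size (filter_mset (\<lambda>x. x \<in> B) X) = k} \<inter> cyl l" by (auto simp: cyl_def Bk)
    moreover have "{X. size (filter_mset (\<lambda>x. x \<in> B) X) = k} \<in> sets mset_borel"
      unfolding sets_mset_borel using Cons.prems Bk by (intro sigma_sets.Basic) auto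
    ultimately show ?case using Cons by auto
  next
    case Nil
    show ?case using sets.top[of mset_borel] by (simp add: cyl_def)
  qed
  have sigma: "sets mset_borel = sigma_sets UNIV G"
  proof
    show "sets mset_borel \<subseteq> sigma_sets UNIV G"
      unfolding sets_mset_borel
    proof (rule sigma_sets_mono', safe)
      fix B :: "real set" and k :: nat assume "B \<in> sets borel"
      thus "{X. size (filter_mset (\<lambda>x. x \<in> B) X) = k} \<in> G"
        unfolding G_def by (intro CollectI exI[of _ "[(B, k)]"]) (auto simp: cyl_def)
    qed
    show "sigma_sets UNIV G \<subseteq> sets mset_borel"
      using sets.sigma_sets_subset[of G mset_borel] cyl_sets by (auto simp: G_def)
  qed
  show ?thesis
  proof (rule measure_eqI_generator_eq[where E = G and \<Omega> = UNIV and A = "\<lambda>_. UNIV"])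
    show "Int_stable G"
      unfolding Int_stable_def
    proof (intro ballI)
      fix a b assume "a \<in> G" "b \<in> G"
      then obtain l l' where l: "a = cyl l" "\<forall>(B, k)\<in>set l. B \<in> sets borel" "b = cyl l'" "\<forall>(B, k)\<in>set l'. B \<in> sets borel"
        unfolding G_def by blast
      have "a \<inter> b = cyl (l @ l')" by (simp only: l cyl_def set_append ball_Un Collect_conj_eq)
      moreover have "\<forall>(B, k)\<in>set (l @ l'). B \<in> sets borel" using l by auto
      ultimately show "a \<inter> b \<in> G" unfolding G_def by blast
    qed
    show "range (\<lambda>_. UNIV) \<subseteq> G"
      unfolding G_def by (auto intro!: exI[of _ "[]"] simp: cyl_def)
    show "emeasure P UNIV \<noteq> \<infinity>" for i :: nat by simp
    show "sets P = sigma_sets UNIV G" "sets Q = sigma_sets UNIV G" using P Q sigma by simp_all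
    fix X assume "X \<in> G"
    then obtain l where X: "X = cyl l" and l: "\<forall>(B, k)\<in>set l. B \<in> sets borel" unfolding G_def by blast
    have m: "measure M X = (\<integral>X. of_bool (\<forall>(B, k)\<in>set l. N B X = real k) \<partial>M)"
      if M: "prob_space M" "sets M = sets mset_borel" "AE X in M. size X = n" for M
    proof -
      interpret M: prob_space M by fact
      have XM: "X \<in> sets M" using cyl_sets[OF l] M(2) X by simp
      have "measure M X = (\<integral>Y. indicator X Y \<partial>M)"
        using XM by simp
      also have "\<dots> = (\<integral>X. of_bool (\<forall>(B, k)\<in>set l. N B X = real k) \<partial>M)"
      proof (rule integral_cong_AE)
        show "(\<lambda>Y. indicator X Y :: real) \<in> borel_measurable M" using XM by simp
        show "(\<lambda>X. of_bool (\<forall>(B, k)\<in>set l. N B X = real k) :: real) \<in> borel_measurable M"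
          unfolding measurable_cong_sets[OF M(2) refl] using good_list[OF l] unfolding good_def by blast
        show "AE Y in M. indicator X Y = of_bool (\<forall>(B, k)\<in>set l. N B Y = real k)"
          using M(3) by eventually_elim (simp add: X cyl_def N_nat indicator_def)
      qed
      finally show ?thesis .
    qed
    have "measure P X = measure Q X"
      unfolding m[OF P n(1)] m[OF Q n(2)] using good_list[OF l] unfolding good_def
      by (metis (mono_tags, lifting) Bochner_Integration.integral_cong list.simps(8) mult.right_neutral prod_list.Nil)
    thus "emeasure P X = emeasure Q X"
      by (simp add: P.emeasure_eq_measure Q.emeasure_eq_measure)
  qed auto
qed

section \<open>Singular values\<close>

definition tr :: "complex mat \<Rightarrow> complex" where
  "tr A = (\<Sum>i<dim_row A. A $$ (i, i))"

lemma mat_mult_index: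
  assumes "A \<in> carrier_mat n n" "B \<in> carrier_mat n n" "i < n" "j < n"
  shows "(A * B) $$ (i, j) = (\<Sum>k<n. A $$ (i, k) * B $$ (k, j))"
  using assms by (auto simp: scalar_prod_def atLeast0LessThan intro!: sum.cong)

lemma tr_carrier: "A \<in> carrier_mat n n \<Longrightarrow> tr A = (\<Sum>i<n. A $$ (i, i))"
  by (simp add: tr_def)

lemma tr_mult_commute:
  assumes "A \<in> carrier_mat n n" "B \<in> carrier_mat n n"
  shows "tr (A * B) = tr (B * A)"
proof -
  have "tr (A * B) = (\<Sum>i<n. \<Sum>k<n. A $$ (i, k) * B $$ (k, i))"
    unfolding tr_carrier[OF mult_carrier_mat[OF assms]]
    by (intro sum.cong refl mat_mult_index[OF assms]) auto
  also have "\<dots> = (\<Sum>k<n. \<Sum>i<n. A $$ (i, k) * B $$ (k, i))" by (rule sum.swap)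
  also have "\<dots> = (\<Sum>k<n. \<Sum>i<n. B $$ (k, i) * A $$ (i, k))" by (simp only: mult.commute)
  also have "\<dots> = tr (B * A)"
    unfolding tr_carrier[OF mult_carrier_mat[OF assms(2,1)]]
    by (intro sum.cong refl mat_mult_index[OF assms(2,1), symmetric]) auto
  finally show ?thesis .
qed

lemma upper_triangular_pow:
  fixes U :: "complex mat"
  assumes U: "U \<in> carrier_mat n n" "upper_triangular U"
  shows "(\<forall>i<n. \<forall>j<i. (U ^\<^sub>m k) $$ (i, j) = 0) \<and> (\<forall>i<n. (U ^\<^sub>m k) $$ (i, i) = (U $$ (i, i)) ^ k)"
proof (induction k)
  case 0
  show ?case using U(1) by auto
next
  case (Suc k)
  have c: "U ^\<^sub>m k \<in> carrier_mat n n" using U(1) by simp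
  have idx: "(U ^\<^sub>m Suc k) $$ (i, j) = (\<Sum>l<n. (U ^\<^sub>m k) $$ (i, l) * U $$ (l, j))" if "i < n" "j < n" for i j
    using mat_mult_index[OF c U(1) that] by simp
  have z: "(U ^\<^sub>m k) $$ (i, l) * U $$ (l, j) = 0" if "i < n" "l < n" "j < i \<or> (j = i \<and> l \<noteq> i)" for i j l
  proof (cases "l < i")
    case True
    thus ?thesis using Suc that by simp
  next
    case False
    hence "j < l" using that by auto
    thus ?thesis using U that upper_triangularD[OF U(2), of j l] by simp
  qed
  show ?case
  proof (intro conjI allI impI)
    fix i j assume "i < n" "j < i"
    thus "(U ^\<^sub>m Suc k) $$ (i, j) = 0" using z by (subst idx) (auto intro!: sum.neutral)
  next
    fix i assume i: "i < n"
    have "(\<Sum>l<n. (U ^\<^sub>m k) $$ (i, l) * U $$ (l, i)) = (\<Sum>l\<in>{i}. (U ^\<^sub>m k) $$ (i, l) * U $$ (l, i))"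
      using i z by (intro sum.mono_neutral_right) auto
    thus "(U ^\<^sub>m Suc k) $$ (i, i) = U $$ (i, i) ^ Suc k" using idx[OF i i] Suc i by (simp add: mult.commute)
  qed
qed

text \<open>Schur's theorem triangularizes A. The trace of A^k is invariant under similarity, powers
  of a triangular matrix carry the powers of its diagonal, and that diagonal lists the roots of the
  characteristic polynomial with multiplicity.\<close>

lemma sum_eigenvalue_powers:
  assumes A: "A \<in> carrier_mat n n"
  shows "(\<Sum>z\<in>#proots (char_poly A). z ^ k) = tr (A ^\<^sub>m k)"
proof -
  obtain as where as: "char_poly A = (\<Prod>a\<leftarrow>as. [:- a, 1:])" using char_poly_factorized[OF A] by blast
  obtain U where U: "U \<in> carrier_mat n n" "upper_triangular U" and sim: "similar_mat A U"
    using schur_decomposition_exists[OF A as] by blast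
  obtain P Q where wit: "similar_mat_wit A U P Q" using sim unfolding similar_mat_def by blast
  have c: "P \<in> carrier_mat n n" "Q \<in> carrier_mat n n" "Q * P = 1\<^sub>m n"
    using similar_mat_witD2[OF A wit] by auto
  have cU: "U ^\<^sub>m k \<in> carrier_mat n n" using U(1) by simp
  have "A ^\<^sub>m k = P * (U ^\<^sub>m k) * Q"
    using similar_mat_witD[OF _ similar_mat_wit_pow[OF wit, of k]] by blast
  also have "tr \<dots> = tr (Q * (P * (U ^\<^sub>m k)))"
    by (rule tr_mult_commute[of _ n]) (use c cU in auto)
  also have "Q * (P * (U ^\<^sub>m k)) = U ^\<^sub>m k"
    unfolding assoc_mult_mat[OF c(2,1) cU, symmetric] c(3) by (rule left_mult_one_mat[OF cU])
  finally have 1: "tr (A ^\<^sub>m k) = tr (U ^\<^sub>m k)" .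
  have "proots (char_poly A) = proots (\<Prod>a\<leftarrow>diag_mat U. [:- a, 1:])"
    using char_poly_similar[OF sim] char_poly_upper_triangular[OF U] by simp
  also have "\<dots> = mset (diag_mat U)"
  proof -
    have "proots (\<Prod>a\<leftarrow>xs. [:- a, 1:]) = mset xs" for xs :: "complex list"
    proof (induction xs)
      case (Cons x xs)
      have "(\<Prod>a\<leftarrow>xs. [:- a, 1:]) \<noteq> (0 :: complex poly)"
        by (induction xs) (simp_all del: mult_pCons_left)
      thus ?case using Cons by (simp add: proots_mult del: mult_pCons_left)
    qed simp
    thus ?thesis .
  qed
  finally have "(\<Sum>z\<in>#proots (char_poly A). z ^ k) = (\<Sum>z\<leftarrow>diag_mat U. z ^ k)"
    by (simp only: mset_map[symmetric] sum_mset_sum_list)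
  also have "\<dots> = (\<Sum>i<n. U $$ (i, i) ^ k)"
    using U(1) by (simp add: diag_mat_def sum_list_sum_nth atLeast0LessThan)
  also have "\<dots> = tr (U ^\<^sub>m k)"
    unfolding tr_def using U upper_triangular_pow[OF U, of k] by simp
  finally show ?thesis using 1 by simp
qed

section \<open>Gram matrices and singular values\<close>

lemma mat_adjoint_carrier: "A \<in> carrier_mat n n \<Longrightarrow> mat_adjoint A \<in> carrier_mat n n"
  by (auto simp: mat_adjoint_def)

lemma gram_carrier: "A \<in> carrier_mat n n \<Longrightarrow> mat_adjoint A * A \<in> carrier_mat n n"
  by (rule mult_carrier_mat[OF mat_adjoint_carrier])

text \<open>Pairing A^H A v = z v with the eigenvector v gives z |v|^2 = |A v|^2, so z is the
  quotient of a nonnegative by a positive real.\<close>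

lemma gram_eigenvalue:
  fixes A :: "complex mat"
  assumes A: "A \<in> carrier_mat n n" and z: "z \<in># proots (char_poly (mat_adjoint A * A))"
  shows "Im z = 0" "0 \<le> Re z"
proof -
  have B: "mat_adjoint A * A \<in> carrier_mat n n" by (rule gram_carrier[OF A])
  have "poly (char_poly (mat_adjoint A * A)) z = 0"
    using z by (cases "char_poly (mat_adjoint A * A) = 0") auto
  hence "eigenvalue (mat_adjoint A * A) z" using eigenvalue_root_char_poly[OF B] by simp
  then obtain v where v: "v \<in> carrier_vec n" "v \<noteq> 0\<^sub>v n" and ev: "(mat_adjoint A * A) *\<^sub>v v = z \<cdot>\<^sub>v v"
    unfolding eigenvalue_def eigenvector_def using B by auto
  let ?w = "\<lambda>j. \<Sum>k<n. A $$ (j, k) * v $ k"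
  have e: "z * v $ i = (\<Sum>j<n. cnj (A $$ (j, i)) * ?w j)" if i: "i < n" for i
  proof -
    have "z * v $ i = ((mat_adjoint A * A) *\<^sub>v v) $ i" using ev i v by simp
    also have "\<dots> = (mat_adjoint A *\<^sub>v (A *\<^sub>v v)) $ i"
      using assoc_mult_mat_vec[OF mat_adjoint_carrier[OF A] A v(1)] by simp
    also have "\<dots> = (\<Sum>j<n. mat_adjoint A $$ (i, j) * (A *\<^sub>v v) $ j)"
      using i A mat_adjoint_carrier[OF A] by (auto simp: scalar_prod_def atLeast0LessThan)
    also have "\<dots> = (\<Sum>j<n. cnj (A $$ (j, i)) * ?w j)"
      using i A v(1) by (intro sum.cong refl) (auto simp: mat_adjoint_index[OF A] scalar_prod_def atLeast0LessThan)
    finally show ?thesis .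
  qed
  have "z * (\<Sum>i<n. cnj (v $ i) * v $ i) = (\<Sum>i<n. cnj (v $ i) * (z * v $ i))"
    by (simp add: sum_distrib_left mult_ac)
  also have "\<dots> = (\<Sum>i<n. \<Sum>j<n. cnj (v $ i) * (cnj (A $$ (j, i)) * ?w j))"
    by (intro sum.cong refl) (simp add: e sum_distrib_left)
  also have "\<dots> = (\<Sum>j<n. \<Sum>i<n. cnj (v $ i) * (cnj (A $$ (j, i)) * ?w j))"
    by (rule sum.swap)
  also have "\<dots> = (\<Sum>j<n. cnj (?w j) * ?w j)"
    unfolding cnj_sum sum_distrib_right by (intro sum.cong refl) (simp add: mult_ac)
  finally have *: "z * (\<Sum>i<n. cnj (v $ i) * v $ i) = (\<Sum>j<n. cnj (?w j) * ?w j)" .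
  have nrm: "(\<Sum>i<n. cnj (f i) * f i) = complex_of_real (\<Sum>i<n. (cmod (f i))\<^sup>2)" for f
    by (simp add: complex_norm_square mult.commute del: of_real_power)
  define s t where "s = (\<Sum>i<n. (cmod (v $ i))\<^sup>2)" and "t = (\<Sum>i<n. (cmod (?w i))\<^sup>2)"
  obtain i where i: "i < n" "v $ i \<noteq> 0" using v by (metis carrier_vecD eq_vecI index_zero_vec)
  have "s > 0" unfolding s_def using i by (intro sum_pos2[of _ i]) auto
  moreover have "t \<ge> 0" unfolding t_def by (intro sum_nonneg) auto
  moreover have "z * complex_of_real s = complex_of_real t" using * unfolding nrm s_def t_def .
  ultimately have "z = complex_of_real (t / s)" "0 \<le> t / s" by (auto simp: field_simps)
  thus "Im z = 0" "0 \<le> Re z" by simp_all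
qed

lemma of_real_lin: "complex_of_real (lin f X) = (\<Sum>x\<in>#X. complex_of_real (f x))"
  by (induction X) simp_all

lemma lin_zero: "lin (\<lambda>_. 0) X = 0"
  by (induction X) simp_all

text \<open>Even powers undo the square root in \<open>singular_values\<close>, which leaves power
  sums of the eigenvalues of the Gram matrix, hence traces: polynomials in the entries and their
  conjugates.\<close>

lemma lin_singular_values:
  assumes A: "A \<in> carrier_mat n n"
  shows "complex_of_real (lin (\<lambda>x. x ^ (2 * k)) (singular_values A)) = tr ((mat_adjoint A * A) ^\<^sub>m k)"
proof -
  have "complex_of_real (lin (\<lambda>x. x ^ (2 * k)) (singular_values A)) =
     (\<Sum>z\<in>#proots (char_poly (mat_adjoint A * A)). complex_of_real (sqrt (Re z) ^ (2 * k)))"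
    unfolding of_real_lin singular_values_def by (simp add: image_mset.compositionality o_def)
  also have "\<dots> = (\<Sum>z\<in>#proots (char_poly (mat_adjoint A * A)). z ^ k)"
  proof (intro arg_cong[where f = sum_mset] image_mset_cong)
    fix z assume z: "z \<in># proots (char_poly (mat_adjoint A * A))"
    have "complex_of_real (Re z) = z" using gram_eigenvalue(1)[OF A z] by (simp add: complex_eq_iff)
    moreover have "sqrt (Re z) ^ (2 * k) = Re z ^ k" using gram_eigenvalue(2)[OF A z] by (simp add: power_mult)
    ultimately show "complex_of_real (sqrt (Re z) ^ (2 * k)) = z ^ k" by simp
  qed
  also have "\<dots> = tr ((mat_adjoint A * A) ^\<^sub>m k)"
    by (rule sum_eigenvalue_powers[OF gram_carrier[OF A]])
  finally show ?thesis .
qed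

lemma singular_values_nonneg:
  assumes "A \<in> carrier_mat n n" "x \<in># singular_values A"
  shows "0 \<le> x"
  using assms gram_eigenvalue(2)[OF assms(1)] by (auto simp: singular_values_def)

lemma size_singular_values:
  assumes "A \<in> carrier_mat n n"
  shows "size (singular_values A) = n"
  using degree_monic_char_poly[OF gram_carrier[OF assms]]
  by (simp add: singular_values_def size_proots_complex)

section \<open>Measurability of the singular values as a random multiset\<close>

lemma measurable_mat_entry:
  assumes "i < n" "j < n"
  shows "(\<lambda>A. A $$ (i, j)) \<in> borel_measurable (mat_borel n)"
proof (rule measurableI)
  fix B :: "complex set" assume "B \<in> sets borel"
  hence "{A \<in> carrier_mat n n. A $$ (i, j) \<in> B} \<in> sets (mat_borel n)"
    unfolding mat_borel_def using assms by (subst sets_measure_of) (auto intro!: sigma_sets.Basic)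
  moreover have "(\<lambda>A. A $$ (i, j)) -` B \<inter> space (mat_borel n) = {A \<in> carrier_mat n n. A $$ (i, j) \<in> B}" by auto
  ultimately show "(\<lambda>A. A $$ (i, j)) -` B \<inter> space (mat_borel n) \<in> sets (mat_borel n)" by simp
qed simp

lemma borel_measurable_cnj: "f \<in> borel_measurable M \<Longrightarrow> (\<lambda>x. cnj (f x)) \<in> borel_measurable M"
  by (rule borel_measurable_continuous_on[of cnj]) (auto intro!: continuous_intros)

lemma measurable_gram_pow:
  assumes "i < n" "j < n"
  shows "(\<lambda>A. ((mat_adjoint A * A) ^\<^sub>m k) $$ (i, j)) \<in> borel_measurable (mat_borel n)"
proof -
  have gram: "(\<lambda>A. (mat_adjoint A * A) $$ (i, j)) \<in> borel_measurable (mat_borel n)" if ij: "i < n" "j < n" for i j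
  proof (subst measurable_cong)
    fix A assume "A \<in> space (mat_borel n)"
    hence A: "A \<in> carrier_mat n n" by simp
    show "(mat_adjoint A * A) $$ (i, j) = (\<Sum>l<n. cnj (A $$ (l, i)) * A $$ (l, j))"
      unfolding mat_mult_index[OF mat_adjoint_carrier[OF A] A ij]
      using ij by (intro sum.cong refl) (simp add: mat_adjoint_index[OF A])
  next
    show "(\<lambda>A. \<Sum>l<n. cnj (A $$ (l, i)) * A $$ (l, j)) \<in> borel_measurable (mat_borel n)"
      using ij by (intro borel_measurable_sum borel_measurable_times borel_measurable_cnj measurable_mat_entry) auto
  qed
  show ?thesis using assms
  proof (induction k arbitrary: i j)
    case 0
    have "(\<lambda>A. ((mat_adjoint A * A) ^\<^sub>m 0) $$ (i, j)) \<in> borel_measurable (mat_borel n)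
      \<longleftrightarrow> (\<lambda>A. of_bool (i = j) :: complex) \<in> borel_measurable (mat_borel n)"
      by (rule measurable_cong) (use 0 in \<open>auto simp: mat_adjoint_def\<close>)
    thus ?case by simp
  next
    case (Suc k)
    show ?case
    proof (subst measurable_cong)
      fix A assume "A \<in> space (mat_borel n)"
      hence A: "A \<in> carrier_mat n n" by simp
      show "((mat_adjoint A * A) ^\<^sub>m Suc k) $$ (i, j) = (\<Sum>l<n. ((mat_adjoint A * A) ^\<^sub>m k) $$ (i, l) * (mat_adjoint A * A) $$ (l, j))"
        unfolding pow_mat.simps by (rule mat_mult_index) (use gram_carrier[OF A] Suc.prems in auto)
    next
      show "(\<lambda>A. \<Sum>l<n. ((mat_adjoint A * A) ^\<^sub>m k) $$ (i, l) * (mat_adjoint A * A) $$ (l, j)) \<in> borel_measurable (mat_borel n)"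
        by (intro borel_measurable_sum borel_measurable_times gram Suc.IH) (use Suc.prems in auto)
    qed
  qed
qed

lemma measurable_lin_power_singular_values:
  "(\<lambda>A. lin (\<lambda>x. x ^ (2 * k)) (singular_values A)) \<in> borel_measurable (mat_borel n)"
proof (subst measurable_cong)
  fix A assume "A \<in> space (mat_borel n)"
  hence A: "A \<in> carrier_mat n n" by simp
  have "lin (\<lambda>x. x ^ (2 * k)) (singular_values A) = Re (complex_of_real (lin (\<lambda>x. x ^ (2 * k)) (singular_values A)))"
    by simp
  also have "\<dots> = Re (\<Sum>i<n. ((mat_adjoint A * A) ^\<^sub>m k) $$ (i, i))"
    unfolding lin_singular_values[OF A] tr_carrier[OF pow_carrier_mat[OF gram_carrier[OF A]]] ..
  finally show "lin (\<lambda>x. x ^ (2 * k)) (singular_values A) = Re (\<Sum>i<n. ((mat_adjoint A * A) ^\<^sub>m k) $$ (i, i))" .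
next
  show "(\<lambda>A. Re (\<Sum>i<n. ((mat_adjoint A * A) ^\<^sub>m k) $$ (i, i))) \<in> borel_measurable (mat_borel n)"
    by (intro measurable_compose[OF _ borel_measurable_continuous_onI[OF continuous_on_Re[OF continuous_on_id]]] borel_measurable_sum measurable_gram_pow) auto
qed

text \<open>Ramps that equal 1 up to b and drop to 0 on [b, b + 1/k] converge pointwise to the
  indicator, and Weierstrass approximates the k-th ramp within 1 / (k + 1) on [-k, k]. The
  coefficients do not depend on y, so the approximation can be summed over the points of a
  multiset.\<close>

lemma polys_to_indicator:
  "\<exists>(c :: nat \<Rightarrow> nat \<Rightarrow> real) N. \<forall>y. (\<lambda>k. \<Sum>i\<le>N k. c k i * y ^ i) \<longlonglongrightarrow> indicator {..b :: real} y"
proof -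
  let ?h = "\<lambda>(k :: nat) y. max 0 (min 1 (1 - real k * (y - b)))"
  have "\<exists>c N. \<forall>y\<in>{- real k..real k}. \<bar>?h k y - (\<Sum>i\<le>(N::nat). c i * y ^ i)\<bar> < 1 / (real k + 1)" for k :: nat
  proof -
    have "continuous_on {- real k..real k} (?h k)" by (intro continuous_intros)
    then obtain g where g: "real_polynomial_function g" "\<And>y. y \<in> {- real k..real k} \<Longrightarrow> \<bar>?h k y - g y\<bar> < 1 / (real k + 1)"
      using Stone_Weierstrass_real_polynomial_function[of "{- real k..real k}" "?h k" "1 / (real k + 1)"] by auto
    thus ?thesis unfolding real_polynomial_function_iff_sum by blast
  qed
  then obtain c N where cN: "\<And>k y. y \<in> {- real k..real k} \<Longrightarrow> \<bar>?h k y - (\<Sum>i\<le>N k. c k i * y ^ i)\<bar> < 1 / (real k + 1)"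
    by metis
  have "(\<lambda>k. \<Sum>i\<le>N k. c k i * y ^ i) \<longlonglongrightarrow> indicator {..b} y" for y
  proof -
    have ev: "eventually (\<lambda>k. ?h k y = indicator {..b} y) sequentially"
    proof (cases "y \<le> b")
      case True
      hence "?h k y = 1" for k by (simp add: mult_nonneg_nonpos)
      thus ?thesis using True by simp
    next
      case False
      obtain K :: nat where "1 / (y - b) < real K" using reals_Archimedean2 by blast
      hence K: "1 \<le> real K * (y - b)" using False by (simp add: field_simps)
      have "?h k y = 0" if "k \<ge> K" for k
      proof -
        have "1 \<le> real k * (y - b)"
          by (rule order_trans[OF K mult_right_mono]) (use that False in auto)
        thus ?thesis by simp
      qed
      thus ?thesis using False by (auto simp: eventually_sequentially)
    qed
    obtain Y :: nat where Y: "\<bar>y\<bar> < real Y" using reals_Archimedean2 by blast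
    have "(\<lambda>k. (\<Sum>i\<le>N k. c k i * y ^ i) - ?h k y) \<longlonglongrightarrow> 0"
    proof (rule Lim_null_comparison)
      show "eventually (\<lambda>k. norm ((\<Sum>i\<le>N k. c k i * y ^ i) - ?h k y) \<le> 1 / (real k + 1)) sequentially"
        unfolding eventually_sequentially
      proof (intro exI[of _ Y] allI impI)
        fix k assume "Y \<le> k"
        hence "y \<in> {- real k..real k}" using Y by auto
        from cN[OF this] show "norm ((\<Sum>i\<le>N k. c k i * y ^ i) - ?h k y) \<le> 1 / (real k + 1)"
          by (simp add: abs_minus_commute)
      qed
      show "(\<lambda>k. 1 / (real k + 1)) \<longlonglongrightarrow> 0" by real_asymp
    qed
    moreover have "(\<lambda>k. ?h k y) \<longlonglongrightarrow> indicator {..b} y"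
      using ev by (rule tendsto_eventually)
    ultimately show ?thesis using tendsto_add by fastforce
  qed
  thus ?thesis by blast
qed

text \<open>Eigenvalues are not explicit functions of the entries, but traces of powers of the Gram
  matrix are. The number of singular values at most a is a pointwise limit of polynomial statistics
  of their squares.\<close>

lemma measurable_singular_values: "singular_values \<in> measurable (mat_borel n) mset_borel"
proof (rule measurable_mset_borel_atMostI)
  have "(\<lambda>A. real (size (singular_values A))) \<in> borel_measurable (mat_borel n) \<longleftrightarrow> (\<lambda>A. real n) \<in> borel_measurable (mat_borel n)"
    by (rule measurable_cong) (simp add: size_singular_values)
  thus "(\<lambda>A. real (size (singular_values A))) \<in> borel_measurable (mat_borel n)" by simp
next
  fix a :: real
  show "(\<lambda>A. lin (indicator {..a}) (singular_values A)) \<in> borel_measurable (mat_borel n)"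
  \<comment> \<open>Comparing squares with a^2 decides x \<le> a only for a \<ge> 0; for negative a
    the count is zero.\<close>
  proof (cases "a < 0")
    case True
    have "lin (indicator {..a}) (singular_values A) = 0" if "A \<in> carrier_mat n n" for A
    proof -
      have "lin (indicator {..a}) (singular_values A) = lin (\<lambda>x. 0) (singular_values A)"
        using singular_values_nonneg[OF that] True by (intro lin_cong) (force simp: indicator_def)
      thus ?thesis by (simp only: lin_zero)
    qed
    hence "(\<lambda>A. lin (indicator {..a}) (singular_values A)) \<in> borel_measurable (mat_borel n) \<longleftrightarrow>
      (\<lambda>A. 0 :: real) \<in> borel_measurable (mat_borel n)" by (intro measurable_cong) simp
    thus ?thesis by simp
  next
    case False
    obtain c :: "nat \<Rightarrow> nat \<Rightarrow> real" and N where cN: "\<And>y. (\<lambda>k. \<Sum>i\<le>N k. c k i * y ^ i) \<longlonglongrightarrow> indicator {..a\<^sup>2} y"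
      using polys_to_indicator[of "a\<^sup>2"] by blast
    show ?thesis
    proof (rule borel_measurable_LIMSEQ_real)
      fix A assume "A \<in> space (mat_borel n)"
      hence A: "A \<in> carrier_mat n n" by simp
      have "(\<lambda>k. lin (\<lambda>x. \<Sum>i\<le>N k. c k i * (x\<^sup>2) ^ i) (singular_values A)) \<longlonglongrightarrow> lin (\<lambda>x. indicator {..a\<^sup>2} (x\<^sup>2)) (singular_values A)"
        by (intro lin_tendsto cN)
      also have "lin (\<lambda>x. indicator {..a\<^sup>2} (x\<^sup>2)) (singular_values A) = lin (indicator {..a}) (singular_values A)"
      proof (rule lin_cong)
        fix x assume "x \<in># singular_values A"
        hence "0 \<le> x" by (rule singular_values_nonneg[OF A])
        thus "indicator {..a\<^sup>2} (x\<^sup>2) = (indicator {..a} x :: real)"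
          using False by (auto simp: indicator_def power2_le_iff_abs_le)
      qed
      finally show "(\<lambda>k. \<Sum>i\<le>N k. c k i * lin (\<lambda>x. x ^ (2 * i)) (singular_values A)) \<longlonglongrightarrow> lin (indicator {..a}) (singular_values A)"
        unfolding lin_sum lin_cmult power_mult .
    next
      fix k
      show "(\<lambda>A. \<Sum>i\<le>N k. c k i * lin (\<lambda>x. x ^ (2 * i)) (singular_values A)) \<in> borel_measurable (mat_borel n)"
        by (intro borel_measurable_sum borel_measurable_times borel_measurable_const measurable_lin_power_singular_values)
    qed
  qed
qed

section \<open>Traces of even powers as power sums of singular values\<close>

context gauss_matrix
begin

text \<open>The matrix is hermitian, so \<open>mat_adjoint A * A\<close> is its square.\<close>

lemma gram_pow_mp:
  assumes A: "A \<in> carrier_mat n n" and entry: "\<And>i j. i < n \<Longrightarrow> j < n \<Longrightarrow> A $$ (i, j) = m g i j"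
    and herm: "\<And>\<alpha> a b. E \<alpha> b a = cnj (E \<alpha> a b)"
  shows "i < n \<Longrightarrow> j < n \<Longrightarrow> ((mat_adjoint A * A) ^\<^sub>m k) $$ (i, j) = mp (2 * k) g i j"
proof (induction k arbitrary: i j)
  case 0
  thus ?case using gram_carrier[OF A] A by (auto simp: mat_adjoint_def)
next
  case (Suc k)
  have mh: "cnj (m g a b) = m g b a" for a b
    unfolding m_def by (simp add: herm[of _ b a])
  have gram: "(mat_adjoint A * A) $$ (a, b) = mp 2 g a b" if ab: "a < n" "b < n" for a b
  proof -
    have "(mat_adjoint A * A) $$ (a, b) = (\<Sum>l<n. mat_adjoint A $$ (a, l) * A $$ (l, b))"
      by (rule mat_mult_index[OF mat_adjoint_carrier[OF A] A ab])
    also have "\<dots> = (\<Sum>l<n. m g a l * m g l b)"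
      using ab by (intro sum.cong refl) (simp add: mat_adjoint_index[OF A] entry mh)
    finally show ?thesis using ab by (simp add: numeral_2_eq_2 mp_one del: mp.simps(2)) (simp add: mp_one[OF ab(2)])
  qed
  have "((mat_adjoint A * A) ^\<^sub>m Suc k) $$ (i, j) = (\<Sum>l<n. ((mat_adjoint A * A) ^\<^sub>m k) $$ (i, l) * (mat_adjoint A * A) $$ (l, j))"
    unfolding pow_mat.simps by (rule mat_mult_index) (use gram_carrier[OF A] Suc.prems in auto)
  also have "\<dots> = (\<Sum>l<n. mp (2 * k) g i l * mp 2 g l j)"
    using Suc by (intro sum.cong refl) (simp add: gram)
  also have "\<dots> = mp (2 * k + 2) g i j" using Suc.prems by (simp only: mp_add)
  finally show ?case by (simp only: mult_Suc_right add.commute)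
qed

lemma lin_singular_values_T:
  assumes A: "A \<in> carrier_mat n n" and entry: "\<And>i j. i < n \<Longrightarrow> j < n \<Longrightarrow> A $$ (i, j) = m g i j"
    and herm: "\<And>\<alpha> a b. E \<alpha> b a = cnj (E \<alpha> a b)"
  shows "complex_of_real (lin (\<lambda>x. x ^ (2 * k)) (singular_values A)) = T (2 * k) g"
  unfolding lin_singular_values[OF A] tr_carrier[OF pow_carrier_mat[OF gram_carrier[OF A]]] T_def
  using gram_pow_mp[OF A entry herm] by (intro sum.cong refl) auto

end

section \<open>Point configurations with Gaussian weights\<close>

text \<open>
  The anti-GUE needs \<open>a = 2\<close>, since its non-zero singular values come in equal pairs, and \<open>b = 1\<close> in
  odd order.
\<close>

definition conf :: "nat \<Rightarrow> nat \<Rightarrow> nat \<Rightarrow> (nat \<Rightarrow> real) \<Rightarrow> real multiset" where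
  "conf a b n x = repeat_mset a (image_mset (\<lambda>i. \<bar>x i\<bar>) (mset_set {..<n})) + replicate_mset b 0"

lemma lin_repeat_mset: "lin f (repeat_mset a X) = real a * lin f X"
  by (induction a) (simp_all add: algebra_simps)

lemma lin_image_mset: "lin f (image_mset g X) = (\<Sum>x\<in>#X. f (g x))"
  by (simp add: lin_def image_mset.compositionality o_def)

lemma lin_conf: "lin f (conf a b n x) = real a * (\<Sum>i<n. f \<bar>x i\<bar>) + real b * f 0"
proof -
  have "lin f (replicate_mset b 0) = real b * f 0" by (induction b) (simp_all add: algebra_simps)
  thus ?thesis
    by (simp add: conf_def lin_repeat_mset lin_image_mset sum_unfold_sum_mset)
qed

lemma size_conf: "size (conf a b n x) = a * n + b"
  by (simp add: conf_def)

lemma in_repeat_mset: "y \<in># repeat_mset a X \<longleftrightarrow> a \<noteq> 0 \<and> y \<in># X"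
  by (simp flip: count_greater_zero_iff)

lemma conf_nonneg: "y \<in># conf a b n x \<Longrightarrow> 0 \<le> y"
  by (cases "b = 0") (auto simp: conf_def in_repeat_mset)

lemma measurable_conf: "conf a b n \<in> measurable (gauss {..<n}) mset_borel"
proof (rule measurable_mset_borel_indicatorI)
  fix B :: "real set" assume [measurable]: "B \<in> sets borel"
  have *: "(\<lambda>y. indicator B \<bar>y\<bar> :: real) \<in> borel_measurable borel" by measurable
  show "(\<lambda>x. lin (indicator B) (conf a b n x)) \<in> borel_measurable (gauss {..<n})"
    unfolding lin_conf
    by (intro borel_measurable_add borel_measurable_times borel_measurable_const borel_measurable_sum
        measurable_compose[OF measurable_gauss_coord *]) auto
qed

lemma tame_exp_abs:
  assumes "finite I" "i \<in> I" "0 \<le> c"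
  shows "tame I (\<lambda>g. complex_of_real (exp (c * \<bar>g i\<bar>)))"
  unfolding tame_def
proof (intro conjI allI)
  have "(\<lambda>y. complex_of_real (exp (c * \<bar>y\<bar>))) \<in> borel_measurable borel" by measurable
  thus "(\<lambda>g. complex_of_real (exp (c * \<bar>g i\<bar>))) \<in> borel_measurable (gauss I)"
    by (rule measurable_compose[OF measurable_gauss_coord[OF assms(2)]])
  have "cmod (complex_of_real (exp (c * \<bar>g i\<bar>))) \<le> 1 * exp (c * (\<Sum>i\<in>I. \<bar>g i\<bar>))" for g :: "'a \<Rightarrow> real"
    using member_le_sum[OF assms(2) _ assms(1), of "\<lambda>i. \<bar>g i\<bar>"] assms(3) by (simp add: mult_left_mono)
  thus "\<exists>C d. 0 \<le> d \<and> (\<forall>g. cmod (complex_of_real (exp (c * \<bar>g i\<bar>))) \<le> C * exp (d * (\<Sum>i\<in>I. \<bar>g i\<bar>)))"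
    using assms(3) by blast
  show "isCont (\<lambda>s. complex_of_real (exp (c * \<bar>(g(j := s)) i\<bar>))) t" for g j t
    by (cases "i = j") (auto intro!: continuous_intros)
qed

lemma tame_real_integrable:
  assumes "finite I" "tame I (\<lambda>g. complex_of_real (f g))"
  shows "integrable (gauss I) f"
  using tame_integrable[OF assms] by (simp only: complex_of_real_integrable_eq)

text \<open>Bounds all partial sums of a moment series at once by an integrable function: the even
  terms are part of the nonnegative exponential series of |t x|.\<close>

lemma even_exp_partial_sum_le: "(\<Sum>k<K. (t * x) ^ (2 * k) / fact (2 * k)) \<le> exp (\<bar>t\<bar> * \<bar>x\<bar> :: real)"
proof -
  have "(\<Sum>k<K. (t * x) ^ (2 * k) / fact (2 * k)) = (\<Sum>k<K. \<bar>t * x\<bar> ^ (2 * k) / fact (2 * k))"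
    by (simp add: power_even_abs)
  also have "\<dots> = (\<Sum>k\<in>(\<lambda>k. 2 * k) ` {..<K}. \<bar>t * x\<bar> ^ k / fact k)"
    by (subst sum.reindex) (auto simp: inj_on_def)
  also have "\<dots> \<le> (\<Sum>k<2 * K. \<bar>t * x\<bar> ^ k / fact k)"
    by (intro sum_mono2) auto
  also have "\<dots> \<le> exp \<bar>t * x\<bar>"
  proof -
    have "(\<Sum>k<2 * K. \<bar>t * x\<bar> ^ k / fact k) = (\<Sum>k<2 * K. \<bar>t * x\<bar> ^ k /\<^sub>R fact k)"
      by (intro sum.cong refl) (simp add: divide_inverse)
    also have "\<dots> \<le> (\<Sum>k. \<bar>t * x\<bar> ^ k /\<^sub>R fact k)"
      by (rule sum_le_suminf[OF summable_exp_generic]) auto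
    finally show ?thesis unfolding exp_def .
  qed
  finally show ?thesis by (simp add: abs_mult)
qed

text \<open>The law of points whose Lebesgue density is proportional to w times the exponential of
  minus half the sum of squares; that exponential sits in the reference measure.\<close>

definition weighted :: "nat \<Rightarrow> ((nat \<Rightarrow> real) \<Rightarrow> real) \<Rightarrow> (nat \<Rightarrow> real) measure" where
  "weighted n w = density (gauss {..<n}) (\<lambda>x. ennreal (w x / (\<integral>x. w x \<partial>gauss {..<n})))"

context
  fixes n :: nat and w :: "(nat \<Rightarrow> real) \<Rightarrow> real"
  assumes w0: "\<And>x. 0 \<le> w x" and wt: "tame {..<n} (\<lambda>x. complex_of_real (w x))"
    and Z: "0 < (\<integral>x. w x \<partial>gauss {..<n})"
begin

lemma measurable_weight: "w \<in> borel_measurable (gauss {..<n})"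
  using tame_real_integrable[OF _ wt] by auto

lemma prob_space_weighted: "prob_space (weighted n w)"
proof (rule prob_spaceI)
  have "(\<integral>\<^sup>+x. ennreal (w x / (\<integral>x. w x \<partial>gauss {..<n})) \<partial>gauss {..<n}) = ennreal (\<integral>x. w x / (\<integral>x. w x \<partial>gauss {..<n}) \<partial>gauss {..<n})"
    using w0 Z by (intro nn_integral_eq_integral integrable_divide tame_real_integrable wt) auto
  also have "\<dots> = 1" using Z by simp
  finally show "emeasure (weighted n w) (space (weighted n w)) = 1"
    unfolding weighted_def using measurable_weight
    by (subst emeasure_density) (auto cong: nn_integral_cong)
qed

lemma integral_weighted:
  fixes h :: "(nat \<Rightarrow> real) \<Rightarrow> real"
  assumes "h \<in> borel_measurable (gauss {..<n})"
  shows "(\<integral>x. h x \<partial>weighted n w) = (\<integral>x. w x * h x \<partial>gauss {..<n}) / (\<integral>x. w x \<partial>gauss {..<n})"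
proof -
  have "(\<integral>x. h x \<partial>weighted n w) = (\<integral>x. (w x / (\<integral>x. w x \<partial>gauss {..<n})) *\<^sub>R h x \<partial>gauss {..<n})"
    unfolding weighted_def using measurable_weight assms w0 Z by (intro integral_density) auto
  thus ?thesis by simp
qed

lemma integrable_weighted:
  fixes h :: "(nat \<Rightarrow> real) \<Rightarrow> real"
  assumes "tame {..<n} (\<lambda>x. complex_of_real (h x))"
  shows "integrable (weighted n w) h"
proof -
  have "h \<in> borel_measurable (gauss {..<n})" using tame_real_integrable[OF _ assms] by auto
  moreover have "integrable (gauss {..<n}) (\<lambda>x. w x * h x)"
    using tame_mult[OF wt assms] by (intro tame_real_integrable) simp_all
  hence "integrable (gauss {..<n}) (\<lambda>x. (w x / (\<integral>x. w x \<partial>gauss {..<n})) *\<^sub>R h x)"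
    by simp
  ultimately show ?thesis
    unfolding weighted_def using measurable_weight w0 Z by (subst integrable_density) auto
qed

lemma tame_prod_lin: "tame {..<n} (\<lambda>x. complex_of_real (prod_lin ks (conf a b n x)))"
proof (induction ks)
  case (Cons k ks)
  have "tame {..<n} (\<lambda>x. of_nat a * (\<Sum>i<n. complex_of_real (x i) ^ (2 * k)) + of_nat b * of_bool (k = 0))"
    by (intro tame_add tame_mult tame_sum tame_const tame_power tame_coord) auto
  also have "(\<lambda>x. of_nat a * (\<Sum>i<n. complex_of_real (x i) ^ (2 * k)) + of_nat b * of_bool (k = 0))
    = (\<lambda>x. complex_of_real (lin (\<lambda>x. x ^ (2 * k)) (conf a b n x)))"
    by (simp add: lin_conf power_even_abs fun_eq_iff zero_power)
  finally show ?case using tame_mult[OF _ Cons] by simp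
qed (simp add: tame_const)

text \<open>The moment criterion with an explicit model law on the right. Growth is checked on the
  model side, where partial sums of the moment series are bounded by an integral of w times
  exponentials of the |x_i|, finite for tame w.\<close>

theorem law_of_moments:
  assumes M: "prob_space M" and Y: "Y \<in> measurable M mset_borel"
    and sz: "\<And>\<omega>. \<omega> \<in> space M \<Longrightarrow> size (Y \<omega>) = a * n + b"
    and nonneg: "\<And>\<omega> y. \<omega> \<in> space M \<Longrightarrow> y \<in># Y \<omega> \<Longrightarrow> 0 \<le> y"
    and int: "\<And>ks. integrable M (\<lambda>\<omega>. prod_lin ks (Y \<omega>))"
    and mom: "\<And>ks. (\<integral>x. w x * prod_lin ks (conf a b n x) \<partial>gauss {..<n}) =
        (\<integral>x. w x \<partial>gauss {..<n}) * (\<integral>\<omega>. prod_lin ks (Y \<omega>) \<partial>M)"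
  shows "distr M mset_borel Y = distr (weighted n w) mset_borel (conf a b n)"
proof (rule mset_measure_eq_moments)
  interpret M: prob_space M by fact
  interpret W: prob_space "weighted n w" by (rule prob_space_weighted)
  let ?Z = "\<integral>x. w x \<partial>gauss {..<n}"
  have cm: "conf a b n \<in> measurable (weighted n w) mset_borel"
    unfolding weighted_def using measurable_conf by simp
  show "prob_space (distr M mset_borel Y)" by (rule M.prob_space_distr[OF Y])
  show "prob_space (distr (weighted n w) mset_borel (conf a b n))" by (rule W.prob_space_distr[OF cm])
  have sz_meas: "{X. size X = k} \<in> sets mset_borel" for k
    using measurable_compose[OF measurable_size_mset, of "\<lambda>j. j = k" "count_space UNIV"] by (simp add: pred_def)
  have nn_meas: "{X :: real multiset. \<forall>x\<in>#X. 0 \<le> x} \<in> sets mset_borel"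
  proof -
    have "{X :: real multiset. \<forall>x\<in>#X. 0 \<le> x} = {X. size (filter_mset (\<lambda>x. x \<in> {..<0}) X) = 0}"
    proof -
      have "size (filter_mset (\<lambda>x. x \<in> {..<0}) X) = 0 \<longleftrightarrow> (\<forall>x\<in>#X. 0 \<le> x)" for X :: "real multiset"
        by (induction X) auto
      thus ?thesis by blast
    qed
    also have "\<dots> \<in> sets mset_borel" unfolding sets_mset_borel
      by (intro sigma_sets.Basic CollectI exI[of _ "{..<0}"] exI[of _ 0]) simp
    finally show ?thesis .
  qed
  show "AE X in distr M mset_borel Y. size X = a * n + b"
    using sz sz_meas by (subst AE_distr_iff[OF Y]) auto
  show "AE X in distr (weighted n w) mset_borel (conf a b n). size X = a * n + b"
    using sz_meas by (subst AE_distr_iff[OF cm]) (auto simp: size_conf)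
  show "AE X in distr M mset_borel Y. \<forall>x\<in>#X. 0 \<le> x"
    using nonneg nn_meas by (subst AE_distr_iff[OF Y]) auto
  show "AE X in distr (weighted n w) mset_borel (conf a b n). \<forall>x\<in>#X. 0 \<le> x"
    using nn_meas conf_nonneg by (subst AE_distr_iff[OF cm]) auto
  have iP: "(\<integral>X. prod_lin ks X \<partial>distr M mset_borel Y) = (\<integral>\<omega>. prod_lin ks (Y \<omega>) \<partial>M)" for ks
    by (rule integral_distr[OF Y measurable_prod_lin])
  have mc: "(\<lambda>x. prod_lin ks (conf a b n x)) \<in> borel_measurable (gauss {..<n})" for ks
    by (rule measurable_compose[OF measurable_conf measurable_prod_lin])
  have iQ: "(\<integral>X. prod_lin ks X \<partial>distr (weighted n w) mset_borel (conf a b n)) =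
      (\<integral>x. w x * prod_lin ks (conf a b n x) \<partial>gauss {..<n}) / ?Z" for ks
    unfolding integral_weighted[OF mc, symmetric] by (rule integral_distr[OF cm measurable_prod_lin])
  show "integrable (distr M mset_borel Y) (prod_lin ks)" for ks
    using int integrable_distr_eq[OF Y measurable_prod_lin] by blast
  show "integrable (distr (weighted n w) mset_borel (conf a b n)) (prod_lin ks)" for ks
    using integrable_weighted[OF tame_prod_lin] integrable_distr_eq[OF cm measurable_prod_lin] by blast
  show "(\<integral>X. prod_lin ks X \<partial>distr M mset_borel Y) = (\<integral>X. prod_lin ks X \<partial>distr (weighted n w) mset_borel (conf a b n))" for ks
    unfolding iP iQ mom using Z by simp
  fix t :: real and ks :: "nat list"
  let ?m = "\<lambda>k. \<integral>X. prod_lin (k # ks) X \<partial>distr M mset_borel Y"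
  let ?F = "\<lambda>x. w x * prod_lin ks (conf a b n x)"
  \<comment> \<open>Majorant of the even exponential series summed over the configuration: a copies
    of each |x_i|, and b zeros contributing at most 1 each.\<close>
  let ?S = "\<lambda>x. real a * (\<Sum>i<n. exp (\<bar>t\<bar> * \<bar>x i\<bar>)) + real b"
  have tF: "tame {..<n} (\<lambda>x. complex_of_real (?F x))"
    using tame_mult[OF wt tame_prod_lin] by simp
  have tS: "tame {..<n} (\<lambda>x. complex_of_real (?S x))"
    using tame_add[OF tame_mult[OF tame_const[of _ "of_nat a"] tame_sum[OF tame_exp_abs[of "{..<n}" _ "\<bar>t\<bar>"]]] tame_const[of _ "of_nat b"], of "{..<n}" "\<lambda>i. i"]
    by simp
  have iFS: "integrable (gauss {..<n}) (\<lambda>x. ?F x * ?S x)"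
    using tame_mult[OF tF tS] by (intro tame_real_integrable) simp_all
  have m: "?m k = (\<integral>x. ?F x * lin (\<lambda>y. y ^ (2 * k)) (conf a b n x) \<partial>gauss {..<n}) / ?Z" for k
    using mom[of "k # ks"] Z unfolding iP by (simp add: field_simps)
  have iFL: "integrable (gauss {..<n}) (\<lambda>x. ?F x * lin (\<lambda>y. y ^ (2 * k)) (conf a b n x))" for k
    using tame_mult[OF wt tame_prod_lin[where ks = "k # ks" and a = a and b = b]] by (intro tame_real_integrable) (simp_all add: mult_ac)
  have F0: "0 \<le> ?F x" for x by (intro mult_nonneg_nonneg w0 prod_lin_nonneg)
  show "summable (\<lambda>k. t ^ (2 * k) / fact (2 * k) * ?m k)"
  proof (rule summableI_nonneg_bounded)
    fix k
    show "0 \<le> t ^ (2 * k) / fact (2 * k) * ?m k"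
      unfolding m using Z
      by (intro mult_nonneg_nonneg divide_nonneg_pos Bochner_Integration.integral_nonneg F0 lin_nonneg) (auto simp: power_mult)
  next
    fix K
    have sum_eq: "(\<Sum>k<K. t ^ (2 * k) / fact (2 * k) * ?m k) =
      (\<Sum>k<K. \<integral>x. t ^ (2 * k) / fact (2 * k) * (?F x * lin (\<lambda>y. y ^ (2 * k)) (conf a b n x)) \<partial>gauss {..<n}) / ?Z"
      unfolding m by (simp add: sum_divide_distrib)
    have "(\<Sum>k<K. \<integral>x. t ^ (2 * k) / fact (2 * k) * (?F x * lin (\<lambda>y. y ^ (2 * k)) (conf a b n x)) \<partial>gauss {..<n}) =
      (\<integral>x. (\<Sum>k<K. t ^ (2 * k) / fact (2 * k) * (?F x * lin (\<lambda>y. y ^ (2 * k)) (conf a b n x))) \<partial>gauss {..<n})"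
      by (intro Bochner_Integration.integral_sum[symmetric] integrable_mult_right iFL)
    also have "\<dots> \<le> (\<integral>x. ?F x * ?S x \<partial>gauss {..<n})"
    proof (intro integral_mono iFS Bochner_Integration.integrable_sum integrable_mult_right iFL)
      fix x
      have "(\<Sum>k<K. t ^ (2 * k) / fact (2 * k) * (?F x * lin (\<lambda>y. y ^ (2 * k)) (conf a b n x))) =
        ?F x * lin (\<lambda>y. \<Sum>k<K. (t * y) ^ (2 * k) / fact (2 * k)) (conf a b n x)"
        unfolding lin_sum power_mult_distrib times_divide_eq_left[symmetric] lin_cmult
        by (simp add: sum_distrib_left mult_ac)
      also have "\<dots> \<le> ?F x * ?S x"
      proof (rule mult_left_mono[OF _ F0])
        have "(\<Sum>k<K. (t * 0) ^ (2 * k) / fact (2 * k)) \<le> (1 :: real)" using even_exp_partial_sum_le[of t 0 K] by simp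
        moreover have "(\<Sum>k<K. (t * \<bar>x i\<bar>) ^ (2 * k) / fact (2 * k)) \<le> exp (\<bar>t\<bar> * \<bar>x i\<bar>)" for i
          using even_exp_partial_sum_le[of t "\<bar>x i\<bar>" K] by simp
        ultimately show "lin (\<lambda>y. \<Sum>k<K. (t * y) ^ (2 * k) / fact (2 * k)) (conf a b n x) \<le> ?S x"
          unfolding lin_conf by (intro add_mono mult_left_mono sum_mono) (auto simp: mult_left_le)
      qed
      finally show "(\<Sum>k<K. t ^ (2 * k) / fact (2 * k) * (?F x * lin (\<lambda>y. y ^ (2 * k)) (conf a b n x))) \<le> ?F x * ?S x" .
    qed
    finally show "(\<Sum>k<K. t ^ (2 * k) / fact (2 * k) * ?m k) \<le> (\<integral>x. ?F x * ?S x \<partial>gauss {..<n}) / ?Z"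
      unfolding sum_eq by (rule divide_right_mono) (use Z in linarith)
  qed
qed simp_all

end

subsection \<open>Almost sure distinctness\<close>

lemma AE_std_normal_neq: "AE y in std_normal. y \<noteq> c"
proof -
  have "AE y in lborel. y \<noteq> c" by (rule AE_lborel_singleton)
  thus ?thesis by (subst AE_density) (auto elim: AE_mp)
qed

text \<open>Fubini in the coordinate i: with the others fixed, x_i has to avoid a single value. The
  scales 1 and -1 together separate absolute values.\<close>

lemma AE_gauss_neq_scaled:
  fixes I :: "nat set"
  assumes I: "finite I" "i \<in> I" "j \<in> I" "i \<noteq> j"
  shows "AE x in gauss I. x i \<noteq> s * x j"
proof -
  define J where "J = I - {i}"
  have J: "finite J" "i \<notin> J" "I = insert i J" "j \<in> J" using I by (auto simp: J_def)
  let ?f = "\<lambda>x. indicator {x \<in> space (gauss I). x i = s * x j} x :: ennreal"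
  have S: "{x \<in> space (gauss I). x i = s * x j} \<in> sets (gauss I)"
    using measurable_gauss_coord[OF I(2)] measurable_gauss_coord[OF I(3)] by measurable
  have "(\<integral>\<^sup>+x. ?f x \<partial>gauss I) = (\<integral>\<^sup>+x. (\<integral>\<^sup>+y. ?f (x(i := y)) \<partial>std_normal) \<partial>gauss J)"
    unfolding J(3) by (rule std_normal.product_nn_integral_insert[OF J(1,2)]) (use S J(3) in simp)
  also have "\<dots> = (\<integral>\<^sup>+x. 0 \<partial>gauss J)"
  proof (rule nn_integral_cong)
    fix x
    have "(\<integral>\<^sup>+y. ?f (x(i := y)) \<partial>std_normal) = (\<integral>\<^sup>+y. 0 \<partial>std_normal)"
      by (rule nn_integral_cong_AE) (use AE_std_normal_neq[of "s * x j"] I(4) in \<open>auto simp: indicator_def elim!: AE_mp\<close>)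
    thus "(\<integral>\<^sup>+y. ?f (x(i := y)) \<partial>std_normal) = 0" by simp
  qed
  finally have "emeasure (gauss I) {x \<in> space (gauss I). x i = s * x j} = 0"
    using S by simp
  hence "{x \<in> space (gauss I). x i = s * x j} \<in> null_sets (gauss I)" using S by auto
  thus ?thesis by (rule AE_I') auto
qed

lemma AE_gauss_generic:
  fixes n :: nat
  shows "AE x in gauss {..<n}. (\<forall>i<n. x i \<noteq> 0) \<and> (\<forall>i<n. \<forall>j<n. i \<noteq> j \<longrightarrow> \<bar>x i\<bar> \<noteq> \<bar>x j\<bar>)"
proof -
  have 1: "AE x in gauss {..<n}. \<forall>i\<in>{..<n}. x i \<noteq> 0"
    by (rule AE_finite_allI) (auto intro!: AE_PiM_component prob_space_std_normal AE_std_normal_neq)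
  have 2: "AE x in gauss {..<n}. \<forall>p\<in>{(i, j). i < n \<and> j < n \<and> i \<noteq> j}. x (fst p) \<noteq> s * x (snd p)" for s
  proof (rule AE_finite_allI)
    show "finite {(i, j). i < n \<and> j < n \<and> i \<noteq> j}"
      by (rule finite_subset[of _ "{..<n} \<times> {..<n}"]) auto
  qed (auto intro!: AE_gauss_neq_scaled)
  from 1 2[of 1] 2[of "-1"] show ?thesis
    by eventually_elim (auto simp: abs_eq_iff)
qed

lemma integral_pos_of_AE:
  assumes "finite I" "tame I (\<lambda>x. complex_of_real (w x))" "\<And>x. 0 \<le> w x" "AE x in gauss I. w x \<noteq> 0"
  shows "0 < (\<integral>x. w x \<partial>gauss I)"
proof (rule ccontr)
  interpret prob_space "gauss I" by (rule prob_space_gauss)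
  have int: "integrable (gauss I) w" by (rule tame_real_integrable[OF assms(1,2)])
  assume "\<not> 0 < (\<integral>x. w x \<partial>gauss I)"
  hence "(\<integral>x. w x \<partial>gauss I) = 0"
    using Bochner_Integration.integral_nonneg[of "gauss I" w, OF assms(3)] by linarith
  hence "AE x in gauss I. w x = 0"
    using integral_nonneg_eq_0_iff_AE[OF int] assms(3) by auto
  with assms(4) have "AE x in gauss I. False" by eventually_elim simp
  thus False by simp
qed

lemma distinct_part_conf:
  assumes "\<forall>i<m. x i \<noteq> 0" "\<forall>i<m. \<forall>j<m. i \<noteq> j \<longrightarrow> \<bar>x i\<bar> \<noteq> \<bar>x j\<bar>"
  shows "distinct_part (conf 2 r m x) = conf 1 0 m x"
proof -
  have "set_mset (conf 2 r m x) - {0} = (\<lambda>i. \<bar>x i\<bar>) ` {..<m}"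
    using assms(1) by (cases "r = 0") (auto simp: conf_def in_repeat_mset)
  moreover have "inj_on (\<lambda>i. \<bar>x i\<bar>) {..<m}"
    using assms(2) by (auto simp: inj_on_def)
  ultimately show ?thesis
    by (simp add: distinct_part_def conf_def image_mset_mset_set)
qed

subsection \<open>Symmetries of the Gaussian measure\<close>

lemma distr_std_normal_uminus: "distr std_normal borel uminus = std_normal"
proof -
  have "density (distr lborel borel uminus) (\<lambda>x. ennreal (std_normal_density x)) =
    distr (density lborel (\<lambda>x. ennreal (std_normal_density (- x)))) borel uminus"
    by (rule density_distr) simp_all
  thus ?thesis by (simp add: lborel_distr_uminus std_normal_density_def)
qed

text \<open>Restriction keeps the flipped tuple in the space of the product measure, which consists
  of extensional functions.\<close>

definition flip :: "nat \<Rightarrow> (nat \<Rightarrow> real) \<Rightarrow> (nat \<Rightarrow> real) \<Rightarrow> (nat \<Rightarrow> real)" where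
  "flip n \<epsilon> x = (\<lambda>i\<in>{..<n}. \<epsilon> i * x i)"

lemma measurable_flip: "flip n \<epsilon> \<in> measurable (gauss {..<n}) (gauss {..<n})"
  unfolding flip_def
proof (rule measurable_restrict)
  fix i assume "i \<in> {..<n}"
  hence "(\<lambda>x. \<epsilon> i * x i) \<in> borel_measurable (gauss {..<n})"
    by (intro borel_measurable_times borel_measurable_const measurable_gauss_coord)
  thus "(\<lambda>x. \<epsilon> i * x i) \<in> measurable (gauss {..<n}) std_normal" by simp
qed

lemma distr_flip:
  assumes \<epsilon>: "\<epsilon> \<in> {..<n} \<rightarrow>\<^sub>E {1, -1}"
  shows "distr (gauss {..<n}) (gauss {..<n}) (flip n \<epsilon>) = gauss {..<n}"
proof (rule std_normal.PiM_eqI)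
  fix A :: "nat \<Rightarrow> real set" assume A: "\<And>i. i \<in> {..<n} \<Longrightarrow> A i \<in> sets std_normal"
  let ?B = "\<lambda>i. (\<lambda>y. \<epsilon> i * y) -` A i"
  have B: "?B i \<in> sets std_normal" if "i \<in> {..<n}" for i
    using A[OF that] measurable_sets[of "\<lambda>y. \<epsilon> i * y" borel borel "A i"] by simp
  have s: "space std_normal = UNIV" by simp
  have "flip n \<epsilon> -` (Pi\<^sub>E {..<n} A) \<inter> space (gauss {..<n}) = Pi\<^sub>E {..<n} ?B"
    by (auto simp: flip_def space_PiM PiE_iff extensional_def)
  hence "emeasure (distr (gauss {..<n}) (gauss {..<n}) (flip n \<epsilon>)) (Pi\<^sub>E {..<n} A) = emeasure (gauss {..<n}) (Pi\<^sub>E {..<n} ?B)"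
    using A by (subst emeasure_distr[OF measurable_flip]) (auto intro!: sets_PiM_I_finite)
  also have "\<dots> = (\<Prod>i<n. emeasure std_normal (?B i))"
    using B by (intro std_normal.emeasure_PiM) auto
  also have "\<dots> = (\<Prod>i<n. emeasure std_normal (A i))"
  proof (rule prod.cong[OF refl])
    fix i assume i: "i \<in> {..<n}"
    hence "\<epsilon> i = 1 \<or> \<epsilon> i = -1" using \<epsilon> by auto
    thus "emeasure std_normal (?B i) = emeasure std_normal (A i)"
    proof
      assume "\<epsilon> i = -1"
      hence "?B i = uminus -` A i \<inter> space std_normal" by simp
      hence "emeasure std_normal (?B i) = emeasure (distr std_normal borel uminus) (A i)"
        using A[OF i] by (subst emeasure_distr) auto
      thus ?thesis by (simp only: distr_std_normal_uminus)
    qed simp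
  qed
  finally show "emeasure (distr (gauss {..<n}) (gauss {..<n}) (flip n \<epsilon>)) (Pi\<^sub>E {..<n} A) = (\<Prod>i<n. emeasure std_normal (A i))" .
qed simp_all

lemma gauss_eq_density:
  assumes "finite I"
  shows "gauss I = density (PiM I (\<lambda>_. lborel)) (\<lambda>x. ennreal (\<Prod>i\<in>I. std_normal_density (x i)))"
proof -
  interpret L: product_sigma_finite "\<lambda>_ :: 'a. lborel :: real measure" by standard
  have m: "(\<lambda>x. \<Prod>i\<in>I. std_normal_density (x i)) \<in> borel_measurable (PiM I (\<lambda>_. lborel))"
  proof (rule borel_measurable_prod)
    fix i assume "i \<in> I"
    hence "(\<lambda>x. x i) \<in> measurable (PiM I (\<lambda>_. lborel)) lborel" by (rule measurable_component_singleton)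
    thus "(\<lambda>x. std_normal_density (x i)) \<in> borel_measurable (PiM I (\<lambda>_. lborel))"
      by (rule measurable_compose) simp
  qed
  have "density (PiM I (\<lambda>_. lborel)) (\<lambda>x. ennreal (\<Prod>i\<in>I. std_normal_density (x i))) = gauss I"
  proof (rule std_normal.PiM_eqI)
    fix A :: "'a \<Rightarrow> real set" assume A: "\<And>i. i \<in> I \<Longrightarrow> A i \<in> sets std_normal"
    have "Pi\<^sub>E I A \<in> sets (PiM I (\<lambda>_. lborel))" using A assms by (intro sets_PiM_I_finite) auto
    hence "emeasure (density (PiM I (\<lambda>_. lborel)) (\<lambda>x. ennreal (\<Prod>i\<in>I. std_normal_density (x i)))) (Pi\<^sub>E I A) =
      (\<integral>\<^sup>+x. ennreal (\<Prod>i\<in>I. std_normal_density (x i)) * indicator (Pi\<^sub>E I A) x \<partial>PiM I (\<lambda>_. lborel))"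
      using m by (subst emeasure_density) auto
    also have "\<dots> = (\<integral>\<^sup>+x. (\<Prod>i\<in>I. ennreal (std_normal_density (x i)) * indicator (A i) (x i)) \<partial>PiM I (\<lambda>_. lborel))"
    proof (rule nn_integral_cong)
      fix x :: "'a \<Rightarrow> real" assume "x \<in> space (PiM I (\<lambda>_. lborel))"
      hence "indicator (Pi\<^sub>E I A) x = (\<Prod>i\<in>I. indicator (A i) (x i) :: ennreal)"
        using assms by (auto simp: indicator_def space_PiM PiE_iff)
      thus "ennreal (\<Prod>i\<in>I. std_normal_density (x i)) * indicator (Pi\<^sub>E I A) x = (\<Prod>i\<in>I. ennreal (std_normal_density (x i)) * indicator (A i) (x i))"
        by (simp add: prod.distrib prod_ennreal)
    qed
    also have "\<dots> = (\<Prod>i\<in>I. \<integral>\<^sup>+y. ennreal (std_normal_density y) * indicator (A i) y \<partial>lborel)"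
      using A assms by (intro L.product_nn_integral_prod) auto
    also have "\<dots> = (\<Prod>i\<in>I. emeasure std_normal (A i))"
      using A by (intro prod.cong refl) (simp add: emeasure_density)
    finally show "emeasure (density (PiM I (\<lambda>_. lborel)) (\<lambda>x. ennreal (\<Prod>i\<in>I. std_normal_density (x i)))) (Pi\<^sub>E I A) = (\<Prod>i\<in>I. emeasure std_normal (A i))" .
  qed (use assms in \<open>simp_all cong: sets_PiM_cong\<close>)
  thus ?thesis by simp
qed

text \<open>Transfers the normalizing constants, defined by Lebesgue integrals, to the Gaussian
  measure; each coordinate contributes the constant sqrt(2 pi) of the normal density.\<close>

lemma lborel_integral_gauss:
  fixes f :: "(nat \<Rightarrow> real) \<Rightarrow> real"
  assumes f: "f \<in> borel_measurable (gauss {..<n})"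
  shows "(LINT x|PiM {..<n} (\<lambda>_. lborel). f x * exp (- (1 / 2) * (\<Sum>i<n. (x i)\<^sup>2))) = sqrt (2 * pi) ^ n * (\<integral>x. f x \<partial>gauss {..<n})"
proof -
  have sets: "sets (gauss {..<n}) = sets (PiM {..<n} (\<lambda>_. lborel :: real measure))"
    by (intro sets_PiM_cong) auto
  have f': "f \<in> borel_measurable (PiM {..<n} (\<lambda>_. lborel))"
    using f measurable_cong_sets[OF sets refl] by blast
  have p: "(\<Prod>i<n. std_normal_density (x i)) = (1 / sqrt (2 * pi)) ^ n * exp (- (1 / 2) * (\<Sum>i<n. (x i)\<^sup>2))" for x :: "nat \<Rightarrow> real"
    by (simp add: std_normal_density_def prod.distrib exp_sum[symmetric] sum_divide_distrib[symmetric] sum_negf power_one_over prod_dividef)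
  have m: "(\<lambda>x. \<Prod>i<n. std_normal_density (x i)) \<in> borel_measurable (PiM {..<n} (\<lambda>_. lborel))"
  proof (rule borel_measurable_prod)
    fix i assume "i \<in> {..<n}"
    hence "(\<lambda>x. x i) \<in> measurable (PiM {..<n} (\<lambda>_. lborel)) lborel" by (rule measurable_component_singleton)
    thus "(\<lambda>x. std_normal_density (x i)) \<in> borel_measurable (PiM {..<n} (\<lambda>_. lborel))"
      by (rule measurable_compose) simp
  qed
  have "(\<integral>x. f x \<partial>gauss {..<n}) = (LINT x|PiM {..<n} (\<lambda>_. lborel). (\<Prod>i<n. std_normal_density (x i)) *\<^sub>R f x)"
    unfolding gauss_eq_density[OF finite_lessThan]
    by (rule integral_density[OF f' m]) (auto intro!: AE_I2 prod_nonneg)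
  also have "\<dots> = (1 / sqrt (2 * pi)) ^ n * (LINT x|PiM {..<n} (\<lambda>_. lborel). f x * exp (- (1 / 2) * (\<Sum>i<n. (x i)\<^sup>2)))"
    unfolding p real_scaleR_def mult.commute[of "f _"] mult.assoc by (rule integral_mult_right_zero)
  finally show ?thesis by (simp add: power_one_over field_simps)
qed

lemma integral_flip:
  fixes F :: "(nat \<Rightarrow> real) \<Rightarrow> real"
  assumes "\<epsilon> \<in> {..<n} \<rightarrow>\<^sub>E {1, -1}" "F \<in> borel_measurable (gauss {..<n})"
  shows "(\<integral>x. F (flip n \<epsilon> x) \<partial>gauss {..<n}) = (\<integral>x. F x \<partial>gauss {..<n})"
  using integral_distr[OF measurable_flip assms(2), of \<epsilon>] by (simp only: distr_flip[OF assms(1)])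

lemma nn_integral_flip:
  assumes "\<epsilon> \<in> {..<n} \<rightarrow>\<^sub>E {1, -1}" "F \<in> borel_measurable (gauss {..<n})"
  shows "(\<integral>\<^sup>+x. F (flip n \<epsilon> x) \<partial>gauss {..<n}) = (\<integral>\<^sup>+x. F x \<partial>gauss {..<n})"
proof -
  have "F \<in> borel_measurable (distr (gauss {..<n}) (gauss {..<n}) (flip n \<epsilon>))" using assms(2) by simp
  from nn_integral_distr[OF measurable_flip this] show ?thesis by (simp only: distr_flip[OF assms(1)])
qed

lemma card_signs: "card ({..<n} \<rightarrow>\<^sub>E {1, -1 :: real}) = 2 ^ n"
  by (simp add: card_PiE numeral_2_eq_2)

text \<open>Almost every point is carried into the orthant by exactly one of the 2^n sign changes,
  and these preserve both the measure and F.\<close>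

lemma orthant_integral:
  fixes F :: "(nat \<Rightarrow> real) \<Rightarrow> real"
  assumes F: "integrable (gauss {..<n}) F" and even: "\<And>\<epsilon> x. \<epsilon> \<in> {..<n} \<rightarrow>\<^sub>E {1, -1} \<Longrightarrow> F (flip n \<epsilon> x) = F x"
  shows "(\<integral>x. F x \<partial>gauss {..<n}) = 2 ^ n * (\<integral>x. indicator ({..<n} \<rightarrow>\<^sub>E {0..}) x * F x \<partial>gauss {..<n})"
proof -
  let ?O = "{..<n} \<rightarrow>\<^sub>E {0 :: real..}" and ?E = "{..<n} \<rightarrow>\<^sub>E {1, -1 :: real}"
  have finE: "finite ?E" by (intro finite_PiE) auto
  have O: "?O \<in> sets (gauss {..<n})" by (intro sets_PiM_I_finite) auto
  have int: "integrable (gauss {..<n}) (\<lambda>x. indicator ?O x * F x)"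
    using integrable_mult_indicator[OF O F] by simp
  have one: "AE x in gauss {..<n}. (\<Sum>\<epsilon>\<in>?E. indicator ?O (flip n \<epsilon> x)) = (1 :: real)"
    using AE_gauss_generic[of n]
  proof eventually_elim
    case (elim x)
    \<comment> \<open>The only sign change that moves x into the orthant; uniqueness needs all
      coordinates to be non-zero.\<close>
    define s where "s = (\<lambda>i\<in>{..<n}. sgn (x i))"
    have s: "s \<in> ?E" using elim by (auto simp: s_def sgn_real_def)
    have "flip n \<epsilon> x \<in> ?O \<longleftrightarrow> \<epsilon> = s" if "\<epsilon> \<in> ?E" for \<epsilon>
    proof
      assume f: "flip n \<epsilon> x \<in> ?O"
      show "\<epsilon> = s"
      proof (rule PiE_ext[OF that s])
        fix i assume i: "i \<in> {..<n}"
        hence "\<epsilon> i * x i \<ge> 0" using f by (auto simp: flip_def PiE_iff)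
        moreover have "\<epsilon> i = 1 \<or> \<epsilon> i = -1" using that i by auto
        ultimately show "\<epsilon> i = s i" using elim i by (auto simp: s_def sgn_real_def)
      qed
    qed (auto simp: flip_def s_def sgn_real_def)
    hence "(\<Sum>\<epsilon>\<in>?E. indicator ?O (flip n \<epsilon> x)) = (\<Sum>\<epsilon>\<in>?E. if \<epsilon> = s then 1 else (0 :: real))"
      by (intro sum.cong) (auto simp: indicator_def)
    thus ?case using s finE by simp
  qed
  have fi: "integrable (gauss {..<n}) (\<lambda>x. indicator ?O (flip n \<epsilon> x) * F x)" if "\<epsilon> \<in> ?E" for \<epsilon>
  proof -
    have "integrable (distr (gauss {..<n}) (gauss {..<n}) (flip n \<epsilon>)) (\<lambda>x. indicator ?O x * F x)"
      using int by (simp only: distr_flip[OF that])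
    from integrable_distr[OF measurable_flip this] show ?thesis by (simp add: even[OF that])
  qed
  have "(\<integral>x. F x \<partial>gauss {..<n}) = (\<integral>x. (\<Sum>\<epsilon>\<in>?E. indicator ?O (flip n \<epsilon> x) * F x) \<partial>gauss {..<n})"
  proof (rule integral_cong_AE)
    show "F \<in> borel_measurable (gauss {..<n})" using F by simp
    show "(\<lambda>x. \<Sum>\<epsilon>\<in>?E. indicator ?O (flip n \<epsilon> x) * F x) \<in> borel_measurable (gauss {..<n})"
      using fi by (intro borel_measurable_sum) auto
    show "AE x in gauss {..<n}. F x = (\<Sum>\<epsilon>\<in>?E. indicator ?O (flip n \<epsilon> x) * F x)"
      using one by eventually_elim (simp add: sum_distrib_right[symmetric])
  qed
  also have "\<dots> = (\<Sum>\<epsilon>\<in>?E. \<integral>x. indicator ?O (flip n \<epsilon> x) * F x \<partial>gauss {..<n})"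
    by (intro Bochner_Integration.integral_sum fi)
  also have "\<dots> = (\<Sum>\<epsilon>\<in>?E. \<integral>x. indicator ?O x * F x \<partial>gauss {..<n})"
  proof (rule sum.cong[OF refl])
    fix \<epsilon> assume \<epsilon>: "\<epsilon> \<in> ?E"
    have "(\<integral>x. indicator ?O (flip n \<epsilon> x) * F (flip n \<epsilon> x) \<partial>gauss {..<n}) = (\<integral>x. indicator ?O x * F x \<partial>gauss {..<n})"
      using int by (intro integral_flip[OF \<epsilon>]) auto
    thus "(\<integral>x. indicator ?O (flip n \<epsilon> x) * F x \<partial>gauss {..<n}) = (\<integral>x. indicator ?O x * F x \<partial>gauss {..<n})"
      by (simp add: even[OF \<epsilon>])
  qed
  also have "\<dots> = 2 ^ n * (\<integral>x. indicator ?O x * F x \<partial>gauss {..<n})"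
    by (simp add: card_signs)
  finally show ?thesis .
qed

subsection \<open>Splitting a tuple\<close>

lemma nn_integral_subtuple:
  assumes S: "finite S" and h: "h \<in> borel_measurable (gauss {..<card S})"
  shows "(\<integral>\<^sup>+y. h (restrict (subtuple y S) {..<card S}) \<partial>gauss S) = (\<integral>\<^sup>+\<theta>. h \<theta> \<partial>gauss {..<card S})"
    and "(\<lambda>y. restrict (subtuple y S) {..<card S}) \<in> measurable (gauss S) (gauss {..<card S})"
proof -
  let ?f = "\<lambda>k. sorted_list_of_set S ! k"
  have f: "inj_on ?f {..<card S}" "?f \<in> {..<card S} \<rightarrow> S"
  proof -
    show "inj_on ?f {..<card S}"
      by (rule inj_on_nth) simp_all
    show "?f \<in> {..<card S} \<rightarrow> S"
    proof
      fix k assume "k \<in> {..<card S}"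
      hence "?f k \<in> set (sorted_list_of_set S)" by (intro nth_mem) simp
      thus "?f k \<in> S" using S by simp
    qed
  qed
  have eq: "restrict (subtuple y S) {..<card S} = (\<lambda>k\<in>{..<card S}. y (?f k))" for y
    by (simp add: subtuple_def[abs_def])
  have d: "distr (gauss S) (gauss {..<card S}) (\<lambda>y. restrict (subtuple y S) {..<card S}) = gauss {..<card S}"
    unfolding eq by (rule distr_PiM_reindex[OF prob_space_std_normal f])
  show m: "(\<lambda>y. restrict (subtuple y S) {..<card S}) \<in> measurable (gauss S) (gauss {..<card S})"
    unfolding eq by (rule measurable_restrict, rule measurable_component_singleton) (use f in auto)
  show "(\<integral>\<^sup>+y. h (restrict (subtuple y S) {..<card S}) \<partial>gauss S) = (\<integral>\<^sup>+\<theta>. h \<theta> \<partial>gauss {..<card S})"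
  proof -
    have "h \<in> borel_measurable (distr (gauss S) (gauss {..<card S}) (\<lambda>y. restrict (subtuple y S) {..<card S}))"
      using h by simp
    from nn_integral_distr[OF m this] show ?thesis by (simp only: d)
  qed
qed

lemma subtuple_merge:
  assumes "finite S" "S \<inter> T = {}" "k < card S"
  shows "subtuple (merge S T (x, y)) S k = subtuple x S k" "subtuple (merge T S (y, x)) S k = subtuple x S k"
proof -
  have "sorted_list_of_set S ! k \<in> S"
    using assms by (metis length_sorted_list_of_set nth_mem set_sorted_list_of_set)
  thus "subtuple (merge S T (x, y)) S k = subtuple x S k" "subtuple (merge T S (y, x)) S k = subtuple x S k"
    using assms(2) by (auto simp: subtuple_def merge_def)
qed

text \<open>The coordinates in S and in T are independent, and as all factors of the product measure
  are equal, relabelling them by initial segments does not change their law. The restrictions keep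
  the subtuples extensional.\<close>

lemma nn_integral_split:
  fixes n :: nat
  assumes S: "S \<subseteq> {..<n}" and T: "T = {..<n} - S"
    and h: "(\<lambda>(\<theta>, \<phi>). h \<theta> \<phi>) \<in> borel_measurable (gauss {..<card S} \<Otimes>\<^sub>M gauss {..<card T})"
  shows "(\<integral>\<^sup>+x. h (restrict (subtuple x S) {..<card S}) (restrict (subtuple x T) {..<card T}) \<partial>gauss {..<n}) =
     (\<integral>\<^sup>+\<theta>. (\<integral>\<^sup>+\<phi>. h \<theta> \<phi> \<partial>gauss {..<card T}) \<partial>gauss {..<card S})"
proof -
  have fin: "finite S" "finite T" using S T finite_subset by auto
  have U: "{..<n} = S \<union> T" "S \<inter> T = {}" using S T by auto
  have eqS: "restrict (subtuple (merge S T (x, y)) S) {..<card S} = restrict (subtuple x S) {..<card S}" for x y :: "nat \<Rightarrow> real"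
    using subtuple_merge(1)[OF fin(1) U(2)] by (auto simp: restrict_def fun_eq_iff)
  have eqT: "restrict (subtuple (merge S T (x, y)) T) {..<card T} = restrict (subtuple y T) {..<card T}" for x y :: "nat \<Rightarrow> real"
    using subtuple_merge(2)[OF fin(2), of S] U(2) by (auto simp: restrict_def fun_eq_iff Int_commute)
  have m: "(\<lambda>y. restrict (subtuple y R) {..<card R}) \<in> measurable (gauss {..<n}) (gauss {..<card R})" if "R \<subseteq> {..<n}" for R
    unfolding restrict_def subtuple_def
  proof (rule measurable_restrict[unfolded restrict_def], rule measurable_component_singleton)
    fix k assume "k \<in> {..<card R}"
    hence "sorted_list_of_set R ! k \<in> R"
      using that by (metis finite_lessThan finite_subset length_sorted_list_of_set lessThan_iff nth_mem set_sorted_list_of_set)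
    thus "sorted_list_of_set R ! k \<in> {..<n}" using that by blast
  qed
  have F: "(\<lambda>x. h (restrict (subtuple x S) {..<card S}) (restrict (subtuple x T) {..<card T})) \<in> borel_measurable (gauss {..<n})"
    using measurable_compose[OF measurable_Pair[OF m[OF S] m[of T]] h] T by (simp add: case_prod_unfold)
  have h2: "h \<theta> \<in> borel_measurable (gauss {..<card T})" if "\<theta> \<in> space (gauss {..<card S})" for \<theta>
    using measurable_compose[OF measurable_Pair1'[OF that] h] by simp
  have h1: "(\<lambda>\<theta>. \<integral>\<^sup>+\<phi>. h \<theta> \<phi> \<partial>gauss {..<card T}) \<in> borel_measurable (gauss {..<card S})"
    using h by (intro sigma_finite_measure.borel_measurable_nn_integral) (auto intro: prob_space_imp_sigma_finite prob_space_gauss)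
  have "(\<integral>\<^sup>+x. h (restrict (subtuple x S) {..<card S}) (restrict (subtuple x T) {..<card T}) \<partial>gauss {..<n}) =
    (\<integral>\<^sup>+x. (\<integral>\<^sup>+y. h (restrict (subtuple x S) {..<card S}) (restrict (subtuple y T) {..<card T}) \<partial>gauss T) \<partial>gauss S)"
    using std_normal.product_nn_integral_fold[OF U(2) fin, of "\<lambda>x. h (restrict (subtuple x S) {..<card S}) (restrict (subtuple x T) {..<card T})"] F
    unfolding U(1)[symmetric] eqS eqT by blast
  also have "\<dots> = (\<integral>\<^sup>+x. (\<integral>\<^sup>+\<phi>. h (restrict (subtuple x S) {..<card S}) \<phi> \<partial>gauss {..<card T}) \<partial>gauss S)"
  proof (rule nn_integral_cong)
    fix x assume "x \<in> space (gauss S)"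
    hence "restrict (subtuple x S) {..<card S} \<in> space (gauss {..<card S})"
      using measurable_space[OF nn_integral_subtuple(2)[OF fin(1) borel_measurable_const]] by blast
    thus "(\<integral>\<^sup>+y. h (restrict (subtuple x S) {..<card S}) (restrict (subtuple y T) {..<card T}) \<partial>gauss T) =
      (\<integral>\<^sup>+\<phi>. h (restrict (subtuple x S) {..<card S}) \<phi> \<partial>gauss {..<card T})"
      by (intro nn_integral_subtuple(1)[OF fin(2)] h2)
  qed
  also have "\<dots> = (\<integral>\<^sup>+\<theta>. (\<integral>\<^sup>+\<phi>. h \<theta> \<phi> \<partial>gauss {..<card T}) \<partial>gauss {..<card S})"
    by (rule nn_integral_subtuple(1)[OF fin(1) h1])
  finally show ?thesis .
qed

section \<open>Sums of squared Vandermonde determinants over signs\<close>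

text \<open>Multiplication by the unitriangular matrix of coefficients of the Newton polynomials (X
  - y_0) ... (X - y_(j-1)) turns column j from powers into values of these polynomials. They vanish
  at y_i for i < j, so the product is lower triangular.\<close>

lemma det_weighted_vandermonde:
  fixes c y :: "nat \<Rightarrow> real"
  shows "det (mat m m (\<lambda>(i, j). c i * y i ^ j)) = (\<Prod>i<m. c i * (\<Prod>l<i. y i - y l))"
proof -
  let ?M = "mat m m (\<lambda>(i, j). c i * y i ^ j)"
  let ?p = "\<lambda>j. \<Prod>l<j. [:- y l, 1:]"
  let ?C = "mat m m (\<lambda>(k, j). poly.coeff (?p j) k)"
  have deg: "Polynomial.degree (?p j) = j" for j
    by (subst Polynomial.degree_prod_eq_sum_degree) auto
  have lead: "poly.coeff (?p j) j = 1" for j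
  proof -
    have "Polynomial.lead_coeff (?p j) = 1" by (simp add: Polynomial.lead_coeff_prod)
    thus ?thesis by (simp add: deg)
  qed
  have "det ?C = prod_list (diag_mat ?C)"
  proof (rule det_upper_triangular[of _ m])
    show "upper_triangular ?C"
      by (rule upper_triangularI) (auto intro!: coeff_eq_0 simp: deg)
  qed simp
  also have "\<dots> = 1" by (simp add: prod_list_diag_prod lead)
  finally have detC: "det ?C = 1" .
  have MC: "(?M * ?C) $$ (i, j) = c i * (\<Prod>l<j. y i - y l)" if ij: "i < m" "j < m" for i j
  proof -
    have "(?M * ?C) $$ (i, j) = (\<Sum>k<m. c i * y i ^ k * poly.coeff (?p j) k)"
      using ij by (simp add: scalar_prod_def atLeast0LessThan)
    also have "\<dots> = c i * (\<Sum>k<m. poly.coeff (?p j) k * y i ^ k)"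
      by (simp add: sum_distrib_left mult_ac)
    also have "(\<Sum>k<m. poly.coeff (?p j) k * y i ^ k) = (\<Sum>k\<le>Polynomial.degree (?p j). poly.coeff (?p j) k * y i ^ k)"
      using ij by (intro sum.mono_neutral_right) (auto simp: deg intro!: coeff_eq_0)
    also have "\<dots> = (\<Prod>l<j. y i - y l)"
      by (simp add: poly_altdef[symmetric] poly_prod)
    finally show ?thesis .
  qed
  have "det ?M = det (?M * ?C)" by (subst det_mult[of _ m]) (simp_all add: detC)
  also have "\<dots> = prod_list (diag_mat (?M * ?C))"
  proof (rule det_lower_triangular[of m])
    fix i j assume "i < j" "j < m"
    hence "(\<Prod>l<j. y i - y l) = 0" by (intro prod_zero) auto
    thus "(?M * ?C) $$ (i, j) = 0" using MC[of i j] \<open>i < j\<close> \<open>j < m\<close> by simp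
  qed (rule mult_carrier_mat[of _ m m]; simp)
  also have "\<dots> = (\<Prod>i<m. (?M * ?C) $$ (i, i))" by (simp add: prod_list_diag_prod atLeast0LessThan)
  also have "\<dots> = (\<Prod>i<m. c i * (\<Prod>l<i. y i - y l))" by (intro prod.cong refl MC) auto
  finally show ?thesis .
qed

lemma det_weighted_vandermonde_square:
  fixes c y :: "nat \<Rightarrow> real"
  shows "(det (mat m m (\<lambda>(i, j). c i * y i ^ j)))\<^sup>2 =
    (\<Prod>i<m. (c i)\<^sup>2) * (\<Prod>(i, j)\<in>{(i, j). i < j \<and> j < m}. (y i - y j)\<^sup>2)"
proof -
  have "(\<Prod>(i, j)\<in>{(i, j). i < j \<and> j < m}. (y i - y j)\<^sup>2) = (\<Prod>(j, i)\<in>Sigma {..<m} (\<lambda>j. {..<j}). (y j - y i)\<^sup>2)"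
    by (rule prod.reindex_bij_witness[of _ prod.swap prod.swap]) (auto simp: power2_commute)
  also have "\<dots> = (\<Prod>j<m. \<Prod>i<j. (y j - y i)\<^sup>2)" by (simp add: prod.Sigma)
  finally show ?thesis
    unfolding det_weighted_vandermonde by (simp add: prod.distrib power_mult_distrib prod_power_distrib)
qed

section \<open>Parity decomposition of the Vandermonde determinant\<close>

lemma permutes_lt: "p permutes {0..<n} \<Longrightarrow> i < n \<Longrightarrow> p i < (n :: nat)"
  using permutes_in_image[of p "{0..<n}" i] by simp

lemma det_permute_columns:
  fixes A :: "real mat"
  assumes A: "A \<in> carrier_mat n n" and p: "p permutes {0..<n}"
  shows "det (mat n n (\<lambda>(i, j). A $$ (i, p j))) = signof p * det A"
proof -
  have "mat n n (\<lambda>(i, j). A $$ (i, p j)) = transpose_mat (mat n n (\<lambda>(i, j). transpose_mat A $$ (p i, j)))"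
    using A p permutes_in_image[OF p] by (intro eq_matI) auto
  hence "det (mat n n (\<lambda>(i, j). A $$ (i, p j))) = det (mat n n (\<lambda>(i, j). transpose_mat A $$ (p i, j)))"
    by (simp add: det_transpose[of _ n])
  thus ?thesis using det_permute_rows[of "transpose_mat A" n p] A p by (simp add: det_transpose)
qed

text \<open>
  The determinant of this matrix is the part of the Vandermonde determinant that is odd in the
  variables with index in \<open>A\<close> and even in the others.
\<close>

definition parity_mat :: "nat \<Rightarrow> (nat \<Rightarrow> real) \<Rightarrow> nat set \<Rightarrow> real mat" where
  "parity_mat n x A = mat n n (\<lambda>(i, j). of_bool (odd j \<longleftrightarrow> i \<in> A) * x i ^ j)"

lemma card_odd: "card {j. j < n \<and> odd j} = n div 2"
proof -
  have "bij_betw (\<lambda>j. 2 * j + 1) {..<n div 2} {j. j < n \<and> odd j}"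
    by (rule bij_betwI[of _ _ _ "\<lambda>j. j div 2"]) (auto elim!: oddE)
  from bij_betw_same_card[OF this] show ?thesis by simp
qed

text \<open>In the Leibniz expansion the term of p carries the factors \<epsilon>_i^(p i), which are
  \<epsilon>_i for odd p i and 1 for even p i. Grouping the permutations by the set A of rows with
  odd exponent gives a sum of sign characters.\<close>

lemma vandermonde_signs:
  fixes x \<epsilon> :: "nat \<Rightarrow> real"
  assumes \<epsilon>: "\<epsilon> \<in> {..<n} \<rightarrow>\<^sub>E {1, -1}"
  shows "det (mat n n (\<lambda>(i, j). (\<epsilon> i * x i) ^ j)) = (\<Sum>A\<in>Pow {..<n}. (\<Prod>i\<in>A. \<epsilon> i) * det (parity_mat n x A))"
proof -
  let ?P = "{p. p permutes {0..<n}}"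
  \<comment> \<open>For given p the parity constraints hold for exactly one A, the set of i with p i
    odd.\<close>
  have trm: "(\<Sum>A\<in>Pow {..<n}. (\<Prod>i\<in>A. \<epsilon> i) * (\<Prod>i=0..<n. of_bool (odd (p i) \<longleftrightarrow> i \<in> A) * x i ^ p i)) = (\<Prod>i=0..<n. (\<epsilon> i * x i) ^ p i)" for p
  proof -
    let ?O = "{i. i < n \<and> odd (p i)}"
    have O: "?O \<in> Pow {..<n}" by auto
    have "(\<Prod>i\<in>A. \<epsilon> i) * (\<Prod>i=0..<n. of_bool (odd (p i) \<longleftrightarrow> i \<in> A) * x i ^ p i) =
      (if A = ?O then (\<Prod>i\<in>A. \<epsilon> i) * (\<Prod>i=0..<n. x i ^ p i) else 0)" if A: "A \<in> Pow {..<n}" for A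
    proof (cases "A = ?O")
      case True
      hence "(\<Prod>i=0..<n. of_bool (odd (p i) \<longleftrightarrow> i \<in> A) * x i ^ p i) = (\<Prod>i=0..<n. x i ^ p i)"
        by (intro prod.cong refl) auto
      thus ?thesis using True by simp
    next
      case False
      then obtain i where "i < n" "\<not> (odd (p i) \<longleftrightarrow> i \<in> A)" using A by blast
      hence "(\<Prod>i=0..<n. of_bool (odd (p i) \<longleftrightarrow> i \<in> A) * x i ^ p i) = 0"
        by (intro prod_zero) (auto intro!: bexI[of _ i])
      thus ?thesis using False by simp
    qed
    hence "(\<Sum>A\<in>Pow {..<n}. (\<Prod>i\<in>A. \<epsilon> i) * (\<Prod>i=0..<n. of_bool (odd (p i) \<longleftrightarrow> i \<in> A) * x i ^ p i)) =
      (\<Sum>A\<in>Pow {..<n}. if A = ?O then (\<Prod>i\<in>A. \<epsilon> i) * (\<Prod>i=0..<n. x i ^ p i) else 0)"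
      by (intro sum.cong refl) blast
    also have "\<dots> = (\<Prod>i\<in>?O. \<epsilon> i) * (\<Prod>i=0..<n. x i ^ p i)"
      using O by (subst sum.delta) auto
    also have "(\<Prod>i\<in>?O. \<epsilon> i) = (\<Prod>i\<in>?O. \<epsilon> i ^ p i)"
    proof (intro prod.cong refl)
      fix i assume "i \<in> ?O"
      hence "\<epsilon> i = 1 \<or> \<epsilon> i = -1" "odd (p i)" using \<epsilon> by auto
      thus "\<epsilon> i = \<epsilon> i ^ p i" by auto
    qed
    also have "\<dots> = (\<Prod>i=0..<n. \<epsilon> i ^ p i)"
    proof (rule prod.mono_neutral_left)
      show "\<forall>i\<in>{0..<n} - ?O. \<epsilon> i ^ p i = 1"
      proof
        fix i assume "i \<in> {0..<n} - ?O"
        hence "\<epsilon> i = 1 \<or> \<epsilon> i = -1" "even (p i)" using \<epsilon> by auto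
        thus "\<epsilon> i ^ p i = 1" by auto
      qed
    qed auto
    finally show ?thesis by (simp add: power_mult_distrib prod.distrib)
  qed
  have "det (mat n n (\<lambda>(i, j). (\<epsilon> i * x i) ^ j)) = (\<Sum>p\<in>?P. signof p * (\<Prod>i=0..<n. (\<epsilon> i * x i) ^ p i))"
    by (subst det_def'[of _ n]) (auto intro!: sum.cong prod.cong simp: permutes_lt)
  also have "\<dots> = (\<Sum>p\<in>?P. signof p * (\<Sum>A\<in>Pow {..<n}. (\<Prod>i\<in>A. \<epsilon> i) * (\<Prod>i=0..<n. of_bool (odd (p i) \<longleftrightarrow> i \<in> A) * x i ^ p i)))"
    unfolding trm ..
  also have "\<dots> = (\<Sum>p\<in>?P. \<Sum>A\<in>Pow {..<n}. (\<Prod>i\<in>A. \<epsilon> i) * (signof p * (\<Prod>i=0..<n. of_bool (odd (p i) \<longleftrightarrow> i \<in> A) * x i ^ p i)))"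
    unfolding sum_distrib_left by (intro sum.cong refl mult.left_commute)
  also have "\<dots> = (\<Sum>A\<in>Pow {..<n}. \<Sum>p\<in>?P. (\<Prod>i\<in>A. \<epsilon> i) * (signof p * (\<Prod>i=0..<n. of_bool (odd (p i) \<longleftrightarrow> i \<in> A) * x i ^ p i)))"
    by (rule sum.swap)
  also have "\<dots> = (\<Sum>A\<in>Pow {..<n}. (\<Prod>i\<in>A. \<epsilon> i) * det (parity_mat n x A))"
  proof (intro sum.cong refl)
    fix A
    have "det (parity_mat n x A) = (\<Sum>p\<in>?P. signof p * (\<Prod>i=0..<n. of_bool (odd (p i) \<longleftrightarrow> i \<in> A) * x i ^ p i))"
      unfolding parity_mat_def by (subst det_def'[of _ n]) (auto intro!: sum.cong prod.cong simp: permutes_lt)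
    thus "(\<Sum>p\<in>?P. (\<Prod>i\<in>A. \<epsilon> i) * (signof p * (\<Prod>i=0..<n. of_bool (odd (p i) \<longleftrightarrow> i \<in> A) * x i ^ p i))) = (\<Prod>i\<in>A. \<epsilon> i) * det (parity_mat n x A)"
      by (simp only: sum_distrib_left)
  qed
  finally show ?thesis .
qed

text \<open>Orthogonality of the characters of the group of sign vectors: the sum factorizes over
  the coordinates, and a coordinate in exactly one of A and B contributes 1 + (-1) = 0.\<close>

lemma sign_orthogonality:
  assumes A: "A \<subseteq> {..<n}" and B: "B \<subseteq> {..<n}"
  shows "(\<Sum>\<epsilon>\<in>{..<n} \<rightarrow>\<^sub>E {1, -1 :: real}. (\<Prod>i\<in>A. \<epsilon> i) * (\<Prod>i\<in>B. \<epsilon> i)) = (if A = B then 2 ^ n else 0)"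
proof -
  let ?f = "\<lambda>i (s :: real). (if i \<in> A then s else 1) * (if i \<in> B then s else 1)"
  have "(\<Prod>i\<in>A. \<epsilon> i) * (\<Prod>i\<in>B. \<epsilon> i) = (\<Prod>i<n. ?f i (\<epsilon> i))" for \<epsilon> :: "nat \<Rightarrow> real"
  proof -
    have "(\<Prod>i\<in>C. \<epsilon> i) = (\<Prod>i<n. if i \<in> C then \<epsilon> i else 1)" if "C \<subseteq> {..<n}" for C
      using that by (simp add: prod.If_cases Int_absorb1)
    thus ?thesis using A B by (simp add: prod.distrib)
  qed
  hence "(\<Sum>\<epsilon>\<in>{..<n} \<rightarrow>\<^sub>E {1, -1 :: real}. (\<Prod>i\<in>A. \<epsilon> i) * (\<Prod>i\<in>B. \<epsilon> i)) =
     (\<Sum>\<epsilon>\<in>{..<n} \<rightarrow>\<^sub>E {1, -1 :: real}. \<Prod>i<n. ?f i (\<epsilon> i))" by simp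
  also have "\<dots> = (\<Prod>i<n. \<Sum>s\<in>{1, -1}. ?f i s)"
    by (rule prod_sum_PiE[symmetric]) auto
  also have "\<dots> = (\<Prod>i<n. if i \<in> A \<longleftrightarrow> i \<in> B then 2 else 0)"
    by (intro prod.cong) auto
  also have "\<dots> = (if A = B then 2 ^ n else 0)"
  proof (cases "A = B")
    case False
    then obtain i where "i < n" "\<not> (i \<in> A \<longleftrightarrow> i \<in> B)" using A B by blast
    hence "(\<Prod>i<n. if i \<in> A \<longleftrightarrow> i \<in> B then 2 else 0 :: real) = 0"
      by (intro prod_zero) (auto intro!: bexI[of _ i])
    thus ?thesis using False by simp
  qed simp
  finally show ?thesis .
qed

text \<open>A non-zero Leibniz term needs a permutation that maps A onto the odd exponents below n,
  of which there are n div 2.\<close>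

lemma parity_mat_det_zero:
  assumes A: "A \<subseteq> {..<n}" and c: "card A \<noteq> n div 2"
  shows "det (parity_mat n x A) = 0"
proof -
  have "(\<Prod>i=0..<n. parity_mat n x A $$ (i, p i)) = 0" if p: "p permutes {0..<n}" for p
  proof (rule ccontr)
    assume "(\<Prod>i=0..<n. parity_mat n x A $$ (i, p i)) \<noteq> 0"
    hence nz: "parity_mat n x A $$ (i, p i) \<noteq> 0" if "i < n" for i using that by auto
    have iff: "odd (p i) \<longleftrightarrow> i \<in> A" if "i < n" for i
      using nz[OF that] that permutes_lt[OF p that] by (auto simp: parity_mat_def split: if_splits)
    have "p ` A = {j. j < n \<and> odd j}"
    proof
      show "p ` A \<subseteq> {j. j < n \<and> odd j}" using A iff permutes_lt[OF p] by auto
      show "{j. j < n \<and> odd j} \<subseteq> p ` A"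
      proof
        fix j assume j: "j \<in> {j. j < n \<and> odd j}"
        then obtain i where i: "i < n" "p i = j"
          using permutes_image[OF p] by (metis (mono_tags, lifting) atLeastLessThan_iff imageE mem_Collect_eq zero_le)
        thus "j \<in> p ` A" using iff j by auto
      qed
    qed
    moreover have "card (p ` A) = card A" by (rule card_image) (use permutes_inj[OF p] in \<open>auto simp: inj_on_def inj_def\<close>)
    ultimately show False using c card_odd[of n] by simp
  qed
  thus ?thesis by (subst det_def'[of _ n]) (auto simp: parity_mat_def intro!: sum.neutral)
qed

text \<open>Lists one set in the first m places by f and its complement in the remaining ones by g;
  being the identity from n on is what \<open>permutes\<close> requires.\<close>

definition blocks :: "nat \<Rightarrow> (nat \<Rightarrow> nat) \<Rightarrow> (nat \<Rightarrow> nat) \<Rightarrow> nat \<Rightarrow> nat \<Rightarrow> nat" where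
  "blocks n f g m i = (if i < m then f i else if i < n then g (i - m) else i)"

lemma blocks_permutes:
  assumes m: "m \<le> n" and f: "bij_betw f {..<m} A" and g: "bij_betw g {..<n - m} ({0..<n} - A)" and A: "A \<subseteq> {0..<n}"
  shows "blocks n f g m permutes {0..<n}"
proof (rule bij_imp_permutes)
  have 1: "bij_betw (blocks n f g m) {..<m} A"
    using f by (rule bij_betw_cong[THEN iffD1, rotated]) (simp add: blocks_def)
  have "bij_betw (\<lambda>i. i - m) {m..<n} {..<n - m}"
    by (rule bij_betwI[of _ _ _ "\<lambda>i. i + m"]) auto
  from bij_betw_trans[OF this g] have "bij_betw (g \<circ> (\<lambda>i. i - m)) {m..<n} ({0..<n} - A)" .
  hence 2: "bij_betw (blocks n f g m) {m..<n} ({0..<n} - A)"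
    by (rule bij_betw_cong[THEN iffD1, rotated]) (simp add: blocks_def)
  have "bij_betw (blocks n f g m) ({..<m} \<union> {m..<n}) (A \<union> ({0..<n} - A))"
    by (rule bij_betw_combine[OF 1 2]) auto
  moreover have "{..<m} \<union> {m..<n} = {0..<n}" "A \<union> ({0..<n} - A) = {0..<n}" using m A by auto
  ultimately show "bij_betw (blocks n f g m) {0..<n} {0..<n}" by simp
qed (use m in \<open>auto simp: blocks_def\<close>)

text \<open>Moving the rows in A and the odd columns to the front makes the matrix block diagonal.
  Column 2 j + 1 has entries x (x^2)^j and column 2 j has entries (x^2)^j, so the blocks are
  Vandermonde matrices in the squares, the first with row weights x. Squaring removes the signs of
  the permutations.\<close>

lemma parity_mat_det_square:
  fixes x :: "nat \<Rightarrow> real"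
  assumes A: "A \<subseteq> {..<n}" and c: "card A = n div 2"
  defines "m \<equiv> n div 2" and "B \<equiv> {..<n} - A"
  shows "(det (parity_mat n x A))\<^sup>2 =
    (\<Prod>i<m. (subtuple x A i)\<^sup>2) * (\<Prod>(i, j)\<in>{(i, j). i < j \<and> j < m}. ((subtuple x A i)\<^sup>2 - (subtuple x A j)\<^sup>2)\<^sup>2) *
    (\<Prod>(i, j)\<in>{(i, j). i < j \<and> j < n - m}. ((subtuple x B i)\<^sup>2 - (subtuple x B j)\<^sup>2)\<^sup>2)"
proof -
  have finA: "finite A" "finite B" using A finite_subset by (auto simp: B_def)
  have cB: "card B = n - m" using A c by (simp add: B_def m_def card_Diff_subset finA)
  have nth_bij: "bij_betw (\<lambda>i. sorted_list_of_set S ! i) {..<card S} S" if "finite S" for S :: "nat set"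
    using bij_betw_nth[of "sorted_list_of_set S" "{..<card S}" S] that by simp
  have B': "B = {0..<n} - A" by (auto simp: B_def)
  let ?e = "blocks n (\<lambda>i. sorted_list_of_set A ! i) (\<lambda>i. sorted_list_of_set B ! i) m"
  have e: "?e permutes {0..<n}"
    by (rule blocks_permutes[where A = A])
       (use nth_bij[OF finA(1)] nth_bij[OF finA(2)] cB c A in \<open>auto simp: m_def B'\<close>)
  let ?f = "blocks n (\<lambda>j. 2 * j + 1) (\<lambda>j. 2 * j) m"
  have f: "?f permutes {0..<n}"
  proof (rule blocks_permutes[where A = "{j. j < n \<and> odd j}"])
    show "bij_betw (\<lambda>j. 2 * j + 1) {..<m} {j. j < n \<and> odd j}"
      by (rule bij_betwI[of _ _ _ "\<lambda>j. j div 2"]) (auto simp: m_def elim!: oddE)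
    have "{0..<n} - {j. j < n \<and> odd j} = {j. j < n \<and> even j}" by auto
    moreover have "bij_betw (\<lambda>j. 2 * j) {..<n - m} {j. j < n \<and> even j}"
      by (rule bij_betwI[of _ _ _ "\<lambda>j. j div 2"]) (auto simp: m_def elim!: evenE)
    ultimately show "bij_betw (\<lambda>j. 2 * j) {..<n - m} ({0..<n} - {j. j < n \<and> odd j})" by simp
  qed (auto simp: m_def)
  let ?M = "parity_mat n x A"
  have M: "?M \<in> carrier_mat n n" by (simp add: parity_mat_def)
  let ?R = "mat n n (\<lambda>(i, j). ?M $$ (?e i, j))"
  let ?Q = "mat n n (\<lambda>(i, j). ?R $$ (i, ?f j))"
  have "det ?Q = signof ?f * (signof ?e * det ?M)"
    by (subst det_permute_columns[OF _ f]) (simp_all add: det_permute_rows[OF M e])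
  hence sq: "(det ?Q)\<^sup>2 = (det ?M)\<^sup>2"
    by (auto simp: sign_def power_mult_distrib)
  let ?X = "mat m m (\<lambda>(i, j). subtuple x A i * ((subtuple x A i)\<^sup>2) ^ j)"
  let ?Y = "mat (n - m) (n - m) (\<lambda>(i, j). 1 * ((subtuple x B i)\<^sup>2) ^ j)"
  have "?Q = four_block_mat ?X (0\<^sub>m m (n - m)) (0\<^sub>m (n - m) m) ?Y"
  proof (rule eq_matI)
    fix i j assume "i < dim_row (four_block_mat ?X (0\<^sub>m m (n - m)) (0\<^sub>m (n - m) m) ?Y)"
      "j < dim_col (four_block_mat ?X (0\<^sub>m m (n - m)) (0\<^sub>m (n - m) m) ?Y)"
    hence ij: "i < n" "j < n" by (auto simp: m_def)
    have ei: "?e i < n" and fj: "?f j < n" using permutes_lt[OF e ij(1)] permutes_lt[OF f ij(2)] by auto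
    have q: "?Q $$ (i, j) = of_bool (odd (?f j) \<longleftrightarrow> ?e i \<in> A) * x (?e i) ^ ?f j"
      using ij ei fj by (simp add: parity_mat_def)
    have odd: "odd (?f j) \<longleftrightarrow> j < m" using ij by (simp add: blocks_def)
    have inA: "?e i \<in> A \<longleftrightarrow> i < m"
    proof (cases "i < m")
      case True
      hence "sorted_list_of_set A ! i \<in> A" using nth_bij[OF finA(1)] c by (auto simp: bij_betw_def m_def)
      thus ?thesis using True by (simp add: blocks_def)
    next
      case False
      hence "i - m < card B" using ij cB by simp
      hence "sorted_list_of_set B ! (i - m) \<in> B" using nth_bij[OF finA(2)] by (auto simp: bij_betw_def)
      thus ?thesis using False ij by (simp add: blocks_def B_def)
    qed
    have mn: "m \<le> n" by (simp add: m_def)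
    show "?Q $$ (i, j) = four_block_mat ?X (0\<^sub>m m (n - m)) (0\<^sub>m (n - m) m) ?Y $$ (i, j)"
      unfolding q odd inA using ij mn
      by (cases "i < m"; cases "j < m") (auto simp: blocks_def subtuple_def power_mult)
  qed (auto simp: m_def)
  hence "det ?Q = det ?X * det ?Y"
    by (simp only:) (rule det_four_block_mat_upper_right_zero[of _ m _ "n - m"]; simp)
  hence "(det ?M)\<^sup>2 = (det ?X)\<^sup>2 * (det ?Y)\<^sup>2" using sq by (simp add: power_mult_distrib)
  thus ?thesis unfolding det_weighted_vandermonde_square by simp
qed

lemma sum_signs_vandermonde_square:
  fixes x :: "nat \<Rightarrow> real"
  shows "(\<Sum>\<epsilon>\<in>{..<n} \<rightarrow>\<^sub>E {1, -1}. (\<Prod>(i, j)\<in>{(i, j). i < j \<and> j < n}. (\<epsilon> i * x i - \<epsilon> j * x j)\<^sup>2)) =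
    2 ^ n * (\<Sum>A\<in>{A. A \<subseteq> {..<n} \<and> card A = n div 2}. (det (parity_mat n x A))\<^sup>2)"
proof -
  let ?E = "{..<n} \<rightarrow>\<^sub>E {1, -1 :: real}" and ?P = "Pow {..<n}" and ?d = "\<lambda>A. det (parity_mat n x A)"
  have "(\<Prod>(i, j)\<in>{(i, j). i < j \<and> j < n}. (\<epsilon> i * x i - \<epsilon> j * x j)\<^sup>2) = (\<Sum>A\<in>?P. (\<Prod>i\<in>A. \<epsilon> i) * ?d A)\<^sup>2" if "\<epsilon> \<in> ?E" for \<epsilon>
    using det_weighted_vandermonde_square[of n "\<lambda>_. 1" "\<lambda>i. \<epsilon> i * x i"] vandermonde_signs[OF that, of x] by simp
  hence "(\<Sum>\<epsilon>\<in>?E. (\<Prod>(i, j)\<in>{(i, j). i < j \<and> j < n}. (\<epsilon> i * x i - \<epsilon> j * x j)\<^sup>2)) = (\<Sum>\<epsilon>\<in>?E. (\<Sum>A\<in>?P. (\<Prod>i\<in>A. \<epsilon> i) * ?d A)\<^sup>2)"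
    by (intro sum.cong refl)
  also have "\<dots> = (\<Sum>\<epsilon>\<in>?E. \<Sum>A\<in>?P. \<Sum>B\<in>?P. (?d A * ?d B) * ((\<Prod>i\<in>A. \<epsilon> i) * (\<Prod>i\<in>B. \<epsilon> i)))"
    unfolding power2_eq_square sum_product by (simp only: mult_ac)
  also have "\<dots> = (\<Sum>A\<in>?P. \<Sum>B\<in>?P. \<Sum>\<epsilon>\<in>?E. (?d A * ?d B) * ((\<Prod>i\<in>A. \<epsilon> i) * (\<Prod>i\<in>B. \<epsilon> i)))"
    by (subst sum.swap) (intro sum.cong refl sum.swap)
  also have "\<dots> = (\<Sum>A\<in>?P. \<Sum>B\<in>?P. (?d A * ?d B) * (if A = B then 2 ^ n else 0))"
    unfolding sum_distrib_left[symmetric] by (intro sum.cong refl arg_cong2[where f = "(*)"] sign_orthogonality) auto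
  also have "\<dots> = (\<Sum>A\<in>?P. 2 ^ n * (?d A)\<^sup>2)"
    by (intro sum.cong refl) (simp add: if_distrib[of "(*) _"] power2_eq_square cong: if_cong)
  also have "\<dots> = (\<Sum>A\<in>{A. A \<subseteq> {..<n} \<and> card A = n div 2}. 2 ^ n * (?d A)\<^sup>2)"
    by (rule sum.mono_neutral_right) (auto simp: parity_mat_det_zero)
  finally show ?thesis by (simp add: sum_distrib_left)
qed

definition gue_poly :: "nat \<Rightarrow> (nat \<Rightarrow> real) \<Rightarrow> real" where
  "gue_poly n x = (\<Prod>(i, j)\<in>{(i, j). i < j \<and> j < n}. \<bar>x i - x j\<bar>\<^sup>2)"

definition antigue_poly :: "nat \<Rightarrow> (nat \<Rightarrow> real) \<Rightarrow> real" where
  "antigue_poly N \<theta> = (\<Prod>j<N div 2. \<theta> j ^ (2 * (N mod 2))) *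
     (\<Prod>(j, k)\<in>{(j, k). j < k \<and> k < N div 2}. ((\<theta> j)\<^sup>2 - (\<theta> k)\<^sup>2)\<^sup>2)"

text \<open>The odd block carries the factors x_i^2, so it belongs to the anti-GUE of odd order. For
  odd n this is order n, and S is the set A of odd rows; for even n it is order n + 1, and S is the
  complement of A, which again has n div 2 elements.\<close>

theorem sum_signs_gue_poly:
  fixes x :: "nat \<Rightarrow> real"
  shows "(\<Sum>\<epsilon>\<in>{..<n} \<rightarrow>\<^sub>E {1, -1}. gue_poly n (\<lambda>i. \<epsilon> i * x i)) =
    2 ^ n * (\<Sum>S\<in>{S. S \<subseteq> {..<n} \<and> card S = n div 2}.
      antigue_poly n (subtuple x S) * antigue_poly (n + 1) (subtuple x ({..<n} - S)))"
proof -
  let ?C = "{A. A \<subseteq> {..<n} \<and> card A = n div 2}"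
  have "(\<Sum>\<epsilon>\<in>{..<n} \<rightarrow>\<^sub>E {1, -1}. gue_poly n (\<lambda>i. \<epsilon> i * x i)) = 2 ^ n * (\<Sum>A\<in>?C. (det (parity_mat n x A))\<^sup>2)"
    unfolding sum_signs_vandermonde_square[symmetric] gue_poly_def by (simp add: case_prod_unfold)
  also have "(\<Sum>A\<in>?C. (det (parity_mat n x A))\<^sup>2) =
     (\<Sum>S\<in>?C. antigue_poly n (subtuple x S) * antigue_poly (n + 1) (subtuple x ({..<n} - S)))"
  proof (cases "even n")
    case True
    hence n: "n - n div 2 = n div 2" "(n + 1) div 2 = n div 2" "n mod 2 = 0" "(n + 1) mod 2 = 1" by presburger+
    have cc: "{..<n} - A \<in> ?C" "{..<n} - ({..<n} - A) = A" if "A \<in> ?C" for A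
      using that n by (auto simp: card_Diff_subset finite_subset)
    show ?thesis
    proof (rule sum.reindex_bij_witness[of _ "\<lambda>A. {..<n} - A" "\<lambda>A. {..<n} - A"])
      fix A assume A: "A \<in> ?C"
      show "antigue_poly n (subtuple x ({..<n} - A)) * antigue_poly (n + 1) (subtuple x ({..<n} - ({..<n} - A))) = (det (parity_mat n x A))\<^sup>2"
        unfolding cc(2)[OF A] using parity_mat_det_square[of A n x] A
        by (simp only: mem_Collect_eq antigue_poly_def n mult_ac mult_zero_left mult_0_right power_0 prod.neutral_const mult_1_left mult_1_right)
    qed (use cc in auto)
  next
    case False
    hence n: "n - n div 2 = (n + 1) div 2" "n mod 2 = 1" "(n + 1) mod 2 = 0" by presburger+
    show ?thesis
    proof (rule sum.cong[OF refl])
      fix A assume A: "A \<in> ?C"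
      show "(det (parity_mat n x A))\<^sup>2 = antigue_poly n (subtuple x A) * antigue_poly (n + 1) (subtuple x ({..<n} - A))"
        using parity_mat_det_square[of A n x] A
        by (simp only: mem_Collect_eq antigue_poly_def n mult_0_right power_0 prod.neutral_const mult_1_left mult_1_right)
    qed
  qed
  finally show ?thesis .
qed

section \<open>The two ensembles\<close>

lemma of_real_gue_poly: "complex_of_real (gue_poly n x) = vand2 n x"
  by (simp add: gue_poly_def vand2_def case_prod_unfold of_real_prod)

lemma of_real_antigue_poly: "complex_of_real (antigue_poly N \<theta>) = anti_weight (N mod 2) (N div 2) \<theta>"
  by (simp add: antigue_poly_def anti_weight_def case_prod_unfold of_real_prod)

lemma gue_poly_nonneg: "0 \<le> gue_poly n x"
  unfolding gue_poly_def by (intro prod_nonneg) auto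

lemma antigue_poly_nonneg: "0 \<le> antigue_poly N x"
  unfolding antigue_poly_def by (intro mult_nonneg_nonneg prod_nonneg) (auto simp: power_mult)

lemma tame_gue_poly: "tame {..<n} (\<lambda>x. complex_of_real (gue_poly n x))"
proof -
  have d: "tame {..<n} (\<lambda>x. (gvar a x - gvar b x)\<^sup>2)" if "a < n" "b < n" for a b
    using tame_power[OF tame_add[OF tame_coord[of "{..<n}" a] tame_mult[OF tame_const[of _ "-1"] tame_coord[of "{..<n}" b]]], of 2] that by simp
  show ?thesis unfolding of_real_gue_poly vand2_def
    by (intro tame_prod) (use d in \<open>auto simp: case_prod_unfold\<close>)
qed

lemma tame_antigue_poly: "tame {..<N div 2} (\<lambda>x. complex_of_real (antigue_poly N x))"
proof -
  have d: "tame {..<N div 2} (\<lambda>x. ((gvar a x)\<^sup>2 - (gvar b x)\<^sup>2)\<^sup>2)" if "a < N div 2" "b < N div 2" for a b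
    using tame_power[OF tame_add[OF tame_power[OF tame_coord[of "{..<N div 2}" a], of 2]
      tame_mult[OF tame_const[of _ "-1"] tame_power[OF tame_coord[of "{..<N div 2}" b], of 2]]], of 2] that by simp
  show ?thesis unfolding of_real_antigue_poly anti_weight_def
    by (intro tame_mult tame_prod tame_power tame_coord) (use d in \<open>auto simp: case_prod_unfold\<close>)
qed

lemma gue_poly_integral_pos: "0 < (\<integral>x. gue_poly n x \<partial>gauss {..<n})"
proof (rule integral_pos_of_AE[OF _ tame_gue_poly gue_poly_nonneg])
  show "AE x in gauss {..<n}. gue_poly n x \<noteq> 0"
    using AE_gauss_generic[of n]
  proof eventually_elim
    case (elim x)
    have "\<bar>x i - x j\<bar>\<^sup>2 \<noteq> 0" if "i < j" "j < n" for i j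
    proof -
      have "\<bar>x i\<bar> \<noteq> \<bar>x j\<bar>" using elim that by auto
      thus ?thesis by auto
    qed
    thus ?case by (auto simp: gue_poly_def)
  qed
qed simp

lemma antigue_poly_integral_pos: "0 < (\<integral>x. antigue_poly N x \<partial>gauss {..<N div 2})"
proof (rule integral_pos_of_AE[OF _ tame_antigue_poly antigue_poly_nonneg])
  show "AE x in gauss {..<N div 2}. antigue_poly N x \<noteq> 0"
    using AE_gauss_generic[of "N div 2"]
  proof eventually_elim
    case (elim x)
    have "(x j)\<^sup>2 \<noteq> (x k)\<^sup>2" if "j < k" "k < N div 2" for j k
    proof -
      have "\<bar>x j\<bar> \<noteq> \<bar>x k\<bar>" using elim that by auto
      thus ?thesis by (auto simp: power2_eq_iff)
    qed
    moreover have "x j ^ (2 * (N mod 2)) \<noteq> 0" if "j < N div 2" for j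
      using elim that by simp
    ultimately show ?case by (auto simp: antigue_poly_def)
  qed
qed simp

section \<open>Laws of the singular values of each ensemble\<close>

lemma of_real_prod_lin:
  assumes "\<And>k. complex_of_real (lin (\<lambda>x. x ^ (2 * k)) X) = T k"
  shows "complex_of_real (prod_lin ks X) = (\<Prod>k\<leftarrow>ks. T k)"
  by (induction ks) (simp_all add: assms)

lemma tame_moment_integrable:
  assumes "finite I" "\<And>k. tame I (T k)" "\<And>g ks. complex_of_real (prod_lin ks (Y g)) = (\<Prod>k\<leftarrow>ks. T k g)"
  shows "integrable (gauss I) (\<lambda>g. prod_lin ks (Y g))"
    "complex_of_real (\<integral>g. prod_lin ks (Y g) \<partial>gauss I) = moment I (\<lambda>_. 1) T ks"
proof -
  show "integrable (gauss I) (\<lambda>g. prod_lin ks (Y g))"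
    by (rule tame_real_integrable[OF assms(1)]) (simp only: assms(3) tame_prod_list[OF assms(2)])
  show "complex_of_real (\<integral>g. prod_lin ks (Y g) \<partial>gauss I) = moment I (\<lambda>_. 1) T ks"
    unfolding moment_def mult_1_left assms(3)[symmetric] integral_complex_of_real ..
qed

lemma moment_map: "moment I w (\<lambda>k. T (f k)) ks = moment I w T (map f ks)"
  by (simp add: moment_def o_def)

lemma gue_matrix_entry:
  assumes "a < n" "b < n"
  shows "gue_matrix n g $$ (a, b) = gue.m n g a b"
proof -
  let ?z = "\<lambda>i j. complex_of_real (g (i, j, False)) + \<i> * complex_of_real (g (i, j, True))"
  have "gue.m n g a b = (\<Sum>i<n. \<Sum>j<n. \<Sum>\<beta>\<in>UNIV. complex_of_real (g (i, j, \<beta>)) * gue_unit (i, j, \<beta>) a b)"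
    unfolding gue.m_def by (simp add: gue_index_def sum.cartesian_product')
  also have "\<dots> = (\<Sum>i<n. \<Sum>j<n. of_bool (i = a) * (of_bool (j = b) * (?z i j / 2)) + of_bool (j = a) * (of_bool (i = b) * (cnj (?z i j) / 2)))"
  proof (intro sum.cong refl)
    fix i j
    have "of_bool (a = i \<and> b = j) = of_bool (i = a) * (of_bool (j = b) :: complex)"
      "of_bool (a = j \<and> b = i) = of_bool (j = a) * (of_bool (i = b) :: complex)"
      unfolding of_bool_conj[symmetric] by (intro arg_cong[where f = of_bool]; blast)+
    thus "(\<Sum>\<beta>\<in>UNIV. complex_of_real (g (i, j, \<beta>)) * gue_unit (i, j, \<beta>) a b) =
      of_bool (i = a) * (of_bool (j = b) * (?z i j / 2)) + of_bool (j = a) * (of_bool (i = b) * (cnj (?z i j) / 2))"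
      by (simp add: UNIV_bool gue_unit_def field_simps)
  qed
  also have "\<dots> = (?z a b + cnj (?z b a)) / 2"
  proof -
    have dd: "(\<Sum>i<n. \<Sum>j<n. of_bool (i = x) * (of_bool (j = y) * K i j)) = K x y" if "x < n" "y < n" for x y and K :: "nat \<Rightarrow> nat \<Rightarrow> complex"
      using that by (simp add: sum_distrib_left[symmetric])
    have "(\<Sum>i<n. \<Sum>j<n. of_bool (j = a) * (of_bool (i = b) * (cnj (?z i j) / 2))) = cnj (?z b a) / 2"
      by (subst mult.left_commute, rule dd) fact+
    thus ?thesis unfolding sum.distrib dd[OF assms] by (simp only: add_divide_distrib)
  qed
  also have "\<dots> = gue_matrix n g $$ (a, b)"
    using assms by (simp add: gue_matrix_def Let_def mat_adjoint_def mat_of_rows_def complex_eq_iff)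
  finally show ?thesis by simp
qed

lemma gue_unit_hermitian: "gue_unit \<alpha> b a = cnj (gue_unit \<alpha> a b)"
proof -
  obtain i j \<beta> where \<alpha>: "\<alpha> = (i, j, \<beta>)" by (cases \<alpha>)
  have sw: "(b = i \<and> a = j) = (a = j \<and> b = i)" "(b = j \<and> a = i) = (a = i \<and> b = j)" by blast+
  have "(of_bool P * (if \<beta> then \<i> else 1) + of_bool Q * (if \<beta> then - \<i> else 1)) / 2 =
    cnj ((of_bool Q * (if \<beta> then \<i> else 1) + of_bool P * (if \<beta> then - \<i> else 1)) / 2)" for P Q
    by (cases \<beta>; cases P; cases Q) simp_all
  thus ?thesis unfolding \<alpha> gue_unit_def prod.case sw .
qed

lemma gue_matrix_carrier: "gue_matrix n g \<in> carrier_mat n n"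
  by (auto simp: gue_matrix_def Let_def mat_adjoint_def)

lemma GUE_gauss: "GUE n = distr (gauss (gue_index n)) (mat_borel n) (gue_matrix n)"
  by (simp add: GUE_def gue_index_def)

text \<open>Singular values of a hermitian matrix are absolute values of eigenvalues, so
  \<open>gue_moments\<close> is needed at even exponents only, where \<open>conf\<close> may replace
  x_i by |x_i|.\<close>

theorem GUE_singular_values_law:
  "distr (GUE n) mset_borel singular_values = distr (weighted n (gue_poly n)) mset_borel (conf 1 0 n)"
proof (rule law_of_moments[OF gue_poly_nonneg tame_gue_poly gue_poly_integral_pos prob_space_GUE])
  have G: "gue_matrix n \<in> measurable (gauss (gue_index n)) (mat_borel n)"
    using measurable_gue_matrix[of n] by (simp add: gue_index_def)
  have sp: "A \<in> carrier_mat n n" if "A \<in> space (GUE n)" for A using that by (simp add: GUE_def)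
  show "singular_values \<in> measurable (GUE n) mset_borel"
    unfolding GUE_gauss using measurable_singular_values by simp
  show "size (singular_values A) = 1 * n + 0" if "A \<in> space (GUE n)" for A
    using size_singular_values[OF sp[OF that]] by simp
  show "0 \<le> y" if "A \<in> space (GUE n)" "y \<in># singular_values A" for A y
    using singular_values_nonneg[OF sp[OF that(1)] that(2)] .
  have tT: "tame (gue_index n) (gue.T n k)" for k using drv_tame[OF gue.drv_T] .
  have L: "complex_of_real (prod_lin ks (singular_values (gue_matrix n g))) = (\<Prod>k\<leftarrow>ks. gue.T n (2 * k) g)" for ks g
    by (rule of_real_prod_lin, rule gue.lin_singular_values_T[OF gue_matrix_carrier gue_matrix_entry gue_unit_hermitian])
  have mPL: "(\<lambda>A. prod_lin ks (singular_values A)) \<in> borel_measurable (mat_borel n)" for ks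
    by (rule measurable_compose[OF measurable_singular_values measurable_prod_lin])
  note I = tame_moment_integrable[of "gue_index n" "\<lambda>k. gue.T n (2 * k)" "\<lambda>g. singular_values (gue_matrix n g)", OF gue.fin tT L]
  show "integrable (GUE n) (\<lambda>A. prod_lin ks (singular_values A))" for ks
    unfolding GUE_gauss using I(1) by (subst integrable_distr_eq[OF G mPL])
  show "(\<integral>x. gue_poly n x * prod_lin ks (conf 1 0 n x) \<partial>gauss {..<n}) =
      (\<integral>x. gue_poly n x \<partial>gauss {..<n}) * (\<integral>A. prod_lin ks (singular_values A) \<partial>GUE n)" for ks
  proof -
    have c: "complex_of_real (prod_lin ks (conf 1 0 n x)) = (\<Prod>k\<leftarrow>ks. psum n (2 * k) x)" for ks x
      by (rule of_real_prod_lin) (simp add: lin_conf psum_def power_even_abs)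
    have "complex_of_real (\<integral>x. gue_poly n x * prod_lin ks (conf 1 0 n x) \<partial>gauss {..<n}) = moment {..<n} (vand2 n) (psum n) (map ((*) 2) ks)" for ks
    proof -
      have m: "moment {..<n} (vand2 n) (psum n) (map ((*) 2) ks) = moment {..<n} (vand2 n) (\<lambda>k. psum n (2 * k)) ks"
        by (rule moment_map[symmetric])
      show ?thesis
        unfolding m unfolding moment_def c[symmetric] of_real_gue_poly[symmetric] of_real_mult[symmetric] integral_complex_of_real ..
    qed
    from this[of ks] this[of "[]"]
    have "complex_of_real (\<integral>x. gue_poly n x * prod_lin ks (conf 1 0 n x) \<partial>gauss {..<n}) =
      complex_of_real (\<integral>x. gue_poly n x \<partial>gauss {..<n}) * moment (gue_index n) (\<lambda>_. 1) (gue.T n) (map ((*) 2) ks)"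
      using gue_moments[of n "map ((*) 2) ks"] by simp
    also have "moment (gue_index n) (\<lambda>_. 1) (gue.T n) (map ((*) 2) ks) = complex_of_real (\<integral>g. prod_lin ks (singular_values (gue_matrix n g)) \<partial>gauss (gue_index n))"
      unfolding I(2) by (rule moment_map[symmetric])
    also have "(\<integral>g. prod_lin ks (singular_values (gue_matrix n g)) \<partial>gauss (gue_index n)) = (\<integral>A. prod_lin ks (singular_values A) \<partial>GUE n)"
      unfolding GUE_gauss by (rule integral_distr[OF G mPL, symmetric])
    finally show ?thesis unfolding of_real_mult[symmetric] of_real_eq_iff .
  qed
qed

lemma antigue_matrix_entry:
  assumes "a < N" "b < N"
  shows "(\<i> \<cdot>\<^sub>m map_mat complex_of_real (skew_matrix N g)) $$ (a, b) = anti.m N g a b"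
proof -
  let ?I = "{(i, j). i < j \<and> j < N}"
  have "anti.m N g a b = (\<Sum>\<alpha>\<in>?I. of_bool (\<alpha> = (a, b)) * (\<i> * complex_of_real (g (a, b))) - of_bool (\<alpha> = (b, a)) * (\<i> * complex_of_real (g (b, a))))"
    unfolding anti.m_def
  proof (intro sum.cong refl)
    fix \<alpha> assume "\<alpha> \<in> ?I"
    obtain i j where \<alpha>: "\<alpha> = (i, j)" by (cases \<alpha>)
    have "(a = i \<and> b = j) = (\<alpha> = (a, b))" "(a = j \<and> b = i) = (\<alpha> = (b, a))"
      unfolding \<alpha> by blast+
    hence u: "anti_unit \<alpha> a b = \<i> * (of_bool (\<alpha> = (a, b)) - of_bool (\<alpha> = (b, a)))"
      by (simp only: anti_unit_def) (simp only: \<alpha> prod.case)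
    show "complex_of_real (g \<alpha>) * anti_unit \<alpha> a b = of_bool (\<alpha> = (a, b)) * (\<i> * complex_of_real (g (a, b))) - of_bool (\<alpha> = (b, a)) * (\<i> * complex_of_real (g (b, a)))"
    proof -
      have e: "of_bool (\<alpha> = p) * (\<i> * complex_of_real (g p)) = of_bool (\<alpha> = p) * (\<i> * complex_of_real (g \<alpha>))" for p
        by (cases "\<alpha> = p") simp_all
      show ?thesis unfolding u e by (simp only: right_diff_distrib mult_ac)
    qed
  qed
  also have "\<dots> = (if a < b then \<i> * complex_of_real (g (a, b)) else 0) - (if b < a then \<i> * complex_of_real (g (b, a)) else 0)"
    using assms by (simp add: sum_subtractf sum_distrib_right[symmetric])
  also have "\<dots> = (\<i> \<cdot>\<^sub>m map_mat complex_of_real (skew_matrix N g)) $$ (a, b)"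
    using assms by (simp add: skew_matrix_def)
  finally show ?thesis by simp
qed

lemma anti_unit_hermitian: "anti_unit \<alpha> b a = cnj (anti_unit \<alpha> a b)"
proof -
  obtain i j where \<alpha>: "\<alpha> = (i, j)" by (cases \<alpha>)
  have sw: "(b = i \<and> a = j) = (a = j \<and> b = i)" "(b = j \<and> a = i) = (a = i \<and> b = j)" by blast+
  have "\<i> * (of_bool P - of_bool Q) = cnj (\<i> * (of_bool Q - of_bool P))" for P Q
    by (cases P; cases Q) simp_all
  thus ?thesis unfolding \<alpha> anti_unit_def prod.case sw .
qed

text \<open>The equal pairs, and the zero in odd order, do not come from linear algebra: the
  configuration with doubled points has the same moments as the matrix, so the pairing comes out as
  part of the law.\<close>

theorem antiGUE_singular_values_law:
  "distr (antiGUE N) mset_borel singular_values =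
     distr (weighted (N div 2) (antigue_poly N)) mset_borel (conf 2 (N mod 2) (N div 2))"
proof (rule law_of_moments[OF antigue_poly_nonneg tame_antigue_poly antigue_poly_integral_pos prob_space_antiGUE])
  let ?I = "{(i, j). i < j \<and> j < N}" and ?r = "N mod 2" and ?m = "N div 2"
  let ?A = "\<lambda>g. \<i> \<cdot>\<^sub>m map_mat complex_of_real (skew_matrix N g)"
  have N: "2 * ?m + ?r = N" by simp
  have G: "?A \<in> measurable (gauss ?I) (mat_borel N)" by (rule measurable_antigue_matrix)
  have sp: "A \<in> carrier_mat N N" if "A \<in> space (antiGUE N)" for A using that by (simp add: antiGUE_def)
  show "singular_values \<in> measurable (antiGUE N) mset_borel"
    unfolding antiGUE_def using measurable_singular_values by simp
  show "size (singular_values A) = 2 * ?m + ?r" if "A \<in> space (antiGUE N)" for A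
    using size_singular_values[OF sp[OF that]] by simp
  show "0 \<le> y" if "A \<in> space (antiGUE N)" "y \<in># singular_values A" for A y
    using singular_values_nonneg[OF sp[OF that(1)] that(2)] .
  have tT: "tame ?I (anti.T N k)" for k using drv_tame[OF anti.drv_T] .
  have car: "?A g \<in> carrier_mat N N" for g by (auto simp: skew_matrix_def)
  have L: "complex_of_real (prod_lin ks (singular_values (?A g))) = (\<Prod>k\<leftarrow>ks. anti.T N (2 * k) g)" for ks g
    by (rule of_real_prod_lin, rule anti.lin_singular_values_T[OF car antigue_matrix_entry anti_unit_hermitian])
  have mPL: "(\<lambda>A. prod_lin ks (singular_values A)) \<in> borel_measurable (mat_borel N)" for ks
    by (rule measurable_compose[OF measurable_singular_values measurable_prod_lin])
  note I = tame_moment_integrable[of ?I "\<lambda>k. anti.T N (2 * k)" "\<lambda>g. singular_values (?A g)", OF anti.fin tT L]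
  show "integrable (antiGUE N) (\<lambda>A. prod_lin ks (singular_values A))" for ks
    unfolding antiGUE_def using I(1) by (subst integrable_distr_eq[OF G mPL])
  show "(\<integral>x. antigue_poly N x * prod_lin ks (conf 2 ?r ?m x) \<partial>gauss {..<?m}) =
      (\<integral>x. antigue_poly N x \<partial>gauss {..<?m}) * (\<integral>A. prod_lin ks (singular_values A) \<partial>antiGUE N)" for ks
  proof -
    have c: "complex_of_real (prod_lin ks (conf 2 ?r ?m x)) = (\<Prod>k\<leftarrow>ks. psum2 ?r ?m k x)" for ks x
      by (rule of_real_prod_lin) (simp add: lin_conf psum2_def power_even_abs zero_power)
    have "complex_of_real (\<integral>x. antigue_poly N x * prod_lin ks (conf 2 ?r ?m x) \<partial>gauss {..<?m}) = moment {..<?m} (anti_weight ?r ?m) (psum2 ?r ?m) ks" for ks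
      unfolding moment_def c[symmetric] of_real_antigue_poly[symmetric] of_real_mult[symmetric] integral_complex_of_real ..
    from this[of ks] this[of "[]"]
    have "complex_of_real (\<integral>x. antigue_poly N x * prod_lin ks (conf 2 ?r ?m x) \<partial>gauss {..<?m}) =
      complex_of_real (\<integral>x. antigue_poly N x \<partial>gauss {..<?m}) * moment ?I (\<lambda>_. 1) (\<lambda>k. anti.T N (2 * k)) ks"
      using antigue_moments[of ?r ?m ks] unfolding N by simp
    also have "moment ?I (\<lambda>_. 1) (\<lambda>k. anti.T N (2 * k)) ks = complex_of_real (\<integral>g. prod_lin ks (singular_values (?A g)) \<partial>gauss ?I)"
      unfolding I(2) ..
    also have "(\<integral>g. prod_lin ks (singular_values (?A g)) \<partial>gauss ?I) = (\<integral>A. prod_lin ks (singular_values A) \<partial>antiGUE N)"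
      unfolding antiGUE_def by (rule integral_distr[OF G mPL, symmetric])
    finally show ?thesis unfolding of_real_mult[symmetric] of_real_eq_iff .
  qed
qed

section \<open>Distinct non-zero singular values of the anti-GUE\<close>

lemma distinct_nonzero_eq: "distinct_nonzero_singular_values A = distinct_part (singular_values A)"
  by (simp add: distinct_nonzero_singular_values_def distinct_part_def)

lemma measurable_conf_weighted: "conf a b m \<in> measurable (weighted m w) mset_borel"
  unfolding weighted_def using measurable_conf by simp

lemma measurable_distinct_nonzero: "distinct_nonzero_singular_values \<in> measurable (antiGUE N) mset_borel"
proof -
  have "singular_values \<in> measurable (antiGUE N) mset_borel"
    unfolding antiGUE_def using measurable_singular_values by simp
  from measurable_compose[OF this measurable_distinct_part] show ?thesis
    by (simp add: distinct_nonzero_eq[abs_def])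
qed

text \<open>\<open>distinct_part\<close> is a measurable map of the multiset, so it may be applied
  to both sides of \<open>antiGUE_singular_values_law\<close>. On the model side the absolute values
  are almost surely distinct and non-zero, and one copy of each remains.\<close>

lemma antiGUE_distinct_law:
  "distr (antiGUE N) mset_borel distinct_nonzero_singular_values =
     distr (weighted (N div 2) (antigue_poly N)) mset_borel (conf 1 0 (N div 2))"
proof -
  let ?W = "weighted (N div 2) (antigue_poly N)"
  have sv: "singular_values \<in> measurable (antiGUE N) mset_borel"
    unfolding antiGUE_def using measurable_singular_values by simp
  have "distr (antiGUE N) mset_borel distinct_nonzero_singular_values =
    distr (distr (antiGUE N) mset_borel singular_values) mset_borel distinct_part"
    by (subst distr_distr[OF measurable_distinct_part sv]) (simp add: distinct_nonzero_eq[abs_def] o_def)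
  also have "\<dots> = distr ?W mset_borel (distinct_part \<circ> conf 2 (N mod 2) (N div 2))"
    unfolding antiGUE_singular_values_law by (rule distr_distr[OF measurable_distinct_part measurable_conf_weighted])
  also have "\<dots> = distr ?W mset_borel (conf 1 0 (N div 2))"
  proof (rule distr_cong_AE[OF refl refl])
    show "AE x in ?W. (distinct_part \<circ> conf 2 (N mod 2) (N div 2)) x = conf 1 0 (N div 2) x"
      unfolding weighted_def
    proof (subst AE_density)
      show "(\<lambda>x. ennreal (antigue_poly N x / (\<integral>x. antigue_poly N x \<partial>gauss {..<N div 2}))) \<in> borel_measurable (gauss {..<N div 2})"
        using tame_real_integrable[OF _ tame_antigue_poly] by auto
      show "AE x in gauss {..<N div 2}. 0 < ennreal (antigue_poly N x / (\<integral>x. antigue_poly N x \<partial>gauss {..<N div 2})) \<longrightarrow>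
          (distinct_part \<circ> conf 2 (N mod 2) (N div 2)) x = conf 1 0 (N div 2) x"
        using AE_gauss_generic[of "N div 2"] by eventually_elim (simp add: distinct_part_conf)
    qed
  qed (auto intro: measurable_comp[OF measurable_conf_weighted measurable_distinct_part] measurable_conf_weighted)
  finally show ?thesis .
qed

subsection \<open>Splitting the weight\<close>

lemma conf_flip:
  assumes "\<epsilon> \<in> {..<n} \<rightarrow>\<^sub>E {1, -1}"
  shows "conf a b n (flip n \<epsilon> x) = conf a b n x"
proof -
  have "\<bar>flip n \<epsilon> x i\<bar> = \<bar>x i\<bar>" if "i < n" for i
  proof -
    have "\<epsilon> i = 1 \<or> \<epsilon> i = -1" using assms that by auto
    thus ?thesis using that by (auto simp: flip_def abs_mult)
  qed
  hence "image_mset (\<lambda>i. \<bar>flip n \<epsilon> x i\<bar>) (mset_set {..<n}) = image_mset (\<lambda>i. \<bar>x i\<bar>) (mset_set {..<n})"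
    by (intro image_mset_cong) simp
  thus ?thesis by (simp add: conf_def)
qed

lemma conf_cong: "(\<And>i. i < n \<Longrightarrow> x i = y i) \<Longrightarrow> conf a b n x = conf a b n y"
  unfolding conf_def by (intro arg_cong2[where f = "(+)"] arg_cong[where f = "repeat_mset a"] image_mset_cong) auto

lemma conf_subtuple:
  assumes "finite S"
  shows "conf 1 0 (card S) (subtuple x S) = image_mset (\<lambda>i. \<bar>x i\<bar>) (mset_set S)"
proof -
  let ?f = "\<lambda>k. sorted_list_of_set S ! k"
  have bij: "bij_betw ?f {..<card S} S"
    using bij_betw_nth[of "sorted_list_of_set S" "{..<card S}" S] assms by simp
  have "image_mset (\<lambda>i. \<bar>x i\<bar>) (mset_set S) = image_mset (\<lambda>i. \<bar>x i\<bar>) (image_mset ?f (mset_set {..<card S}))"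
    using bij by (simp add: image_mset_mset_set bij_betw_def)
  thus ?thesis by (simp add: conf_def subtuple_def image_mset.compositionality o_def)
qed

lemma conf_split:
  assumes "S \<subseteq> {..<n}"
  shows "conf 1 0 n x = conf 1 0 (card S) (subtuple x S) + conf 1 0 (card ({..<n} - S)) (subtuple x ({..<n} - S))"
proof -
  have fin: "finite S" "finite ({..<n} - S)" using assms finite_subset by auto
  have ms: "mset_set {..<n} = mset_set S + mset_set ({..<n} - S)"
    using assms fin by (subst mset_set_Union[symmetric]) (auto simp: Un_absorb1)
  have l: "conf 1 0 n x = image_mset (\<lambda>i. \<bar>x i\<bar>) (mset_set {..<n})" by (simp add: conf_def)
  show ?thesis unfolding l conf_subtuple[OF fin(1)] conf_subtuple[OF fin(2)] ms by (rule image_mset_union)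
qed

lemma gue_poly_cong: "(\<And>i. i < n \<Longrightarrow> x i = y i) \<Longrightarrow> gue_poly n x = gue_poly n y"
  unfolding gue_poly_def by (intro prod.cong refl) auto

lemma antigue_poly_cong: "(\<And>i. i < N div 2 \<Longrightarrow> x i = y i) \<Longrightarrow> antigue_poly N x = antigue_poly N y"
  unfolding antigue_poly_def by (intro arg_cong2[where f = "(*)"] prod.cong refl) auto

lemma measurable_gue_poly: "gue_poly n \<in> borel_measurable (gauss {..<n})"
  using tame_real_integrable[OF _ tame_gue_poly] by auto

lemma measurable_antigue_poly: "antigue_poly N \<in> borel_measurable (gauss {..<N div 2})"
  using tame_real_integrable[OF _ tame_antigue_poly] by auto

text \<open>Sign changes preserve the Gaussian measure and the multiset of absolute values, so
  \<open>gue_poly\<close> may be summed over signs, which gives the sum over S of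
  \<open>sum_signs_gue_poly\<close>. Each S contributes the same integral because the coordinates
  are independent and identically distributed, and the sets S are counted by the binomial
  coefficient.\<close>

theorem nn_integral_gue_split:
  fixes H :: "real multiset \<Rightarrow> ennreal"
  assumes H: "H \<in> borel_measurable mset_borel"
  shows "(\<integral>\<^sup>+x. H (conf 1 0 n x) * ennreal (gue_poly n x) \<partial>gauss {..<n}) =
    of_nat (n choose (n div 2)) *
    (\<integral>\<^sup>+\<theta>. (\<integral>\<^sup>+\<phi>. H (conf 1 0 (n div 2) \<theta> + conf 1 0 ((n + 1) div 2) \<phi>) * (ennreal (antigue_poly n \<theta>) * ennreal (antigue_poly (n + 1) \<phi>))
      \<partial>gauss {..<(n + 1) div 2}) \<partial>gauss {..<n div 2})"
    (is "?L = _ * ?J")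
proof -
  let ?E = "{..<n} \<rightarrow>\<^sub>E {1, -1 :: real}" and ?C = "{S. S \<subseteq> {..<n} \<and> card S = n div 2}"
  let ?m = "n div 2" and ?m' = "(n + 1) div 2"
  have finC: "finite ?C" by (rule finite_subset[of _ "Pow {..<n}"]) auto
  have Hc: "(\<lambda>x. H (conf 1 0 n x)) \<in> borel_measurable (gauss {..<n})"
    by (rule measurable_compose[OF measurable_conf H])
  have F: "(\<lambda>x. H (conf 1 0 n x) * ennreal (gue_poly n x)) \<in> borel_measurable (gauss {..<n})"
    by (intro borel_measurable_times_ennreal Hc measurable_compose[OF measurable_gue_poly measurable_ennreal])
  have Ff: "(\<lambda>x. H (conf 1 0 n x) * ennreal (gue_poly n (flip n \<epsilon> x))) \<in> borel_measurable (gauss {..<n})" for \<epsilon>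
    by (intro borel_measurable_times_ennreal Hc measurable_compose[OF measurable_compose[OF measurable_flip measurable_gue_poly] measurable_ennreal])
  let ?g = "\<lambda>S x. H (conf 1 0 n x) * (ennreal (antigue_poly n (subtuple x S)) * ennreal (antigue_poly (n + 1) (subtuple x ({..<n} - S))))"
  have cT: "card ({..<n} - S) = ?m'" if "S \<in> ?C" for S
    using that by (subst card_Diff_subset) (auto intro: finite_subset)
  define h where "h = (\<lambda>\<theta> \<phi>. H (conf 1 0 ?m \<theta> + conf 1 0 ?m' \<phi>) * (ennreal (antigue_poly n \<theta>) * ennreal (antigue_poly (n + 1) \<phi>)))"
  have hm: "(\<lambda>(\<theta>, \<phi>). h \<theta> \<phi>) \<in> borel_measurable (gauss {..<?m} \<Otimes>\<^sub>M gauss {..<?m'})"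
  proof -
    have "(\<lambda>p. (conf 1 0 ?m (fst p), conf 1 0 ?m' (snd p))) \<in> measurable (gauss {..<?m} \<Otimes>\<^sub>M gauss {..<?m'}) (mset_borel \<Otimes>\<^sub>M mset_borel)"
      by (intro measurable_Pair measurable_compose[OF measurable_fst measurable_conf] measurable_compose[OF measurable_snd measurable_conf])
    from measurable_compose[OF measurable_compose[OF this measurable_mset_plus] H]
    have "(\<lambda>p. H (conf 1 0 ?m (fst p) + conf 1 0 ?m' (snd p))) \<in> borel_measurable (gauss {..<?m} \<Otimes>\<^sub>M gauss {..<?m'})" by simp
    thus ?thesis unfolding h_def case_prod_unfold
      by (intro borel_measurable_times_ennreal measurable_compose[OF _ measurable_ennreal]
          measurable_compose[OF measurable_fst measurable_antigue_poly] measurable_compose[OF measurable_snd measurable_antigue_poly])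
  qed
  have g_eq: "?g S x = h (restrict (subtuple x S) {..<card S}) (restrict (subtuple x ({..<n} - S)) {..<card ({..<n} - S)})" if S: "S \<in> ?C" for S x
  proof -
    have "conf 1 0 n x = conf 1 0 ?m (subtuple x S) + conf 1 0 ?m' (subtuple x ({..<n} - S))"
      using conf_split[of S n x] S cT[OF S] by simp
    moreover have "conf 1 0 ?m (restrict (subtuple x S) {..<card S}) = conf 1 0 ?m (subtuple x S)"
      "conf 1 0 ?m' (restrict (subtuple x ({..<n} - S)) {..<card ({..<n} - S)}) = conf 1 0 ?m' (subtuple x ({..<n} - S))"
      using S cT[OF S] by (auto intro!: conf_cong)
    moreover have "antigue_poly n (restrict (subtuple x S) {..<card S}) = antigue_poly n (subtuple x S)"
      "antigue_poly (n + 1) (restrict (subtuple x ({..<n} - S)) {..<card ({..<n} - S)}) = antigue_poly (n + 1) (subtuple x ({..<n} - S))"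
      using S cT[OF S] by (auto intro!: antigue_poly_cong)
    ultimately show ?thesis unfolding h_def by simp
  qed
  have g_int: "(\<integral>\<^sup>+x. ?g S x \<partial>gauss {..<n}) = ?J" if S: "S \<in> ?C" for S
  proof -
    have "card S = ?m" using S by simp
    hence "(\<integral>\<^sup>+x. h (restrict (subtuple x S) {..<card S}) (restrict (subtuple x ({..<n} - S)) {..<card ({..<n} - S)}) \<partial>gauss {..<n}) =
      (\<integral>\<^sup>+\<theta>. (\<integral>\<^sup>+\<phi>. h \<theta> \<phi> \<partial>gauss {..<card ({..<n} - S)}) \<partial>gauss {..<card S})"
      using S hm cT[OF S] by (intro nn_integral_split) auto
    thus ?thesis unfolding g_eq[OF S] using S cT[OF S] by (simp add: h_def)
  qed
  have gm: "?g S \<in> borel_measurable (gauss {..<n})" if S: "S \<in> ?C" for S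
  proof -
    have m: "(\<lambda>y. restrict (subtuple y R) {..<card R}) \<in> measurable (gauss {..<n}) (gauss {..<card R})" if "R \<subseteq> {..<n}" for R
      unfolding restrict_def subtuple_def
    proof (rule measurable_restrict[unfolded restrict_def], rule measurable_component_singleton)
      fix k assume "k \<in> {..<card R}"
      hence "sorted_list_of_set R ! k \<in> set (sorted_list_of_set R)" by (intro nth_mem) simp
      thus "sorted_list_of_set R ! k \<in> {..<n}" using that finite_subset[OF that] by auto
    qed
    have "(\<lambda>x. (restrict (subtuple x S) {..<card S}, restrict (subtuple x ({..<n} - S)) {..<card ({..<n} - S)})) \<in>
      measurable (gauss {..<n}) (gauss {..<card S} \<Otimes>\<^sub>M gauss {..<card ({..<n} - S)})"
      using S by (intro measurable_Pair m) auto
    moreover have "(\<lambda>(\<theta>, \<phi>). h \<theta> \<phi>) \<in> borel_measurable (gauss {..<card S} \<Otimes>\<^sub>M gauss {..<card ({..<n} - S)})"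
      using S cT[OF S] hm by simp
    ultimately show ?thesis unfolding g_eq[OF S] using measurable_compose by fastforce
  qed
  have key: "(\<Sum>\<epsilon>\<in>?E. H (conf 1 0 n x) * ennreal (gue_poly n (flip n \<epsilon> x))) = 2 ^ n * (\<Sum>S\<in>?C. ?g S x)" for x
  proof -
    have "(\<Sum>\<epsilon>\<in>?E. gue_poly n (flip n \<epsilon> x)) = (\<Sum>\<epsilon>\<in>?E. gue_poly n (\<lambda>i. \<epsilon> i * x i))"
      by (intro sum.cong refl gue_poly_cong) (simp add: flip_def)
    also have "\<dots> = 2 ^ n * (\<Sum>S\<in>?C. antigue_poly n (subtuple x S) * antigue_poly (n + 1) (subtuple x ({..<n} - S)))"
      by (rule sum_signs_gue_poly)
    finally have r: "(\<Sum>\<epsilon>\<in>?E. gue_poly n (flip n \<epsilon> x)) =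
      2 ^ n * (\<Sum>S\<in>?C. antigue_poly n (subtuple x S) * antigue_poly (n + 1) (subtuple x ({..<n} - S)))" .
    have "(\<Sum>\<epsilon>\<in>?E. ennreal (gue_poly n (flip n \<epsilon> x))) = ennreal (\<Sum>\<epsilon>\<in>?E. gue_poly n (flip n \<epsilon> x))"
      by (rule sum_ennreal) (rule gue_poly_nonneg)
    also have "\<dots> = ennreal (2 ^ n) * ennreal (\<Sum>S\<in>?C. antigue_poly n (subtuple x S) * antigue_poly (n + 1) (subtuple x ({..<n} - S)))"
      unfolding r by (rule ennreal_mult) (auto intro!: sum_nonneg mult_nonneg_nonneg antigue_poly_nonneg)
    also have "ennreal (2 ^ n) = 2 ^ n"
      by (metis ennreal_numeral ennreal_power zero_le_numeral)
    also have "ennreal (\<Sum>S\<in>?C. antigue_poly n (subtuple x S) * antigue_poly (n + 1) (subtuple x ({..<n} - S))) =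
      (\<Sum>S\<in>?C. ennreal (antigue_poly n (subtuple x S) * antigue_poly (n + 1) (subtuple x ({..<n} - S))))"
      by (rule sum_ennreal[symmetric]) (intro mult_nonneg_nonneg antigue_poly_nonneg)
    also have "\<dots> = (\<Sum>S\<in>?C. ennreal (antigue_poly n (subtuple x S)) * ennreal (antigue_poly (n + 1) (subtuple x ({..<n} - S))))"
      by (intro sum.cong refl ennreal_mult antigue_poly_nonneg)
    finally have f: "(\<Sum>\<epsilon>\<in>?E. ennreal (gue_poly n (flip n \<epsilon> x))) =
      2 ^ n * (\<Sum>S\<in>?C. ennreal (antigue_poly n (subtuple x S)) * ennreal (antigue_poly (n + 1) (subtuple x ({..<n} - S))))" .
    show ?thesis unfolding sum_distrib_left[symmetric] f by (rule mult.left_commute)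
  qed
  have "2 ^ n * ?L = (\<Sum>\<epsilon>\<in>?E. ?L)" by (simp add: card_signs)
  also have "\<dots> = (\<Sum>\<epsilon>\<in>?E. \<integral>\<^sup>+x. H (conf 1 0 n x) * ennreal (gue_poly n (flip n \<epsilon> x)) \<partial>gauss {..<n})"
  proof (rule sum.cong[OF refl])
    fix \<epsilon> assume \<epsilon>: "\<epsilon> \<in> ?E"
    show "?L = (\<integral>\<^sup>+x. H (conf 1 0 n x) * ennreal (gue_poly n (flip n \<epsilon> x)) \<partial>gauss {..<n})"
      using nn_integral_flip[OF \<epsilon> F] by (simp add: conf_flip[OF \<epsilon>])
  qed
  also have "\<dots> = (\<integral>\<^sup>+x. (\<Sum>\<epsilon>\<in>?E. H (conf 1 0 n x) * ennreal (gue_poly n (flip n \<epsilon> x))) \<partial>gauss {..<n})"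
    by (rule nn_integral_sum[symmetric]) (rule Ff)
  also have "\<dots> = 2 ^ n * (\<integral>\<^sup>+x. (\<Sum>S\<in>?C. ?g S x) \<partial>gauss {..<n})"
    unfolding key using gm by (intro nn_integral_cmult borel_measurable_sum) auto
  also have "(\<integral>\<^sup>+x. (\<Sum>S\<in>?C. ?g S x) \<partial>gauss {..<n}) = (\<Sum>S\<in>?C. \<integral>\<^sup>+x. ?g S x \<partial>gauss {..<n})"
    by (rule nn_integral_sum) (rule gm)
  also have "\<dots> = (\<Sum>S\<in>?C. ?J)" by (rule sum.cong[OF refl g_int])
  also have "\<dots> = of_nat (n choose ?m) * ?J" using n_subsets[of "{..<n}" ?m] by simp
  finally have "2 ^ n * ?L = 2 ^ n * (of_nat (n choose ?m) * ?J)" .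
  \<comment> \<open>Cancelling in \<open>ennreal\<close> needs the factor to be finite and
    non-zero.\<close>
  moreover have "(2 :: ennreal) ^ n \<noteq> Orderings.top" "(2 :: ennreal) ^ n \<noteq> 0" by (simp_all add: power_eq_top_ennreal)
  ultimately show ?thesis by (simp only: ennreal_mult_cancel_left) blast
qed

abbreviation gue_total :: "nat \<Rightarrow> real" where
  "gue_total n \<equiv> \<integral>x. gue_poly n x \<partial>gauss {..<n}"

abbreviation antigue_total :: "nat \<Rightarrow> real" where
  "antigue_total N \<equiv> \<integral>x. antigue_poly N x \<partial>gauss {..<N div 2}"

text \<open>The case H = 1 of \<open>nn_integral_gue_split\<close>. It makes the binomial
  coefficient cancel in the identity of laws and relates the constants in the identity of
  densities.\<close>

lemma gue_total_split: "gue_total n = real (n choose (n div 2)) * (antigue_total n * antigue_total (n + 1))"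
proof -
  have e: "(\<integral>\<^sup>+x. ennreal (gue_poly n x) \<partial>gauss {..<n}) = ennreal (gue_total n)"
    by (intro nn_integral_eq_integral tame_real_integrable tame_gue_poly) (auto simp: gue_poly_nonneg)
  have e': "(\<integral>\<^sup>+x. ennreal (antigue_poly N x) \<partial>gauss {..<N div 2}) = ennreal (antigue_total N)" for N
    by (intro nn_integral_eq_integral tame_real_integrable tame_antigue_poly) (auto simp: antigue_poly_nonneg)
  have m: "(\<lambda>x. ennreal (antigue_poly N x)) \<in> borel_measurable (gauss {..<N div 2})" for N
    by (rule measurable_compose[OF measurable_antigue_poly measurable_ennreal])
  have "ennreal (gue_total n) = of_nat (n choose (n div 2)) * (ennreal (antigue_total n) * ennreal (antigue_total (n + 1)))"
    using nn_integral_gue_split[of "\<lambda>_. 1" n] unfolding mult_1_left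
    by (simp only: e nn_integral_cmult[OF m] nn_integral_multc[OF m] e' borel_measurable_const)
  also have "\<dots> = ennreal (real (n choose (n div 2)) * (antigue_total n * antigue_total (n + 1)))"
    using antigue_poly_integral_pos[of n] antigue_poly_integral_pos[of "n + 1"]
    by (simp add: ennreal_mult ennreal_of_nat_eq_real_of_nat)
  finally show ?thesis
    using gue_poly_integral_pos[of n] antigue_poly_integral_pos[of n] antigue_poly_integral_pos[of "n + 1"]
    by (subst (asm) ennreal_inj) auto
qed

text \<open>Independence makes the right-hand side the image of the product of two model laws. For a
  measurable set of multisets, \<open>nn_integral_gue_split\<close> with H its indicator reduces
  both sides to the same double integral.\<close>

theorem singular_values_law:
  "distr (GUE n) mset_borel singular_values =
      distr (antiGUE n \<Otimes>\<^sub>M antiGUE (n + 1)) mset_borel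
        (\<lambda>(A, B). distinct_nonzero_singular_values A + distinct_nonzero_singular_values B)"
proof -
  let ?m = "n div 2" and ?m' = "(n + 1) div 2"
  let ?W = "weighted ?m (antigue_poly n)" and ?W' = "weighted ?m' (antigue_poly (n + 1))"
  let ?d = distinct_nonzero_singular_values
  interpret W: prob_space ?W by (rule prob_space_weighted[OF antigue_poly_nonneg tame_antigue_poly antigue_poly_integral_pos])
  interpret W': prob_space ?W' by (rule prob_space_weighted[OF antigue_poly_nonneg tame_antigue_poly antigue_poly_integral_pos])
  interpret A': prob_space "antiGUE (n + 1)" by (rule prob_space_antiGUE)
  have sf: "sigma_finite_measure (distr (antiGUE (n + 1)) mset_borel ?d)"
    by (intro prob_space_imp_sigma_finite A'.prob_space_distr measurable_distinct_nonzero)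
  have sf': "sigma_finite_measure (distr ?W' mset_borel (conf 1 0 ?m'))"
    by (intro prob_space_imp_sigma_finite W'.prob_space_distr measurable_conf_weighted)
  have mp: "(\<lambda>(A, B). (f A, g B)) \<in> measurable (M \<Otimes>\<^sub>M N) (mset_borel \<Otimes>\<^sub>M mset_borel)"
    if "f \<in> measurable M mset_borel" "g \<in> measurable N mset_borel" for f :: "'x \<Rightarrow> real multiset" and g :: "'y \<Rightarrow> real multiset" and M N
    unfolding case_prod_unfold using that by (intro measurable_Pair measurable_compose[OF measurable_fst] measurable_compose[OF measurable_snd])
  have "distr (antiGUE n \<Otimes>\<^sub>M antiGUE (n + 1)) mset_borel (\<lambda>(A, B). ?d A + ?d B) =
    distr (distr (antiGUE n \<Otimes>\<^sub>M antiGUE (n + 1)) (mset_borel \<Otimes>\<^sub>M mset_borel) (\<lambda>(A, B). (?d A, ?d B))) mset_borel (\<lambda>(X, Y). X + Y)"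
    by (subst distr_distr[OF measurable_mset_plus mp[OF measurable_distinct_nonzero measurable_distinct_nonzero]])
       (simp add: o_def case_prod_unfold)
  also have "distr (antiGUE n \<Otimes>\<^sub>M antiGUE (n + 1)) (mset_borel \<Otimes>\<^sub>M mset_borel) (\<lambda>(A, B). (?d A, ?d B)) =
     distr (antiGUE n) mset_borel ?d \<Otimes>\<^sub>M distr (antiGUE (n + 1)) mset_borel ?d"
    by (rule pair_measure_distr[OF measurable_distinct_nonzero measurable_distinct_nonzero sf, symmetric])
  also have "\<dots> = distr ?W mset_borel (conf 1 0 ?m) \<Otimes>\<^sub>M distr ?W' mset_borel (conf 1 0 ?m')"
    unfolding antiGUE_distinct_law ..
  also have "\<dots> = distr (?W \<Otimes>\<^sub>M ?W') (mset_borel \<Otimes>\<^sub>M mset_borel) (\<lambda>(\<theta>, \<phi>). (conf 1 0 ?m \<theta>, conf 1 0 ?m' \<phi>))"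
    by (rule pair_measure_distr[OF measurable_conf_weighted measurable_conf_weighted sf'])
  also have "distr \<dots> mset_borel (\<lambda>(X, Y). X + Y) = distr (?W \<Otimes>\<^sub>M ?W') mset_borel (\<lambda>(\<theta>, \<phi>). conf 1 0 ?m \<theta> + conf 1 0 ?m' \<phi>)"
    by (subst distr_distr[OF measurable_mset_plus mp[OF measurable_conf_weighted measurable_conf_weighted]])
       (simp add: o_def case_prod_unfold)
  finally have R: "distr (antiGUE n \<Otimes>\<^sub>M antiGUE (n + 1)) mset_borel (\<lambda>(A, B). ?d A + ?d B) =
     distr (?W \<Otimes>\<^sub>M ?W') mset_borel (\<lambda>(\<theta>, \<phi>). conf 1 0 ?m \<theta> + conf 1 0 ?m' \<phi>)" .
  have plus: "(\<lambda>(\<theta>, \<phi>). conf 1 0 ?m \<theta> + conf 1 0 ?m' \<phi>) \<in> measurable (?W \<Otimes>\<^sub>M ?W') mset_borel"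
    using measurable_compose[OF mp[OF measurable_conf_weighted measurable_conf_weighted] measurable_mset_plus]
    by (simp add: case_prod_unfold)
  show ?thesis unfolding GUE_singular_values_law R
  proof (rule measure_eqI)
    fix S assume "S \<in> sets (distr (weighted n (gue_poly n)) mset_borel (conf 1 0 n))"
    hence S: "S \<in> sets mset_borel" by simp
    let ?H = "indicator S :: real multiset \<Rightarrow> ennreal"
    have H: "?H \<in> borel_measurable mset_borel" using S by simp
    have dens: "(\<integral>\<^sup>+x. F x \<partial>weighted k w) = ennreal (1 / (\<integral>x. w x \<partial>gauss {..<k})) * (\<integral>\<^sup>+x. F x * ennreal (w x) \<partial>gauss {..<k})"
      if F: "F \<in> borel_measurable (gauss {..<k})" and w: "w \<in> borel_measurable (gauss {..<k})" "\<And>x. 0 \<le> w x" "0 < (\<integral>x. w x \<partial>gauss {..<k})"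
      for F :: "(nat \<Rightarrow> real) \<Rightarrow> ennreal" and k w
    proof -
      have "(\<integral>\<^sup>+x. F x \<partial>weighted k w) = (\<integral>\<^sup>+x. ennreal (w x / (\<integral>x. w x \<partial>gauss {..<k})) * F x \<partial>gauss {..<k})"
        unfolding weighted_def using F w by (intro nn_integral_density) auto
      also have "\<dots> = (\<integral>\<^sup>+x. ennreal (1 / (\<integral>x. w x \<partial>gauss {..<k})) * (F x * ennreal (w x)) \<partial>gauss {..<k})"
      proof (rule nn_integral_cong)
        fix x
        have "ennreal (w x / (\<integral>x. w x \<partial>gauss {..<k})) = ennreal (1 / (\<integral>x. w x \<partial>gauss {..<k})) * ennreal (w x)"
          using w(2,3) by (subst ennreal_mult[symmetric]) auto
        thus "ennreal (w x / (\<integral>x. w x \<partial>gauss {..<k})) * F x = ennreal (1 / (\<integral>x. w x \<partial>gauss {..<k})) * (F x * ennreal (w x))"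
          by (simp add: mult_ac)
      qed
      also have "\<dots> = ennreal (1 / (\<integral>x. w x \<partial>gauss {..<k})) * (\<integral>\<^sup>+x. F x * ennreal (w x) \<partial>gauss {..<k})"
        by (intro nn_integral_cmult borel_measurable_times_ennreal F measurable_compose[OF w(1) measurable_ennreal])
      finally show ?thesis .
    qed
    let ?J = "\<integral>\<^sup>+\<theta>. (\<integral>\<^sup>+\<phi>. ?H (conf 1 0 ?m \<theta> + conf 1 0 ?m' \<phi>) * (ennreal (antigue_poly n \<theta>) * ennreal (antigue_poly (n + 1) \<phi>))
      \<partial>gauss {..<?m'}) \<partial>gauss {..<?m}"
    have "emeasure (distr (weighted n (gue_poly n)) mset_borel (conf 1 0 n)) S = (\<integral>\<^sup>+X. ?H X \<partial>distr (weighted n (gue_poly n)) mset_borel (conf 1 0 n))"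
      using S by simp
    also have "\<dots> = (\<integral>\<^sup>+x. ?H (conf 1 0 n x) \<partial>weighted n (gue_poly n))"
      using H by (intro nn_integral_distr measurable_conf_weighted) simp
    also have "\<dots> = ennreal (1 / gue_total n) * (\<integral>\<^sup>+x. ?H (conf 1 0 n x) * ennreal (gue_poly n x) \<partial>gauss {..<n})"
      by (intro dens measurable_compose[OF measurable_conf H] measurable_gue_poly gue_poly_nonneg gue_poly_integral_pos)
    also have "\<dots> = ennreal (1 / gue_total n) * (of_nat (n choose ?m) * ?J)"
      by (simp only: nn_integral_gue_split[OF H])
    \<comment> \<open>By \<open>gue_total_split\<close> the binomial coefficient cancels and the GUE
      mass becomes the product of the two anti-GUE masses.\<close>
    also have "\<dots> = ennreal (1 / (antigue_total n * antigue_total (n + 1))) * ?J"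
    proof -
      have C: "0 < real (n choose ?m)" by simp
      have "ennreal (1 / gue_total n) * of_nat (n choose ?m) = ennreal (1 / gue_total n * real (n choose ?m))"
        unfolding ennreal_of_nat_eq_real_of_nat
        by (rule ennreal_mult[symmetric]) (use gue_poly_integral_pos[of n] in auto)
      also have "1 / gue_total n * real (n choose ?m) = 1 / (antigue_total n * antigue_total (n + 1))"
        unfolding gue_total_split using C by simp
      finally show ?thesis by (simp only: mult.assoc[symmetric])
    qed
    finally have L: "emeasure (distr (weighted n (gue_poly n)) mset_borel (conf 1 0 n)) S = ennreal (1 / (antigue_total n * antigue_total (n + 1))) * ?J" .
    let ?h = "\<lambda>\<theta> \<phi>. ?H (conf 1 0 ?m \<theta> + conf 1 0 ?m' \<phi>)"
    have mh: "(\<lambda>p. ?h (fst p) (snd p)) \<in> borel_measurable (gauss {..<?m} \<Otimes>\<^sub>M gauss {..<?m'})"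
      using measurable_compose[OF measurable_compose[OF mp[OF measurable_conf measurable_conf] measurable_mset_plus] H]
      by (simp add: case_prod_unfold)
    have mh': "(\<lambda>p. ?h (fst p) (snd p)) \<in> borel_measurable (?W \<Otimes>\<^sub>M ?W')"
      using measurable_compose[OF plus H] by (simp add: case_prod_unfold)
    have mh2: "?h \<theta> \<in> borel_measurable (gauss {..<?m'})" if "\<theta> \<in> space (gauss {..<?m})" for \<theta>
      using measurable_compose[OF measurable_Pair1'[OF that] mh] by simp
    have spW: "space (weighted k w) = space (gauss {..<k})" for k w by (simp add: weighted_def)
    have "emeasure (distr (?W \<Otimes>\<^sub>M ?W') mset_borel (\<lambda>(\<theta>, \<phi>). conf 1 0 ?m \<theta> + conf 1 0 ?m' \<phi>)) S =
      (\<integral>\<^sup>+X. ?H X \<partial>distr (?W \<Otimes>\<^sub>M ?W') mset_borel (\<lambda>(\<theta>, \<phi>). conf 1 0 ?m \<theta> + conf 1 0 ?m' \<phi>))"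
      using S by simp
    also have "\<dots> = (\<integral>\<^sup>+p. ?h (fst p) (snd p) \<partial>(?W \<Otimes>\<^sub>M ?W'))"
      using H by (subst nn_integral_distr[OF plus]) (simp_all add: case_prod_unfold)
    also have "\<dots> = (\<integral>\<^sup>+\<theta>. (\<integral>\<^sup>+\<phi>. ?h \<theta> \<phi> \<partial>?W') \<partial>?W)"
      using W'.nn_integral_fst[OF mh'] by simp
    also have "\<dots> = (\<integral>\<^sup>+\<theta>. ennreal (1 / antigue_total (n + 1)) * (\<integral>\<^sup>+\<phi>. ?h \<theta> \<phi> * ennreal (antigue_poly (n + 1) \<phi>) \<partial>gauss {..<?m'}) \<partial>?W)"
      by (intro nn_integral_cong dens mh2 measurable_antigue_poly antigue_poly_nonneg antigue_poly_integral_pos) (simp add: spW)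
    also have "\<dots> = ennreal (1 / antigue_total n) * (\<integral>\<^sup>+\<theta>. (ennreal (1 / antigue_total (n + 1)) * (\<integral>\<^sup>+\<phi>. ?h \<theta> \<phi> * ennreal (antigue_poly (n + 1) \<phi>) \<partial>gauss {..<?m'})) * ennreal (antigue_poly n \<theta>) \<partial>gauss {..<?m})"
    proof (rule dens[OF _ measurable_antigue_poly antigue_poly_nonneg antigue_poly_integral_pos])
      have "(\<lambda>p. ?h (fst p) (snd p) * ennreal (antigue_poly (n + 1) (snd p))) \<in> borel_measurable (gauss {..<?m} \<Otimes>\<^sub>M gauss {..<?m'})"
        by (intro borel_measurable_times_ennreal mh measurable_compose[OF measurable_compose[OF measurable_snd measurable_antigue_poly] measurable_ennreal])
      from sigma_finite_measure.borel_measurable_nn_integral_fst[OF prob_space_imp_sigma_finite[OF prob_space_gauss] this]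
      show "(\<lambda>\<theta>. ennreal (1 / antigue_total (n + 1)) * (\<integral>\<^sup>+\<phi>. ?h \<theta> \<phi> * ennreal (antigue_poly (n + 1) \<phi>) \<partial>gauss {..<?m'})) \<in> borel_measurable (gauss {..<?m})"
        by simp
    qed
    also have "\<dots> = ennreal (1 / antigue_total n) * (ennreal (1 / antigue_total (n + 1)) * ?J)"
    proof -
      have inner: "(\<integral>\<^sup>+\<phi>. ?h \<theta> \<phi> * (ennreal (antigue_poly n \<theta>) * ennreal (antigue_poly (n + 1) \<phi>)) \<partial>gauss {..<?m'}) =
         (\<integral>\<^sup>+\<phi>. ?h \<theta> \<phi> * ennreal (antigue_poly (n + 1) \<phi>) \<partial>gauss {..<?m'}) * ennreal (antigue_poly n \<theta>)" if "\<theta> \<in> space (gauss {..<?m})" for \<theta>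
      proof -
        have "(\<lambda>\<phi>. ?h \<theta> \<phi> * ennreal (antigue_poly (n + 1) \<phi>)) \<in> borel_measurable (gauss {..<?m'})"
          by (intro borel_measurable_times_ennreal mh2[OF that] measurable_compose[OF measurable_antigue_poly measurable_ennreal])
        from nn_integral_multc[OF this, of "ennreal (antigue_poly n \<theta>)"] show ?thesis
          by (simp add: mult_ac)
      qed
      have "(\<lambda>p. ?h (fst p) (snd p) * (ennreal (antigue_poly n (fst p)) * ennreal (antigue_poly (n + 1) (snd p)))) \<in> borel_measurable (gauss {..<?m} \<Otimes>\<^sub>M gauss {..<?m'})"
        by (intro borel_measurable_times_ennreal mh measurable_compose[OF measurable_compose[OF measurable_snd measurable_antigue_poly] measurable_ennreal]
          measurable_compose[OF measurable_compose[OF measurable_fst measurable_antigue_poly] measurable_ennreal])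
      from sigma_finite_measure.borel_measurable_nn_integral_fst[OF prob_space_imp_sigma_finite[OF prob_space_gauss] this]
      have m: "(\<lambda>\<theta>. \<integral>\<^sup>+\<phi>. ?h \<theta> \<phi> * (ennreal (antigue_poly n \<theta>) * ennreal (antigue_poly (n + 1) \<phi>)) \<partial>gauss {..<?m'}) \<in> borel_measurable (gauss {..<?m})"
        by simp
      show ?thesis
        unfolding nn_integral_cmult[OF m, symmetric]
        by (intro arg_cong[where f = "\<lambda>z. ennreal (1 / antigue_total n) * z"] nn_integral_cong) (simp only: inner mult.assoc)
    qed
    also have "\<dots> = ennreal (1 / (antigue_total n * antigue_total (n + 1))) * ?J"
      using antigue_poly_integral_pos[of n] antigue_poly_integral_pos[of "n + 1"]
      by (simp add: mult.assoc[symmetric] ennreal_mult[symmetric])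
    finally show "emeasure (distr (weighted n (gue_poly n)) mset_borel (conf 1 0 n)) S =
      emeasure (distr (?W \<Otimes>\<^sub>M ?W') mset_borel (\<lambda>(\<theta>, \<phi>). conf 1 0 ?m \<theta> + conf 1 0 ?m' \<phi>)) S"
      using L by simp
  qed simp
qed

subsection \<open>Normalizing constants\<close>

lemma gue_weight_eq: "gue_weight n x = gue_poly n x * exp (- (1 / 2) * (\<Sum>i<n. (x i)\<^sup>2))"
  by (simp add: gue_weight_def gue_poly_def)

lemma antigue_weight_eq: "antigue_weight N x = antigue_poly N x * exp (- (1 / 2) * (\<Sum>i<N div 2. (x i)\<^sup>2))"
  by (simp add: antigue_weight_def antigue_poly_def Let_def)

lemma gue_const_eq: "gue_const n = 1 / (sqrt (2 * pi) ^ n * gue_total n)"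
  unfolding gue_const_def gue_weight_eq lborel_integral_gauss[OF measurable_gue_poly] ..

text \<open>The constant normalizes over the orthant, while \<open>antigue_total\<close> integrates
  over the whole space; evenness makes the two integrals differ by 2^(N div 2).\<close>

lemma antigue_const_eq: "antigue_const N = 2 ^ (N div 2) / (sqrt (2 * pi) ^ (N div 2) * antigue_total N)"
proof -
  let ?m = "N div 2"
  let ?O = "{..<?m} \<rightarrow>\<^sub>E {0 :: real..}"
  have O: "?O \<in> sets (gauss {..<?m})" by (intro sets_PiM_I_finite) auto
  have "(LINT \<theta>:?O | PiM {..<?m} (\<lambda>_. lborel). antigue_weight N \<theta>) =
     (LINT \<theta> | PiM {..<?m} (\<lambda>_. lborel). (indicator ?O \<theta> * antigue_poly N \<theta>) * exp (- (1 / 2) * (\<Sum>i<?m. (\<theta> i)\<^sup>2)))"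
    unfolding set_lebesgue_integral_def antigue_weight_eq by (simp add: mult.assoc)
  also have "\<dots> = sqrt (2 * pi) ^ ?m * (\<integral>\<theta>. indicator ?O \<theta> * antigue_poly N \<theta> \<partial>gauss {..<?m})"
    by (intro lborel_integral_gauss borel_measurable_times borel_measurable_indicator O measurable_antigue_poly)
  also have "antigue_total N = 2 ^ ?m * (\<integral>\<theta>. indicator ?O \<theta> * antigue_poly N \<theta> \<partial>gauss {..<?m})"
  proof (rule orthant_integral[OF tame_real_integrable[OF _ tame_antigue_poly]])
    fix \<epsilon> :: "nat \<Rightarrow> real" and x assume \<epsilon>: "\<epsilon> \<in> {..<?m} \<rightarrow>\<^sub>E {1, -1}"
    have sq: "(flip ?m \<epsilon> x j)\<^sup>2 = (x j)\<^sup>2" if "j < ?m" for j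
    proof -
      have "\<epsilon> j = 1 \<or> \<epsilon> j = -1" using \<epsilon> that by auto
      thus ?thesis using that by (auto simp: flip_def power_mult_distrib)
    qed
    show "antigue_poly N (flip ?m \<epsilon> x) = antigue_poly N x"
      unfolding antigue_poly_def power_mult by (intro arg_cong2[where f = "(*)"] prod.cong refl) (auto simp: sq)
  qed simp
  hence "(\<integral>\<theta>. indicator ?O \<theta> * antigue_poly N \<theta> \<partial>gauss {..<?m}) = antigue_total N / 2 ^ ?m" by simp
  finally show ?thesis unfolding antigue_const_def by simp
qed

text \<open>The factor 2^n of the sign sum is absorbed by the orthant factors 2^(n div 2) and 2^((n
  + 1) div 2) in the two anti-GUE constants. The exponential depends on the squares only, which
  split over S and its complement.\<close>

theorem density_identity:
  fixes x :: "nat \<Rightarrow> real"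
  shows "(\<Sum>\<epsilon> \<in> {..<n} \<rightarrow>\<^sub>E {1, -1}. gue_density n (\<lambda>i. \<epsilon> i * x i)) =
      1 / real (n choose (n div 2)) *
      (\<Sum>S \<in> {S. S \<subseteq> {..<n} \<and> card S = n div 2}.
         antigue_density n (subtuple x S) *
         antigue_density (n + 1) (subtuple x ({..<n} - S)))"
proof -
  let ?E = "{..<n} \<rightarrow>\<^sub>E {1, -1 :: real}" and ?C = "{S. S \<subseteq> {..<n} \<and> card S = n div 2}"
  let ?m = "n div 2" and ?m' = "(n + 1) div 2"
  define e where "e = exp (- (1 / 2) * (\<Sum>i<n. (x i)\<^sup>2))"
  have sq: "(\<Sum>i<card S. (subtuple x S i)\<^sup>2) = (\<Sum>i\<in>S. (x i)\<^sup>2)" if "finite S" for S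
  proof -
    have bij: "bij_betw (\<lambda>k. sorted_list_of_set S ! k) {..<card S} S"
      using bij_betw_nth[of "sorted_list_of_set S" "{..<card S}" S] that by simp
    show ?thesis unfolding subtuple_def by (rule sum.reindex_bij_betw[OF bij])
  qed
  have gs: "gue_density n (\<lambda>i. \<epsilon> i * x i) = gue_const n * e * gue_poly n (\<lambda>i. \<epsilon> i * x i)" if "\<epsilon> \<in> ?E" for \<epsilon>
  proof -
    have "(\<epsilon> i * x i)\<^sup>2 = (x i)\<^sup>2" if "i \<in> {..<n}" for i
    proof -
      have "\<epsilon> i = 1 \<or> \<epsilon> i = -1" using \<open>\<epsilon> \<in> ?E\<close> that by auto
      thus ?thesis by auto
    qed
    hence "(\<Sum>i<n. (\<epsilon> i * x i)\<^sup>2) = (\<Sum>i<n. (x i)\<^sup>2)" by (rule sum.cong[OF refl])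
    thus ?thesis by (simp add: gue_density_def gue_weight_eq e_def)
  qed
  have as: "antigue_density n (subtuple x S) * antigue_density (n + 1) (subtuple x ({..<n} - S)) =
     antigue_const n * antigue_const (n + 1) * e * (antigue_poly n (subtuple x S) * antigue_poly (n + 1) (subtuple x ({..<n} - S)))"
    if S: "S \<in> ?C" for S
  proof -
    have fin: "finite S" using S by (auto intro: finite_subset)
    have c: "card S = ?m" "card ({..<n} - S) = ?m'" using S fin by (auto simp: card_Diff_subset)
    have "(\<Sum>i<n. (x i)\<^sup>2) = (\<Sum>i<?m. (subtuple x S i)\<^sup>2) + (\<Sum>i<?m'. (subtuple x ({..<n} - S) i)\<^sup>2)"
      using sq[OF fin] sq[of "{..<n} - S"] S c by (simp add: sum.subset_diff[of S "{..<n}"])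
    hence "e = exp (- (1 / 2) * (\<Sum>i<?m. (subtuple x S i)\<^sup>2)) * exp (- (1 / 2) * (\<Sum>i<?m'. (subtuple x ({..<n} - S) i)\<^sup>2))"
      by (simp add: e_def mult_exp_exp algebra_simps add_divide_distrib)
    thus ?thesis by (simp add: antigue_density_def antigue_weight_eq)
  qed
  have mm: "?m + ?m' = n" by presburger
  have pw: "a ^ ?m * a ^ ?m' = a ^ n" for a :: real by (simp only: power_add[symmetric] mm)
  have "1 / real (n choose ?m) * (antigue_const n * antigue_const (n + 1)) =
     (2 ^ ?m * 2 ^ ?m') / ((sqrt (2 * pi) ^ ?m * sqrt (2 * pi) ^ ?m') * (real (n choose ?m) * (antigue_total n * antigue_total (n + 1))))"
    unfolding antigue_const_eq by simp
  also have "\<dots> = gue_const n * 2 ^ n"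
    unfolding pw gue_const_eq gue_total_split by simp
  finally have const: "gue_const n * 2 ^ n = 1 / real (n choose ?m) * (antigue_const n * antigue_const (n + 1))" by simp
  have "(\<Sum>\<epsilon>\<in>?E. gue_density n (\<lambda>i. \<epsilon> i * x i)) = gue_const n * e * (\<Sum>\<epsilon>\<in>?E. gue_poly n (\<lambda>i. \<epsilon> i * x i))"
    unfolding sum_distrib_left by (rule sum.cong[OF refl gs])
  also have "\<dots> = gue_const n * 2 ^ n * e * (\<Sum>S\<in>?C. antigue_poly n (subtuple x S) * antigue_poly (n + 1) (subtuple x ({..<n} - S)))"
    unfolding sum_signs_gue_poly by (simp only: mult_ac)
  also have "\<dots> = 1 / real (n choose ?m) * (\<Sum>S\<in>?C. antigue_const n * antigue_const (n + 1) * e * (antigue_poly n (subtuple x S) * antigue_poly (n + 1) (subtuple x ({..<n} - S))))"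
    unfolding const sum_distrib_left[symmetric] by (simp only: mult.assoc)
  also have "(\<Sum>S\<in>?C. antigue_const n * antigue_const (n + 1) * e * (antigue_poly n (subtuple x S) * antigue_poly (n + 1) (subtuple x ({..<n} - S)))) =
     (\<Sum>S\<in>?C. antigue_density n (subtuple x S) * antigue_density (n + 1) (subtuple x ({..<n} - S)))"
    by (rule sum.cong[OF refl as[symmetric]])
  finally show ?thesis .
qed

theorem theorem1:
  fixes n :: nat
  assumes "n \<ge> 1"
  shows "singular_values \<in> measurable (GUE n) mset_borel \<and>
    (\<lambda>(A, B). distinct_nonzero_singular_values A + distinct_nonzero_singular_values B)
      \<in> measurable (antiGUE n \<Otimes>\<^sub>M antiGUE (n + 1)) mset_borel \<and>
    distr (GUE n) mset_borel singular_values =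
      distr (antiGUE n \<Otimes>\<^sub>M antiGUE (n + 1)) mset_borel
        (\<lambda>(A, B). distinct_nonzero_singular_values A + distinct_nonzero_singular_values B) \<and>
    (\<forall>x :: nat \<Rightarrow> real. (\<forall>i<n. 0 \<le> x i) \<longrightarrow>
      (\<Sum>\<epsilon> \<in> {..<n} \<rightarrow>\<^sub>E {1, -1}. gue_density n (\<lambda>i. \<epsilon> i * x i)) =
      1 / real (n choose (n div 2)) *
      (\<Sum>S \<in> {S. S \<subseteq> {..<n} \<and> card S = n div 2}.
         antigue_density n (subtuple x S) *
         antigue_density (n + 1) (subtuple x ({..<n} - S))))"
proof (intro conjI allI impI)
  show "singular_values \<in> measurable (GUE n) mset_borel"
    unfolding GUE_def using measurable_singular_values by simp
  have "(\<lambda>(A, B). (distinct_nonzero_singular_values A, distinct_nonzero_singular_values B))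
      \<in> measurable (antiGUE n \<Otimes>\<^sub>M antiGUE (n + 1)) (mset_borel \<Otimes>\<^sub>M mset_borel)"
    unfolding case_prod_unfold
    by (intro measurable_Pair measurable_compose[OF measurable_fst measurable_distinct_nonzero]
        measurable_compose[OF measurable_snd measurable_distinct_nonzero])
  from measurable_compose[OF this measurable_mset_plus]
  show "(\<lambda>(A, B). distinct_nonzero_singular_values A + distinct_nonzero_singular_values B)
      \<in> measurable (antiGUE n \<Otimes>\<^sub>M antiGUE (n + 1)) mset_borel"
    by (simp add: case_prod_unfold)
qed (rule singular_values_law density_identity)+

end
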